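(* For all integers $k\ge1$ and $n\ge0$, $$e_6(13^{2k}n+\delta_{13,2k})\equiv0\pmod{13^{2k}}.$$
   Context: $q=e^{2\pi i\tau}$, $(q;q)_\infty=\prod_{n\ge1}(1-q^n)$, $E_6(\tau)=1-504\sum_{n\ge1}\sigma_5(n)q^n$ with $\sigma_5(n)=\sum_{d\mid n}d^5$. The numbers $e_6(n)$ are defined by $\sum_{n\ge0}e_6(n)q^n=E_6(\tau)/(q;q)_\infty$. For a prime $\ell\ge5$ and $k\ge1$, $\delta_{\ell,k}$ is the integer with $0<\delta_{\ell,k}<\ell^k$ and $24\delta_{\ell,k}\equiv1\pmod{\ell^k}$. *)

theory Defs
  imports "HOL-Analysis.Infinite_Products" "HOL-Number_Theory.Number_Theory"
    "HOL-Computational_Algebra.Formal_Power_Series"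
begin

text \<open>
  The variable \<open>q\<close> is the indeterminate \<^const>\<open>fps_X\<close>, and the \<open>q\<close>-series are formal power
  series over the integers.
\<close>

definition divisor_sigma :: "nat \<Rightarrow> nat \<Rightarrow> nat" where
  "divisor_sigma s n = (\<Sum>d | d dvd n. d ^ s)"

definition E6 :: "int fps" where
  "E6 = Abs_fps (\<lambda>n. if n = 0 then 1 else - 504 * int (divisor_sigma 5 n))"

text \<open>The infinite product is taken in the \<open>q\<close>-adic metric on formal power series.\<close>

definition q_pochhammer :: "int fps" where
  "q_pochhammer = (\<Prod>n. 1 - fps_X ^ Suc n)"

text \<open>
  The library's division of formal power series needs a field of coefficients. Over the
  integers, a series with constant coefficient 1 is a unit and \<open>fps_right_inverse _ 1\<close> is its
  inverse; see \<open>q_pochhammer_times_e6_fps\<close> and \<open>e6_fps_unique\<close> below.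
\<close>

definition e6_fps :: "int fps" where
  "e6_fps = E6 * fps_right_inverse q_pochhammer 1"

definition e6 :: "nat \<Rightarrow> int" where
  "e6 n = fps_nth e6_fps n"

definition delta :: "nat \<Rightarrow> nat \<Rightarrow> nat" where
  "delta l k = (THE d. 0 < d \<and> d < l ^ k \<and> [24 * d = 1] (mod l ^ k))"

lemma has_prod_q_pochhammer:
  "(\<lambda>n. 1 - fps_X ^ Suc n :: int fps) has_prod q_pochhammer"
  and q_pochhammer_nth_0: "fps_nth q_pochhammer 0 = 1"
proof -
  define P :: "nat \<Rightarrow> int fps" where "P = (\<lambda>n. \<Prod>i\<le>n. 1 - fps_X ^ Suc i)"
  define L where "L = Abs_fps (\<lambda>m. fps_nth (P m) m)"
  have step: "fps_nth (P (Suc n)) m = fps_nth (P n) m" if "m \<le> n" for m n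
  proof -
    have "P (Suc n) = P n - P n * fps_X ^ Suc (Suc n)"
      by (simp add: P_def algebra_simps)
    then show ?thesis
      using that by (simp only: fps_sub_nth fps_X_power_mult_right_nth) simp
  qed
  have stable: "fps_nth (P n) m = fps_nth (P m) m" if "m \<le> n" for m n
    using that by (induction n rule: dec_induct) (simp_all add: step)
  have "P \<longlonglongrightarrow> L"
  proof (rule tendsto_fpsI)
    fix m
    show "eventually (\<lambda>n. fps_nth (P n) m = fps_nth L m) sequentially"
      unfolding L_def fps_nth_Abs_fps
      using eventually_ge_at_top[of m] by eventually_elim (rule stable)
  qed
  moreover have L0: "fps_nth L 0 = 1"
    by (simp add: L_def P_def)
  moreover from L0 have "L \<noteq> 0"
    by auto
  ultimately have *: "(\<lambda>n. 1 - fps_X ^ Suc n :: int fps) has_prod L"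
    by (simp add: has_prod_def raw_has_prod_def P_def)
  then have "L = q_pochhammer"
    unfolding q_pochhammer_def by (rule has_prod_unique)
  with * L0 show "(\<lambda>n. 1 - fps_X ^ Suc n :: int fps) has_prod q_pochhammer"
    and "fps_nth q_pochhammer 0 = 1"
    by simp_all
qed

lemma q_pochhammer_times_e6_fps: "q_pochhammer * e6_fps = E6"
proof -
  have "q_pochhammer * fps_right_inverse q_pochhammer 1 = 1"
    by (rule fps_right_inverse) (simp add: q_pochhammer_nth_0)
  then show ?thesis
    by (simp add: e6_fps_def mult.left_commute)
qed

lemma e6_fps_unique: "q_pochhammer * f = E6 \<longleftrightarrow> f = e6_fps"
proof -
  have "q_pochhammer \<noteq> 0"
    using q_pochhammer_nth_0 by auto
  then show ?thesis
    by (metis mult_left_cancel q_pochhammer_times_e6_fps)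
qed

lemma delta_ex1:
  fixes l k :: nat
  assumes "prime l" "l \<ge> 5" "k \<ge> 1"
  shows "\<exists>!d. 0 < d \<and> d < l ^ k \<and> [24 * d = 1] (mod l ^ k)"
proof -
  have gt: "l ^ k > 1"
    using assms by (intro one_less_power) auto
  have "\<not> l dvd 24"
  proof
    assume "l dvd 24"
    then have "l dvd 2 ^ 3 * 3"
      by simp
    then have "l dvd 2 \<or> l dvd 3"
      using assms(1) prime_dvd_mult_iff prime_dvd_power by blast
    then show False
      using assms(2) by (auto dest: dvd_imp_le)
  qed
  then have cop: "coprime 24 (l ^ k)"
    using assms(1) by (metis coprime_commute coprime_power_right_iff prime_imp_coprime)
  then obtain x where x: "[24 * x = 1] (mod l ^ k)"
    by (auto simp: coprime_iff_invertible_nat)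
  define d where "d = x mod l ^ k"
  have d: "[24 * d = 1] (mod l ^ k)"
    using x by (simp add: d_def cong_def mod_mult_right_eq)
  show ?thesis
  proof (rule ex1I[of _ d])
    have "d \<noteq> 0"
      using d gt by (intro notI) (auto simp: cong_def)
    moreover have "d < l ^ k"
      unfolding d_def using gt by (intro mod_less_divisor) linarith
    ultimately show "0 < d \<and> d < l ^ k \<and> [24 * d = 1] (mod l ^ k)"
      using d by blast
  next
    fix e assume e: "0 < e \<and> e < l ^ k \<and> [24 * e = 1] (mod l ^ k)"
    then have "[24 * e = 24 * d] (mod l ^ k)"
      using d cong_trans cong_sym by blast
    then have "[e = d] (mod l ^ k)"
      using cop by (simp add: cong_mult_lcancel_nat)
    then show "e = d"
      using e gt by (simp add: cong_def d_def)
  qed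
qed

end

theory Submission
  imports Defs "HOL-Complex_Analysis.Complex_Analysis"
begin

text \<open>
  The series \<open>F = E\<^sub>6 / \<eta>\<close> has weight 11/2 for the full modular group (with the multiplier of
  \<open>1 / \<eta>\<close>), and \<open>e\<^sub>6 n\<close> is its coefficient at \<open>q\<close> to the power \<open>n - 1 / 24\<close>. The Hecke operator
  \<open>T\<close> of index \<open>13\<^sup>2\<close> acts on such forms by
  \<open>T a n = a (169 n - 7) \<plusminus> 13\<^sup>4 \<chi> (24 n - 1) a n + 13\<^sup>9 a ((n + 7) / 169)\<close>.
  A form of this weight is determined by its coefficients at \<open>n \<le> 0\<close>, and since the forms
  \<open>E\<^sub>6\<close> to the power \<open>2 m + 1\<close> times \<open>\<eta>\<close> to the power \<open>- 24 m - 1\<close> have integral coefficients and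
  leading coefficient 1, any common divisor of the coefficients at \<open>n \<le> 0\<close> divides all of them.
  So consider the forms whose coefficient at each \<open>n \<le> 0\<close> is divisible by \<open>13\<close> to the power \<open>2 e\<close>
  whenever \<open>13\<close> to the power \<open>e\<close> divides \<open>24 n - 1\<close>; \<open>F\<close> is one of them. The formula for \<open>T\<close> shows
  that \<open>T\<close> maps this lattice to \<open>13\<^sup>4\<close> times itself. As \<open>\<chi>\<close> vanishes on multiples of 13, solving for
  \<open>a (169 n - 7)\<close> gives by induction that applying \<open>n \<mapsto> 169 n - 7\<close> to the index \<open>k\<close> times makes the
  coefficient divisible by \<open>13\<close> to the power \<open>4 k\<close>.
\<close>

section \<open>Lipschitz summation formula\<close>

text \<open>The obstacle is the multiplier of 1 / eta. No closed formula for it is used: the Hecke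
  operator is a finite sum over translates, and its behaviour under t -> - 1 / t needs the
  multiplier only at 12 matrices with lower left entry 13 and at 156 matrices with lower left entry
  169, where it is computed. The translations are by multiples of 24 / 13 and 24 / 169, so that q to
  the power n - 1 / 24 acquires a root of unity with exponent proportional to 24 n - 1. This makes
  24 n - 1 the natural index, and n -> 169 n - 7 is the map that multiplies it by 169. The constants
  13 ^ 4 and 13 ^ 9 are p ^ (k - 1) and p ^ (2 k - 1) for p = 13 and weight k + 1 / 2 with k = 5.
  The open sign in the operator is that of a quadratic Gauss sum. It need not be determined, because
  the term that carries it is only tested for divisibility. The inversion law of eta is obtained by
  integrating that of E2, which is its logarithmic derivative up to a constant factor.\<close>

definition to_q :: "complex \<Rightarrow> complex" where
  "to_q z = exp (2 * pi * \<i> * z)"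

lemma norm_to_q: "norm (to_q z) = exp (- 2 * pi * Im z)"
  by (simp add: to_q_def norm_exp_eq_Re)

lemma norm_to_q_less_1: "Im z > 0 \<Longrightarrow> norm (to_q z) < 1"
  by (simp add: norm_to_q)

lemma to_q_nonzero [simp]: "to_q z \<noteq> 0"
  by (simp add: to_q_def)

lemma to_q_power: "to_q z ^ n = to_q (of_nat n * z)"
  by (simp add: to_q_def exp_of_nat_mult [symmetric] mult_ac)

lemma has_field_derivative_to_q [derivative_intros]:
  assumes "(f has_field_derivative f') (at z within A)"
  shows "((\<lambda>z. to_q (f z)) has_field_derivative (2 * pi * \<i> * f' * to_q (f z))) (at z within A)"
  unfolding to_q_def using assms by (auto intro!: derivative_eq_intros)

text \<open>The logarithmic derivative of Euler's reflection formula, taken for the entire function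
  \<open>rGamma\<close>.\<close>

lemma Digamma_reflection:
  fixes z :: complex
  assumes "z \<notin> \<int>"
  shows "Digamma (1 - z) - Digamma z = pi * cot (pi * z)"
proof -
  have nz: "z \<notin> \<int>\<^sub>\<le>\<^sub>0" "1 - z \<notin> \<int>\<^sub>\<le>\<^sub>0"
    using assms Ints_diff [OF Ints_1, of "1 - z"] by (auto dest: nonpos_Ints_Int)
  have sin_nz: "sin (of_real pi * z) \<noteq> 0"
    using assms by (auto simp: sin_eq_0)
  have "((\<lambda>z. rGamma z * rGamma (1 - z)) has_field_derivative
          rGamma z * rGamma (1 - z) * (Digamma (1 - z) - Digamma z)) (at z)"
    using nz by (auto intro!: derivative_eq_intros simp: algebra_simps)
  moreover have "(\<lambda>z. rGamma z * rGamma (1 - z)) = (\<lambda>z::complex. sin (of_real pi * z) / of_real pi)"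
    by (intro ext rGamma_reflection_complex)
  moreover have "((\<lambda>z::complex. sin (of_real pi * z) / of_real pi) has_field_derivative cos (of_real pi * z)) (at z)"
    by (auto intro!: derivative_eq_intros)
  ultimately have "rGamma z * rGamma (1 - z) * (Digamma (1 - z) - Digamma z) = cos (of_real pi * z)"
    using DERIV_unique by metis
  then show ?thesis
    using sin_nz by (simp add: rGamma_reflection_complex cot_def field_simps)
qed

lemma cot_pi_eq_to_q:
  fixes z :: complex
  assumes "to_q z \<noteq> 1"
  shows "cot (pi * z) = - \<i> * (1 + to_q z) / (1 - to_q z)"
proof -
  define e where "e = exp (\<i> * (pi * z))"
  have e: "e \<noteq> 0" "exp (- (\<i> * (pi * z))) = inverse e" "to_q z = e * e"
    by (auto simp: e_def exp_minus to_q_def exp_add [symmetric] mult_ac)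
  have "x / 2 / (y / (2 * \<i>)) = \<i> * x / y" for x y :: complex
    by (cases "y = 0") (simp_all add: divide_simps)
  note this [of "e + inverse e" "e - inverse e"]
  then have "cot (pi * z) = \<i> * (e + inverse e) / (e - inverse e)"
    unfolding cot_def cos_exp_eq sin_exp_eq e(2) e_def [symmetric] .
  also have "\<dots> = - \<i> * (1 + e * e) / (1 - e * e)"
    using assms e by (simp add: divide_simps) (simp add: algebra_simps)
  finally show ?thesis
    by (simp add: e)
qed

lemma not_Ints_if_Im: "Im z \<noteq> 0 \<Longrightarrow> z \<notin> \<int>"
  by (auto elim!: Ints_cases)

text \<open>The polylogarithm of order - r when r > 0. At r = 0 the term n = 0 is 0 ^ 0 = 1, so the
  value is 1 / (1 - q).\<close>

definition power_fps :: "nat \<Rightarrow> complex fps" where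
  "power_fps r = Abs_fps (\<lambda>n. of_nat n ^ r)"

lemma power_fps_Suc: "power_fps (Suc r) = fps_X * fps_deriv (power_fps r)"
  by (auto simp: power_fps_def fps_eq_iff)

lemma power_fps_0: "eval_fps (power_fps 0) q = 1 / (1 - q)" if "norm q < 1"
  using that suminf_geometric [of q] by (simp add: eval_fps_def power_fps_def)

lemma conv_radius_power_fps: "fps_conv_radius (power_fps r) \<ge> 1"
proof (induction r)
  case 0
  have "summable (\<lambda>n. 1 * q ^ n)" if "norm q < 1" for q :: complex
    using that by (simp add: summable_geometric)
  then show ?case
    unfolding fps_conv_radius_def power_fps_def
    by (intro conv_radius_geI_ex') (auto simp: norm_of_real)
next
  case (Suc r)
  have "1 \<le> min (fps_conv_radius (fps_X :: complex fps)) (fps_conv_radius (fps_deriv (power_fps r)))"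
    using order_trans [OF Suc fps_conv_radius_deriv] by simp
  also have "\<dots> \<le> fps_conv_radius (power_fps (Suc r))"
    unfolding power_fps_Suc by (rule fps_conv_radius_mult)
  finally show ?case .
qed

lemma ereal_norm_less_radius: "norm q < 1 \<Longrightarrow> fps_conv_radius f \<ge> 1 \<Longrightarrow> ereal (norm q) < fps_conv_radius f"
  by (metis ereal_less(3) less_ereal.simps(1) one_ereal_def order_less_le_trans)

lemma eval_power_fps_Suc:
  assumes "norm q < 1"
  shows "eval_fps (power_fps (Suc r)) q = q * eval_fps (fps_deriv (power_fps r)) q"
  unfolding power_fps_Suc
  by (subst eval_fps_mult)
    (use assms in \<open>auto intro!: ereal_norm_less_radius order_trans [OF conv_radius_power_fps fps_conv_radius_deriv]\<close>)

lemma has_field_derivative_power_fps_to_q: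
  assumes "Im z > 0"
  shows "((\<lambda>z. eval_fps (power_fps r) (to_q z)) has_field_derivative
           2 * pi * \<i> * eval_fps (power_fps (Suc r)) (to_q z)) (at z)"
  by (rule derivative_eq_intros refl has_field_derivative_eval_fps
        ereal_norm_less_radius norm_to_q_less_1 assms conv_radius_power_fps)+
    (simp add: eval_power_fps_Suc norm_to_q_less_1 assms)

text \<open>With q = \<open>to_q z\<close>, the case r = 0 is pi cot (pi z) = pi i - 2 pi i / (1 -
  q). Each further derivative in z removes the constant, changes the sign of the term in 1 - z and
  acts on the series as 2 pi i q d/dq.\<close>

lemma Polygamma_reflection_to_q:
  assumes "Im z > 0"
  shows "(-1) ^ r * Polygamma r (1 - z) - Polygamma r z =
           (if r = 0 then pi * \<i> else 0) - (2 * pi * \<i>) ^ Suc r * eval_fps (power_fps r) (to_q z)"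
  using assms
proof (induction r arbitrary: z)
  case 0
  have ne: "1 - to_q z \<noteq> 0"
    using norm_to_q_less_1 [OF 0] by auto
  have "Digamma (1 - z) - Digamma z = pi * cot (pi * z)"
    by (rule Digamma_reflection) (use 0 in \<open>auto intro!: not_Ints_if_Im\<close>)
  also have "\<dots> = pi * (- \<i> * (1 + to_q z) / (1 - to_q z))"
    using ne by (subst cot_pi_eq_to_q) auto
  finally show ?case
    using ne norm_to_q_less_1 [OF 0] by (simp add: power_fps_0 field_simps)
next
  case (Suc r)
  define C :: complex where "C = (if r = 0 then pi * \<i> else 0)"
  have nz: "z \<notin> \<int>\<^sub>\<le>\<^sub>0" "1 - z \<notin> \<int>\<^sub>\<le>\<^sub>0"
    using Suc.prems not_Ints_if_Im [of z] not_Ints_if_Im [of "1 - z"] by (auto dest: nonpos_Ints_Int)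
  have 1: "((\<lambda>z. (-1) ^ r * Polygamma r (1 - z) - Polygamma r z) has_field_derivative
          (-1) ^ Suc r * Polygamma (Suc r) (1 - z) - Polygamma (Suc r) z) (at z)"
    using nz by (auto intro!: derivative_eq_intros)
  have "((\<lambda>z. C - (2 * pi * \<i>) ^ Suc r * eval_fps (power_fps r) (to_q z)) has_field_derivative
          - ((2 * pi * \<i>) ^ Suc (Suc r) * eval_fps (power_fps (Suc r)) (to_q z))) (at z)"
    by (rule derivative_eq_intros refl has_field_derivative_power_fps_to_q Suc.prems)+ simp
  then have 2: "((\<lambda>z. (-1) ^ r * Polygamma r (1 - z) - Polygamma r z) has_field_derivative
          - ((2 * pi * \<i>) ^ Suc (Suc r) * eval_fps (power_fps (Suc r)) (to_q z))) (at z)"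
  proof (rule has_field_derivative_transform_within_open [where S = "{z. Im z > 0}"])
    show "open {z. Im z > 0}"
      by (rule open_halfspace_Im_gt)
    show "C - (2 * pi * \<i>) ^ Suc r * eval_fps (power_fps r) (to_q x) =
            (-1) ^ r * Polygamma r (1 - x) - Polygamma r x" if "x \<in> {z. 0 < Im z}" for x
      using Suc.IH [of x] that unfolding C_def by simp
  qed (use Suc.prems in auto)
  from DERIV_unique [OF 1 2] show ?case
    by simp
qed

lemma has_sum_int_iff_nat:
  fixes f :: "int \<Rightarrow> 'a :: banach"
  assumes "f summable_on UNIV"
    and "(\<lambda>n. f (int n)) sums a" and "(\<lambda>n. f (- 1 - int n)) sums b"
  shows "(f has_sum (a + b)) UNIV"
proof -
  have bij1: "bij_betw int UNIV {0..}"
    by (rule bij_betwI [where g = nat]) auto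
  have bij2: "bij_betw (\<lambda>n. - 1 - int n) UNIV {..-1}"
    by (rule bij_betwI [where g = "\<lambda>n. nat (- 1 - n)"]) auto
  have s1: "f summable_on {0..}" and s2: "f summable_on {..-1}"
    by (rule summable_on_subset_banach [OF assms(1)], simp)+
  have "((\<lambda>n. f (int n)) has_sum infsum f {0..}) UNIV"
    using has_sum_reindex_bij_betw [OF bij1, of f] s1 by auto
  then have a: "infsum f {0..} = a"
    using assms(2) by (metis has_sum_imp_sums sums_unique2)
  have "((\<lambda>n. f (- 1 - int n)) has_sum infsum f {..-1}) UNIV"
    using has_sum_reindex_bij_betw [OF bij2, of f] s2 by auto
  then have b: "infsum f {..-1} = b"
    using assms(3) by (metis has_sum_imp_sums sums_unique2)
  have "(f has_sum (a + b)) ({0..} \<union> {..-1})"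
    using s1 s2 by (intro has_sum_Un_disjoint) (auto simp: a [symmetric] b [symmetric])
  also have "{0..} \<union> {..-1} = (UNIV :: int set)"
    by auto
  finally show ?thesis .
qed

text \<open>The terms with n >= 0 and those with n < 0 add up to Polygamma values at z and 1 - z,
  which the reflection formula combines.\<close>

lemma Lipschitz_formula:
  assumes "Im z > 0" "r > 0" "(\<lambda>n::int. 1 / (z + of_int n) ^ Suc r) summable_on UNIV"
  shows "((\<lambda>n::int. 1 / (z + of_int n) ^ Suc r) has_sum
           (- 2 * pi * \<i>) ^ Suc r / fact r * eval_fps (power_fps r) (to_q z)) UNIV"
proof -
  have nz: "z \<noteq> 0" "1 - z \<noteq> 0"
    using assms by auto
  have "(\<lambda>k. inverse ((z + of_nat k) ^ Suc r)) sums ((-1) ^ Suc r * Polygamma r z / fact r)"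
    using nz assms by (intro Polygamma_LIMSEQ) auto
  then have 1: "(\<lambda>n. 1 / (z + of_int (int n)) ^ Suc r) sums ((-1) ^ Suc r * Polygamma r z / fact r)"
    by (simp add: field_simps)
  have "(\<lambda>k. (-1) ^ Suc r * inverse ((1 - z + of_nat k) ^ Suc r)) sums
          ((-1) ^ Suc r * ((-1) ^ Suc r * Polygamma r (1 - z) / fact r))"
    using nz assms by (intro sums_mult Polygamma_LIMSEQ) auto
  moreover have "(-1) ^ Suc r * inverse ((1 - z + of_nat k) ^ Suc r) =
      1 / (z + of_int (- 1 - int k)) ^ Suc r" for k
  proof -
    have "(z + of_int (- 1 - int k)) ^ Suc r = (- 1) ^ Suc r * (1 - z + of_nat k) ^ Suc r"
      by (subst power_mult_distrib [symmetric]) (simp add: algebra_simps)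
    then show ?thesis
      by (cases "even r") (simp_all only: inverse_eq_divide, simp_all)
  qed
  moreover have "(-1) ^ Suc r * ((-1) ^ Suc r * Polygamma r (1 - z) / fact r) = Polygamma r (1 - z) / fact r"
    by (cases "even r") auto
  ultimately have 2: "(\<lambda>n. 1 / (z + of_int (- 1 - int n)) ^ Suc r) sums (Polygamma r (1 - z) / fact r)"
    by simp
  have reflection: "(-1) ^ r * Polygamma r (1 - z) - Polygamma r z =
           - ((2 * pi * \<i>) ^ Suc r * eval_fps (power_fps r) (to_q z))"
    using Polygamma_reflection_to_q [OF assms(1), of r] assms(2) by simp
  have "(-1) ^ Suc r * Polygamma r z / fact r + Polygamma r (1 - z) / fact r =
          (-1) ^ r * ((-1) ^ r * Polygamma r (1 - z) - Polygamma r z) / fact r"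
    by (cases "even r") (auto simp: field_simps)
  also have "\<dots> = (- 1) ^ Suc r * (2 * pi * \<i>) ^ Suc r / fact r * eval_fps (power_fps r) (to_q z)"
    unfolding reflection by simp
  also have "(- 1) ^ Suc r * (2 * pi * \<i>) ^ Suc r = (- 2 * pi * \<i>) ^ Suc r"
    by (subst power_mult_distrib [symmetric]) simp
  finally show ?thesis
    using has_sum_int_iff_nat [OF assms(3) 1 2] by simp
qed

section \<open>Lattice sums and Lambert series\<close>

lemma summable_on_nat_int:
  fixes f :: "int \<Rightarrow> 'a :: banach"
  assumes "(\<lambda>n. f (int n)) summable_on UNIV" "(\<lambda>n. f (- int n)) summable_on UNIV"
  shows "f summable_on UNIV"
proof -
  have bij1: "bij_betw int UNIV {0..}"
    by (rule bij_betwI [where g = nat]) auto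
  have bij2: "bij_betw (\<lambda>n. - int n) UNIV {..0}"
    by (rule bij_betwI [where g = "\<lambda>n. nat (- n)"]) auto
  have "f summable_on {0..}" "f summable_on {..0}"
    using summable_on_reindex_bij_betw [OF bij1, of f] summable_on_reindex_bij_betw [OF bij2, of f] assms
    by auto
  moreover from this have "f summable_on {..-1}"
    by (elim summable_on_subset_banach) auto
  ultimately have "f summable_on {0..} \<union> {..-1}"
    by (intro summable_on_Un_disjoint) auto
  also have "{0..} \<union> {..-1} = (UNIV :: int set)"
    by auto
  finally show ?thesis .
qed

text \<open>The exponent 3 / 2 is half of the cubic decay in \<open>summable_on_lattice\<close> and
  still greater than 1. The maximum with 1 prevents the weight 0 powr (- 3 / 2) = 0 at n =
  0.\<close>

lemma summable_on_lattice_weight: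
  "(\<lambda>n::int. real_of_int (max 1 \<bar>n\<bar>) powr (-3/2)) summable_on UNIV"
proof -
  have "summable (\<lambda>n. of_nat n powr (-3/2) :: real)"
    by (simp add: summable_real_powr_iff)
  then have "summable (\<lambda>n. real_of_int (max 1 \<bar>int n\<bar>) powr (-3/2))"
    by (subst summable_cong [where g = "\<lambda>n. real n powr (-3/2)"])
      (auto simp: eventually_sequentially max_def intro!: exI [of _ 1])
  then have "(\<lambda>n. real_of_int (max 1 \<bar>int n\<bar>) powr (-3/2)) summable_on UNIV"
    by (intro summable_nonneg_imp_summable_on) auto
  then show ?thesis
    by (intro summable_on_nat_int) simp_all
qed

text \<open>Decay of order 3 in the larger coordinate is bounded by decay of order 3 / 2 in each
  coordinate, so a product of two convergent one-dimensional series dominates.\<close>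

lemma summable_on_lattice:
  fixes f :: "int \<times> int \<Rightarrow> complex"
  assumes "\<And>m n. m \<noteq> 0 \<Longrightarrow> norm (f (m, n)) \<le> C / real_of_int (max \<bar>m\<bar> \<bar>n\<bar>) ^ 3"
  shows "f summable_on (- {0}) \<times> UNIV"
proof -
  define w where "w = (\<lambda>n::int. real_of_int (max 1 \<bar>n\<bar>) powr (-3/2))"
  have w: "w summable_on A" for A
    unfolding w_def by (rule summable_on_subset_banach [OF summable_on_lattice_weight]) simp
  have w_nonneg: "w n \<ge> 0" for n
    by (simp add: w_def)
  have "(\<lambda>(m, n). w m * w n) summable_on (- {0}) \<times> UNIV"
  proof (rule summable_on_SigmaI)
    show "((\<lambda>n. case (m, n) of (m, n) \<Rightarrow> w m * w n) has_sum w m * infsum w UNIV) UNIV" for m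
      using has_sum_cmult_right [OF has_sum_infsum [OF w]] by simp
    show "(\<lambda>m. w m * infsum w UNIV) summable_on - {0}"
      by (intro summable_on_cmult_left w)
  qed (auto simp: w_nonneg)
  then have "(\<lambda>(m, n). C * (w m * w n)) summable_on (- {0}) \<times> UNIV"
    using summable_on_cmult_right [of "\<lambda>(m, n). w m * w n" _ C] by (simp add: case_prod_unfold)
  then have "(\<lambda>x. norm (f x)) summable_on (- {0}) \<times> UNIV"
  proof (rule Infinite_Sum.abs_summable_on_comparison_test', goal_cases)
    case (1 x)
    then obtain m n where x: "x = (m, n)" and m: "m \<noteq> 0"
      by auto
    define M where "M = real_of_int (max \<bar>m\<bar> \<bar>n\<bar>)"
    have M: "M \<ge> 1" "real_of_int (max 1 \<bar>m\<bar>) \<le> M" "real_of_int (max 1 \<bar>n\<bar>) \<le> M"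
      using m by (auto simp: M_def)
    have "1 / M ^ 3 = M powr (-3/2) * M powr (-3/2)"
      using M(1) by (simp add: powr_add [symmetric] powr_minus powr_numeral inverse_eq_divide)
    also have "\<dots> \<le> w m * w n"
      unfolding w_def using M by (intro mult_mono powr_mono2') auto
    finally have *: "1 / M ^ 3 \<le> w m * w n" .
    have "0 \<le> C / M ^ 3"
      using assms [OF m, of n] norm_ge_zero [of "f (m, n)"] unfolding M_def by linarith
    then have "C \<ge> 0"
      using M(1) by (simp add: zero_le_divide_iff)
    with * have "C * (1 / M ^ 3) \<le> C * (w m * w n)"
      by (intro mult_left_mono)
    with assms [OF m, of n] show ?case
      by (simp add: M_def x)
  qed
  then show ?thesis
    by (rule abs_summable_summable)
qed

lemma lattice_bound:
  assumes "Im t > 0"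
  obtains K where "K > 0" "\<And>m n :: int. K * real_of_int (max \<bar>m\<bar> \<bar>n\<bar>) \<le> norm (of_int m * t + of_int n)"
proof
  \<comment> \<open>For v = m t + n, the imaginary part of v controls m, and n = v - m t then
    controls n. The denominator is large enough for both estimates.\<close>
  define K where "K = Im t / (1 + Im t + norm t)"
  have pos: "1 + Im t + norm t > 0"
    using assms by (meson add_pos_nonneg add_pos_pos norm_ge_zero zero_less_one)
  show K: "K > 0"
    using assms pos by (simp add: K_def)
  fix m n :: int
  define v where "v = of_int m * t + of_int n"
  have "\<bar>Im v\<bar> \<le> norm v"
    by (rule abs_Im_le_cmod)
  then have m: "Im t * real_of_int \<bar>m\<bar> \<le> norm v"
    using assms by (simp add: v_def abs_mult mult.commute)
  have "real_of_int \<bar>n\<bar> = norm (v - of_int m * t)"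
    by (simp add: v_def)
  also have "\<dots> \<le> norm v + norm t * real_of_int \<bar>m\<bar>"
    by (rule order_trans [OF norm_triangle_ineq4]) (simp add: norm_mult mult.commute)
  finally have "Im t * real_of_int \<bar>n\<bar> \<le> Im t * (norm v + norm t * real_of_int \<bar>m\<bar>)"
    using assms by (intro mult_left_mono) auto
  also have "\<dots> = Im t * norm v + norm t * (Im t * real_of_int \<bar>m\<bar>)"
    by (simp add: algebra_simps)
  also have "\<dots> \<le> Im t * norm v + norm t * norm v"
    using m by (intro add_left_mono mult_left_mono) auto
  also have "\<dots> \<le> (1 + Im t + norm t) * norm v"
    by (simp add: algebra_simps)
  finally have n: "K * real_of_int \<bar>n\<bar> \<le> norm v"
    using pos by (simp add: K_def field_simps)
  have "K * real_of_int \<bar>m\<bar> \<le> Im t * real_of_int \<bar>m\<bar>"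
    unfolding K_def using assms pos by (intro mult_right_mono) (auto simp: field_simps)
  with m n show "K * real_of_int (max \<bar>m\<bar> \<bar>n\<bar>) \<le> norm (of_int m * t + of_int n)"
    unfolding v_def [symmetric] by (auto simp: max_def)
qed

lemma lattice_nonzero:
  assumes "Im t > 0" "m \<noteq> 0"
  shows "of_int m * t + of_int n \<noteq> 0"
proof
  assume "of_int m * t + of_int n = 0"
  then have "Im (of_int m * t + of_int n) = 0"
    by (simp only: zero_complex.sel)
  with assms show False
    by simp
qed

lemma summable_on_lattice_power:
  assumes "Im t > 0" "k \<ge> 3"
  shows "(\<lambda>(m, n). 1 / (of_int m * t + of_int n) ^ k) summable_on (- {0}) \<times> UNIV"
proof -
  obtain K where K: "K > 0" "\<And>m n :: int. K * real_of_int (max \<bar>m\<bar> \<bar>n\<bar>) \<le> norm (of_int m * t + of_int n)"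
    using lattice_bound [OF assms(1)] by blast
  show ?thesis
  proof (rule summable_on_lattice [where C = "1 / K ^ k"])
    fix m n :: int
    assume m: "m \<noteq> 0"
    define M where "M = real_of_int (max \<bar>m\<bar> \<bar>n\<bar>)"
    have M: "M \<ge> 1"
      using m by (auto simp: M_def)
    have "norm (1 / (of_int m * t + of_int n) ^ k) \<le> 1 / (K * M) ^ k"
      using K M by (auto simp: norm_divide norm_power M_def intro!: divide_left_mono power_mono mult_pos_pos zero_less_power)
        (metis K(2) M_def lattice_nonzero assms(1) m zero_less_norm_iff zero_less_power)
    also have "\<dots> = 1 / K ^ k / M ^ k"
      by (simp add: power_mult_distrib)
    also have "\<dots> \<le> 1 / K ^ k / M ^ 3"
      using K M assms by (intro divide_left_mono power_increasing) auto
    finally show "norm (case (m, n) of (m, n) \<Rightarrow> 1 / (of_int m * t + of_int n) ^ k) \<le> 1 / K ^ k / M ^ 3"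
      by simp
  qed
qed

section \<open>Lambert series of divisor sums\<close>

lemma has_sum_eval_fps:
  fixes f :: "complex fps"
  assumes "norm q < fps_conv_radius f"
  shows "((\<lambda>n. fps_nth f n * q ^ n) has_sum eval_fps f q) UNIV"
  using norm_summable_imp_has_sum [OF norm_summable_fps [OF assms] sums_eval_fps [OF assms]] .

definition sigma_fps :: "nat \<Rightarrow> complex fps" where
  "sigma_fps r = Abs_fps (\<lambda>n. of_nat (divisor_sigma r n))"

lemma sigma_fps_nth_0 [simp]: "fps_nth (sigma_fps r) 0 = 0"
  by (simp add: sigma_fps_def divisor_sigma_def)

text \<open>Both series arise from the family n ^ r q ^ (m n), grouped by the product m n or by m.
  Their common value is kept as an infinite sum because the radius of convergence of
  \<open>sigma_fps r\<close> is itself derived from the first part.\<close>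

lemma has_sum_Lambert:
  assumes q: "norm q < 1" and r: "r > 0"
  shows "((\<lambda>n. fps_nth (sigma_fps r) n * q ^ n) has_sum (\<Sum>\<^sub>\<infinity>m\<in>{1..}. eval_fps (power_fps r) (q ^ m))) UNIV"
    and "((\<lambda>m. eval_fps (power_fps r) (q ^ m)) has_sum (\<Sum>\<^sub>\<infinity>m\<in>{1..}. eval_fps (power_fps r) (q ^ m))) {1..}"
proof -
  define f where "f = (\<lambda>(m, n). of_nat n ^ r * q ^ (m * n) :: complex)"
  define S where "S = (\<Sum>\<^sub>\<infinity>m\<in>{1..}. eval_fps (power_fps r) (q ^ m))"
  have qm: "norm (q ^ m) < 1" if "m \<ge> 1" for m
    using q that by (simp add: norm_power power_less_one_iff)
  have inner: "((\<lambda>n. f (m, n)) has_sum eval_fps (power_fps r) (q ^ m)) {1..}" if "m \<ge> 1" for m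
  proof -
    have "((\<lambda>n. fps_nth (power_fps r) n * (q ^ m) ^ n) has_sum eval_fps (power_fps r) (q ^ m)) UNIV"
      by (intro has_sum_eval_fps ereal_norm_less_radius qm that conv_radius_power_fps)
    moreover have "((\<lambda>n. fps_nth (power_fps r) n * (q ^ m) ^ n) has_sum eval_fps (power_fps r) (q ^ m)) UNIV \<longleftrightarrow>
      ((\<lambda>n. f (m, n)) has_sum eval_fps (power_fps r) (q ^ m)) {1..}"
      using r by (intro has_sum_cong_neutral) (auto simp: f_def power_fps_def power_mult Suc_le_eq)
    ultimately show ?thesis
      by blast
  qed
  have "(\<lambda>x. norm (f x)) summable_on {1..} \<times> {1..}"
  \<comment> \<open>With m as inner variable the norms form geometric series, whose sums n ^ r |q| ^
    n / (1 - |q| ^ n) are at most n ^ r |q| ^ n / (1 - |q|).\<close>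
  proof (subst summable_on_swap, rule summable_on_SigmaI)
    fix n :: nat assume n: "n \<in> {1..}"
    have "norm (norm q ^ n) < 1"
      using qm [of n] n by (simp add: norm_power)
    from has_sum_cmult_right [OF has_sum_geometric_from_1 [OF this], of "real n ^ r"]
    show "((\<lambda>m. case (n, m) of (n, m) \<Rightarrow> norm (f (m, n))) has_sum real n ^ r * (norm q ^ n / (1 - norm q ^ n))) {1..}"
      by (simp add: f_def norm_mult norm_power power_mult [symmetric] mult.commute)
  next
    have "summable (\<lambda>n. norm (fps_nth (power_fps r) n * q ^ n))"
      using q conv_radius_power_fps by (intro norm_summable_fps ereal_norm_less_radius)
    then have "(\<lambda>n. norm (fps_nth (power_fps r) n * q ^ n)) summable_on UNIV"
      by (intro summable_nonneg_imp_summable_on) auto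
    then have *: "(\<lambda>n. norm (fps_nth (power_fps r) n * q ^ n)) summable_on {1..}"
      by (rule summable_on_subset_banach) simp
    have "(\<lambda>n. 1 / (1 - norm q) * (real n ^ r * norm q ^ n)) summable_on {1..}"
      using summable_on_cmult_right [OF *, of "1 / (1 - norm q)"]
      by (simp add: power_fps_def norm_mult norm_power)
    then have "(\<lambda>n. norm (real n ^ r * (norm q ^ n / (1 - norm q ^ n)))) summable_on {1..}"
    proof (rule Infinite_Sum.abs_summable_on_comparison_test')
      fix n :: nat assume n: "n \<in> {1..}"
      have "norm q ^ n \<le> norm q ^ 1"
        using q n by (intro power_decreasing) auto
      then have "norm q ^ n / (1 - norm q ^ n) \<le> norm q ^ n / (1 - norm q)"
        using q by (intro divide_left_mono mult_pos_pos) auto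
      moreover have "norm q ^ n / (1 - norm q ^ n) \<ge> 0"
        using q \<open>norm q ^ n \<le> norm q ^ 1\<close> by (intro divide_nonneg_nonneg) auto
      ultimately have "norm (real n ^ r * (norm q ^ n / (1 - norm q ^ n))) \<le> real n ^ r * (norm q ^ n / (1 - norm q))"
        unfolding real_norm_def
        by (subst abs_of_nonneg) (rule mult_nonneg_nonneg mult_left_mono zero_le_power of_nat_0_le_iff | assumption)+
      also have "\<dots> = 1 / (1 - norm q) * (real n ^ r * norm q ^ n)"
        by (simp only: times_divide_eq_left times_divide_eq_right mult_1_left)
      finally show "norm (real n ^ r * (norm q ^ n / (1 - norm q ^ n))) \<le> \<dots>" .
    qed
    then show "(\<lambda>n. real n ^ r * (norm q ^ n / (1 - norm q ^ n))) summable_on {1..}"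
      by (rule abs_summable_summable)
  qed (auto simp: f_def)
  then have "f summable_on {1..} \<times> {1..}"
    by (rule abs_summable_summable)
  then obtain T where T: "(f has_sum T) ({1..} \<times> {1..})"
    by (auto simp: summable_on_def)
  have "((\<lambda>m. eval_fps (power_fps r) (q ^ m)) has_sum T) {1..}"
    using has_sum_SigmaD [OF T] inner by auto
  moreover from this have "T = S"
    unfolding S_def by (simp add: infsumI)
  ultimately show 2: "((\<lambda>m. eval_fps (power_fps r) (q ^ m)) has_sum S) {1..}"
    by simp
  have "((\<lambda>(N, d). of_nat d ^ r * q ^ N) has_sum S) (SIGMA N:{1..}. {d. d dvd N})"
  proof (subst has_sum_reindex_bij_witness [where S = "{1..} \<times> {1..}" and i = "\<lambda>(N, d). (N div d, d)"
        and j = "\<lambda>(m, n). (m * n, n)" and g = f and s = S, symmetric])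
    show "(f has_sum S) ({1..} \<times> {1..})"
      using T \<open>T = S\<close> by simp
  qed (auto simp: f_def Suc_le_eq dvd_pos_nat div_greater_zero_iff dest: dvd_imp_le)
  then have "((\<lambda>N. \<Sum>d | d dvd N. of_nat d ^ r * q ^ N) has_sum S) {1..}"
    by (rule has_sum_SigmaD) (auto intro!: has_sum_finiteI)
  moreover have "((\<lambda>N. \<Sum>d | d dvd N. of_nat d ^ r * q ^ N) has_sum S) {1..} \<longleftrightarrow>
    ((\<lambda>n. fps_nth (sigma_fps r) n * q ^ n) has_sum S) UNIV"
    by (intro has_sum_cong_neutral)
      (auto simp: sigma_fps_def divisor_sigma_def sum_distrib_right Suc_le_eq)
  ultimately show "((\<lambda>n. fps_nth (sigma_fps r) n * q ^ n) has_sum S) UNIV"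
    by blast
qed

lemma fps_conv_radius_ge_1I:
  fixes f :: "complex fps"
  assumes "\<And>q. norm q < 1 \<Longrightarrow> summable (\<lambda>n. fps_nth f n * q ^ n)"
  shows "fps_conv_radius f \<ge> 1"
  unfolding fps_conv_radius_def
proof (rule conv_radius_geI_ex')
  fix r :: real assume "0 < r" "ereal r < 1"
  then show "summable (\<lambda>n. fps_nth f n * of_real r ^ n)"
    by (intro assms) (auto simp: one_ereal_def)
qed

lemma conv_radius_sigma_fps: "r > 0 \<Longrightarrow> fps_conv_radius (sigma_fps r) \<ge> 1"
  by (intro fps_conv_radius_ge_1I sums_summable [OF has_sum_imp_sums [OF has_sum_Lambert(1)]])

lemma has_sum_Lambert':
  assumes q: "norm q < 1" and r: "r > 0"
  shows "((\<lambda>m. eval_fps (power_fps r) (q ^ m)) has_sum eval_fps (sigma_fps r) q) {1..}"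
proof -
  have "((\<lambda>n. fps_nth (sigma_fps r) n * q ^ n) has_sum eval_fps (sigma_fps r) q) UNIV"
    using q r by (intro has_sum_eval_fps ereal_norm_less_radius conv_radius_sigma_fps)
  with has_sum_Lambert [OF q r] show ?thesis
    using has_sum_unique by metis
qed

section \<open>The value of \<open>\<zeta> (6)\<close>\<close>

lemma has_field_derivative_cot_remainder:
  assumes "norm z < 1"
  shows "((\<lambda>z. (-1) ^ r * Polygamma r (1 - z) - Polygamma r (1 + z)) has_field_derivative
           (-1) ^ Suc r * Polygamma (Suc r) (1 - z) - Polygamma (Suc r) (1 + z :: complex)) (at z)"
proof -
  have "Re (1 - z) > 0" "Re (1 + z) > 0"
    using assms abs_Re_le_cmod [of z] by auto
  moreover have "w \<notin> \<int>\<^sub>\<le>\<^sub>0" if "Re w > 0" for w :: complex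
    using that by (auto elim!: nonpos_Ints_cases)
  ultimately have "1 - z \<notin> \<int>\<^sub>\<le>\<^sub>0" "1 + z \<notin> \<int>\<^sub>\<le>\<^sub>0"
    by blast+
  then show ?thesis
    by (auto intro!: derivative_eq_intros)
qed

text \<open>This is pi cot (pi z) - 1 / z with the pole at 0 removed. The Digamma form is regular at
  0, so the derivatives there can be read off from Polygamma values.\<close>

definition cot_remainder :: "complex \<Rightarrow> complex" where
  "cot_remainder z = Digamma (1 - z) - Digamma (1 + z)"

lemma cot_remainder_eq:
  fixes z :: complex
  assumes "z \<notin> \<int>"
  shows "cot_remainder z = pi * cot (pi * z) - 1 / z"
proof -
  have "z \<noteq> 0"
    using assms by auto
  then have "Digamma (1 + z) = Digamma z + 1 / z"
    using Digamma_plus1 [of z] by (simp add: add.commute)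
  then show ?thesis
    using Digamma_reflection [OF assms] by (simp add: cot_remainder_def algebra_simps)
qed

lemma cot_remainder_minus: "cot_remainder (- z) = - cot_remainder z"
  by (simp add: cot_remainder_def)

text \<open>The partial fraction expansion of the cotangent, from the defining series of Digamma at
  1 - z and 1 + z. It includes z = 0, which is the case n = 0 in
  \<open>Eis2_inversion\<close>.\<close>

lemma cot_remainder_sums:
  assumes "z + 1 \<noteq> 0" "z - 1 \<noteq> 0"
  shows "(\<lambda>k. 1 / (z + of_nat (Suc k)) + 1 / (z - of_nat (Suc k))) sums cot_remainder z"
proof -
  have "(\<lambda>n. inverse (of_nat (Suc n)) - inverse (w + of_nat n)) sums (Digamma w + euler_mascheroni)"
    if "w \<noteq> 0" for w :: complex
    using summable_sums [OF summable_Digamma [OF that]] by (simp add: Digamma_def)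
  from sums_diff [OF this [of "1 - z"] this [of "1 + z"]]
  have "(\<lambda>k. inverse (1 + z + of_nat k) - inverse (1 - z + of_nat k)) sums cot_remainder z"
    using assms by (simp add: cot_remainder_def eq_neg_iff_add_eq_0 add.commute)
  also have "(\<lambda>k. inverse (1 + z + of_nat k) - inverse (1 - z + of_nat k)) =
    (\<lambda>k. 1 / (z + of_nat (Suc k)) + 1 / (z - of_nat (Suc k)))"
  proof
    fix k
    have "1 - z + of_nat k = - (z - of_nat (Suc k))" "1 + z + of_nat k = z + of_nat (Suc k)"
      by simp_all
    then show "inverse (1 + z + of_nat k) - inverse (1 - z + of_nat k) =
      1 / (z + of_nat (Suc k)) + 1 / (z - of_nat (Suc k))"
      by (simp only: inverse_minus_eq) (simp add: inverse_eq_divide)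
  qed
  finally show ?thesis .
qed

lemma higher_deriv_cot_remainder:
  assumes "norm z < 1"
  shows "(deriv ^^ r) cot_remainder z = (-1) ^ r * Polygamma r (1 - z) - Polygamma r (1 + z)"
  using assms
proof (induction r arbitrary: z)
  case (Suc r)
  have "eventually (\<lambda>x. x \<in> ball 0 1) (nhds z)"
    using Suc.prems by (intro eventually_nhds_in_open) auto
  then have "eventually (\<lambda>x. (deriv ^^ r) cot_remainder x = (-1) ^ r * Polygamma r (1 - x) - Polygamma r (1 + x)) (nhds z)"
    by eventually_elim (auto intro: Suc.IH)
  then have "(deriv ^^ Suc r) cot_remainder z = deriv (\<lambda>x. (-1) ^ r * Polygamma r (1 - x) - Polygamma r (1 + x)) z"
    by (simp add: deriv_cong_ev)
  also have "\<dots> = (-1) ^ Suc r * Polygamma (Suc r) (1 - z) - Polygamma (Suc r) (1 + z)"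
    by (rule DERIV_imp_deriv [OF has_field_derivative_cot_remainder [OF Suc.prems]])
  finally show ?case .
qed (simp add: cot_remainder_def)

text \<open>This equation determines the Taylor coefficients of \<open>cot_remainder\<close> at 0, which are multiples
  of the values of \<open>\<zeta>\<close> at even arguments.\<close>

lemma cot_remainder_Riccati:
  assumes "norm z < 1"
  shows "z * deriv cot_remainder z + 2 * cot_remainder z + z * cot_remainder z ^ 2 + z * pi ^ 2 = 0"
proof (cases "z = 0")
  case False
  have z: "w \<notin> \<int>" if "w \<in> ball 0 1 - {0}" for w :: complex
  proof
    assume "w \<in> \<int>"
    then obtain n where n: "w = of_int n"
      by (elim Ints_cases)
    with that show False
      by (auto simp: norm_of_int)
  qed
  have zin: "z \<in> ball 0 1 - {0}"
    using False assms by auto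
  define C where "C = pi * cot (pi * z)"
  have sin_nz: "sin (of_real pi * z) \<noteq> 0"
    using z [OF zin] by (auto simp: sin_eq_0)
  note [derivative_intros] = DERIV_chain2 [OF DERIV_cot]
  have "((\<lambda>w. pi * cot (pi * w) - 1 / w) has_field_derivative
          - (pi ^ 2 * inverse (sin (pi * z) ^ 2)) + 1 / z ^ 2) (at z)"
    using sin_nz False by (auto intro!: derivative_eq_intros simp: power2_eq_square field_simps)
  then have "(cot_remainder has_field_derivative - (pi ^ 2 * inverse (sin (pi * z) ^ 2)) + 1 / z ^ 2) (at z)"
    by (rule has_field_derivative_transform_within_open [where S = "ball 0 1 - {0}"])
      (use z zin in \<open>auto simp: cot_remainder_eq\<close>)
  then have "deriv cot_remainder z = - (pi ^ 2 * inverse (sin (pi * z) ^ 2)) + 1 / z ^ 2"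
    by (rule DERIV_imp_deriv)
  also have "of_real (pi ^ 2) * inverse (sin (pi * z) ^ 2) = pi ^ 2 + C ^ 2"
    using sin_nz sin_cos_squared_add [of "of_real pi * z"]
    by (simp add: C_def cot_def power_divide power_mult_distrib field_simps flip: distrib_left)
  finally have deriv: "deriv cot_remainder z = - (pi ^ 2 + C ^ 2) + 1 / z ^ 2" .
  have rem: "cot_remainder z = C - 1 / z"
    using z [OF zin] by (simp add: C_def cot_remainder_eq)
  show ?thesis
    unfolding deriv rem using False by (simp add: field_simps power2_eq_square)
qed (simp add: cot_remainder_def)

lemma zeta_6_sums: "(\<lambda>k. 1 / of_nat (Suc k) ^ 6 :: complex) sums (pi ^ 6 / 945)"
proof -
  define H where "H = fps_expansion cot_remainder 0"
  define c where "c = fps_nth H"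
  have "cot_remainder holomorphic_on ball 0 1"
  proof (subst holomorphic_on_open, simp, intro ballI exI)
    show "(cot_remainder has_field_derivative - Polygamma 1 (1 - z) - Polygamma 1 (1 + z)) (at z)"
      if "z \<in> ball 0 1" for z
      using has_field_derivative_cot_remainder [of z 0] that by (simp add: cot_remainder_def [abs_def])
  qed
  then have H: "cot_remainder has_fps_expansion H"
    unfolding H_def by (rule has_fps_expansion_fps_expansion [rotated 2]) auto
  have "(\<lambda>z. z * deriv cot_remainder z + 2 * cot_remainder z + z * cot_remainder z ^ 2 + z * pi ^ 2)
          has_fps_expansion fps_X * fps_deriv H + fps_const 2 * H + fps_X * H ^ 2 + fps_X * fps_const (of_real (pi ^ 2))"
    by (intro fps_expansion_intros H)
  moreover have "eventually (\<lambda>z::complex. z \<in> ball 0 1) (nhds 0)"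
    by (intro eventually_nhds_in_open) auto
  then have "eventually (\<lambda>z. z * deriv cot_remainder z + 2 * cot_remainder z + z * cot_remainder z ^ 2 + z * pi ^ 2 = 0) (nhds 0)"
    by eventually_elim (use cot_remainder_Riccati in auto)
  ultimately have "(\<lambda>z. 0) has_fps_expansion fps_X * fps_deriv H + fps_const 2 * H + fps_X * H ^ 2 + fps_X * fps_const (of_real (pi ^ 2))"
    by (subst (asm) has_fps_expansion_cong) auto
  then have ode: "fps_X * fps_deriv H + fps_const 2 * H + fps_X * H ^ 2 + fps_X * fps_const (of_real (pi ^ 2)) = 0"
    by (metis fps_expansion_unique_complex has_fps_expansion_0)
  have ode_nth: "fps_nth (fps_X * fps_deriv H + fps_const 2 * H + fps_X * H ^ 2 + fps_X * fps_const (of_real (pi ^ 2))) n = 0" for n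
    unfolding ode by simp
  have square_nth: "fps_nth (H ^ 2) n = (\<Sum>i=0..n. c i * c (n - i))" for n
    by (simp add: power2_eq_square fps_mult_nth c_def)
  \<comment> \<open>This is the coefficient of z ^ (n + 1): the derivative term contributes n + 1
    and the linear term 2.\<close>
  have c: "(of_nat n + 3) * c (Suc n) + (\<Sum>i=0..n. c i * c (n - i)) + (if n = 0 then of_real pi ^ 2 else 0) = 0" for n
    using ode_nth [of "Suc n"]
    unfolding c_def [symmetric]
    by (simp add: square_nth c_def [symmetric] algebra_simps split: if_splits)
  have c0: "c 0 = 0"
    using ode_nth [of 0] by (simp add: c_def numeral_fps_const)
  have c1: "c 1 = - (of_real pi ^ 2) / 3"
    using c [of 0] c0 by (simp add: field_simps eq_neg_iff_add_eq_0)
  have c2: "c 2 = 0"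
    using c [of 1] c0 by (simp add: numeral_2_eq_2)
  have c3: "c 3 = - (of_real pi ^ 4) / 45"
  proof -
    have "c 3 * 5 = - (c 1 * c 1)"
      using c [of 2] c0 c2 by (simp add: numeral_eq_Suc algebra_simps eq_neg_iff_add_eq_0)
    also have "\<dots> = - (of_real pi ^ 4) / 9"
      unfolding c1 by (simp add: power4_eq_xxxx power2_eq_square)
    finally show ?thesis
      by (simp add: field_simps)
  qed
  have c4: "c 4 = 0"
    using c [of 3] c0 c2 by (simp add: numeral_eq_Suc)
  have c5: "c 5 = - 2 * (of_real pi ^ 6) / 945"
  proof -
    have "c 5 * 7 = - (2 * (c 1 * c 3))"
      using c [of 4] c0 c2 c4 by (simp add: numeral_eq_Suc algebra_simps eq_neg_iff_add_eq_0)
    also have "\<dots> = - 2 * (of_real pi ^ 6) / 135"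
      unfolding c1 c3 by (simp add: eval_nat_numeral)
    finally show ?thesis
      by (simp add: field_simps)
  qed
  \<comment> \<open>Computed from derivatives, the same coefficient is - 2 times
    \<open>Polygamma 5 1 / fact 5\<close>, the sum of all 1 / k ^ 6.\<close>
  have "c 5 = (deriv ^^ 5) cot_remainder 0 / fact 5"
    by (simp add: c_def H_def fps_expansion_def)
  also have "\<dots> = - 2 * (Polygamma 5 1 / fact 5)"
    by (subst higher_deriv_cot_remainder) auto
  finally have "- 2 * (Polygamma 5 1 / fact 5) = - 2 * (of_real pi ^ 6 / 945 :: complex)"
    unfolding c5 by (simp only: times_divide_eq_right)
  then have eq: "Polygamma 5 1 / fact 5 = (of_real pi ^ 6 / 945 :: complex)"
    by (simp only: mult_cancel_left) simp
  have "(\<lambda>k. 1 / of_nat (Suc k) ^ 6 :: complex) sums (Polygamma 5 1 / fact 5)"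
    using Polygamma_LIMSEQ [of "1::complex" 5] by (simp add: inverse_eq_divide)
  then show ?thesis
    by (simp only: eq of_real_divide of_real_power of_real_numeral)
qed

section \<open>Inversion formula for \<open>E\<^sub>6\<close>\<close>

lemma summable_on_row:
  assumes "Im z \<noteq> 0" "k \<ge> 2"
  shows "(\<lambda>n::int. 1 / (z + of_int n) ^ k) summable_on A"
proof -
  have *: "(\<lambda>n::int. 1 / (z + of_int n) ^ k) summable_on UNIV" if z: "Im z > 0" for z
  proof -
    obtain K where K: "K > 0" "\<And>m n :: int. K * real_of_int (max \<bar>m\<bar> \<bar>n\<bar>) \<le> norm (of_int m * z + of_int n)"
      using lattice_bound [OF z] by blast
    have "(\<lambda>n. 1 / K ^ k * real_of_int (max 1 \<bar>n\<bar>) powr (-3/2)) summable_on UNIV"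
      by (intro summable_on_cmult_right summable_on_lattice_weight)
    then have "(\<lambda>n::int. norm (1 / (z + of_int n) ^ k)) summable_on UNIV"
    proof (rule Infinite_Sum.abs_summable_on_comparison_test')
      fix n :: int
      define M where "M = real_of_int (max 1 \<bar>n\<bar>)"
      have M: "M \<ge> 1"
        by (simp add: M_def)
      have "K * M \<le> norm (z + of_int n)"
        using K(2) [of 1 n] by (simp add: M_def)
      then have "norm (1 / (z + of_int n) ^ k) \<le> 1 / (K * M) ^ k"
        using K M by (auto simp: norm_divide norm_power intro!: frac_le power_mono zero_less_power mult_pos_pos)
      also have "\<dots> = 1 / K ^ k * (1 / M ^ k)"
        by (simp add: power_mult_distrib)
      also have "\<dots> \<le> 1 / K ^ k * M powr (-3/2)"
      proof (rule mult_left_mono)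
        have "1 / M ^ k = M powr (- real k)"
          using M by (simp add: powr_minus powr_realpow inverse_eq_divide)
        also have "\<dots> \<le> M powr (-3/2)"
          using M assms by (intro powr_mono) auto
        finally show "1 / M ^ k \<le> M powr (-3/2)" .
      qed (use K in auto)
      finally show "norm (1 / (z + of_int n) ^ k) \<le> 1 / K ^ k * M powr (-3/2)" .
    qed
    then show ?thesis
      by (rule abs_summable_summable)
  qed
  have "(\<lambda>n::int. 1 / (z + of_int n) ^ k) summable_on UNIV"
  proof (cases "Im z > 0")
    case False
    then have "(\<lambda>n::int. 1 / (- z + of_int n) ^ k) summable_on UNIV"
      using assms by (intro *) auto
    then have "(\<lambda>n::int. (- 1) ^ k * (1 / (- z + of_int n) ^ k)) summable_on UNIV"
      by (rule summable_on_cmult_right)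
    moreover have "((\<lambda>n::int. (- 1) ^ k * (1 / (- z + of_int n) ^ k)) summable_on UNIV) =
      ((\<lambda>n::int. 1 / (z + of_int n) ^ k) summable_on UNIV)"
    proof (rule summable_on_reindex_bij_witness [where i = uminus and j = uminus])
      fix n :: int
      have "z + of_int (- n) = (- 1) * (- z + of_int n)"
        by simp
      then have "(z + of_int (- n)) ^ k = (- 1) ^ k * (- z + of_int n) ^ k"
        by (simp only: power_mult_distrib)
      then show "1 / (z + of_int (- n)) ^ k = (- 1) ^ k * (1 / (- z + of_int n) ^ k)"
        by (cases "even k") auto
    qed auto
    ultimately show ?thesis
      by blast
  qed (rule *)
  then show ?thesis
    by (rule summable_on_subset_banach) simp
qed

text \<open>For odd r the exponent is even. Hence row - m is row m with n negated, and the sign in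
  the constant of \<open>Lipschitz_formula\<close> disappears.\<close>

lemma Lipschitz_row:
  assumes t: "Im t > 0" and r: "odd r" and m: "m \<noteq> 0"
  shows "((\<lambda>n::int. 1 / (of_int m * t + of_int n) ^ Suc r) has_sum
           (2 * pi * \<i>) ^ Suc r / fact r * eval_fps (power_fps r) (to_q t ^ nat \<bar>m\<bar>)) UNIV"
proof -
  define M where "M = \<bar>m\<bar>"
  have M: "M > 0"
    using m by (simp add: M_def)
  have r0: "r > 0" "Suc r \<ge> 2"
    using r by (auto elim!: oddE)
  have Mt: "Im (of_int M * t) > 0"
    using M t by simp
  have "(- 2 * pi * \<i>) ^ Suc r = (2 * pi * \<i>) ^ Suc r"
    using r power_minus_even [of "Suc r" "2 * pi * \<i>"] by (simp del: power_Suc)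
  moreover have "to_q (of_int M * t) = to_q t ^ nat M"
    using M by (simp add: to_q_power)
  ultimately have *: "((\<lambda>n::int. 1 / (of_int M * t + of_int n) ^ Suc r) has_sum
           (2 * pi * \<i>) ^ Suc r / fact r * eval_fps (power_fps r) (to_q t ^ nat M)) UNIV"
    using Lipschitz_formula [OF Mt r0(1) summable_on_row [OF Mt [THEN less_imp_neq, THEN not_sym] r0(2)]]
    by (simp only:)
  show ?thesis
  proof (cases "m > 0")
    case True
    then show ?thesis
      using * by (simp add: M_def)
  next
    case False
    have "((\<lambda>n::int. 1 / (of_int M * t + of_int n) ^ Suc r) has_sum
           (2 * pi * \<i>) ^ Suc r / fact r * eval_fps (power_fps r) (to_q t ^ nat \<bar>m\<bar>)) UNIV \<longleftrightarrow>
      ((\<lambda>n::int. 1 / (of_int m * t + of_int n) ^ Suc r) has_sum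
           (2 * pi * \<i>) ^ Suc r / fact r * eval_fps (power_fps r) (to_q t ^ nat \<bar>m\<bar>)) UNIV"
    proof (rule has_sum_reindex_bij_witness [where i = uminus and j = uminus])
      fix n :: int
      have "of_int m * t + of_int (- n) = - (of_int M * t + of_int n)"
        using False by (simp add: M_def)
      then show "1 / (of_int m * t + of_int (- n)) ^ Suc r = 1 / (of_int M * t + of_int n) ^ Suc r"
        using r by (simp only: power_minus_even even_Suc not_False_eq_True)
    qed auto
    with * show ?thesis
      by (simp add: M_def)
  qed
qed

lemma has_sum_int_symmetric:
  fixes f :: "nat \<Rightarrow> 'a :: {comm_ring_1, topological_comm_monoid_add}"
  assumes "(f has_sum s) {1..}"
  shows "((\<lambda>m::int. f (nat \<bar>m\<bar>)) has_sum 2 * s) (- {0})"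
proof -
  have "((\<lambda>m::int. f (nat \<bar>m\<bar>)) has_sum s) {1..}"
    by (subst has_sum_reindex_bij_witness [where T = "{1..}" and i = int and j = nat and h = f and s' = s])
      (use assms in auto)
  moreover have "((\<lambda>m::int. f (nat \<bar>m\<bar>)) has_sum s) {..-1}"
    by (subst has_sum_reindex_bij_witness [where T = "{1..}" and i = "\<lambda>n. - int n" and j = "\<lambda>n. nat (- n)" and h = f and s' = s])
      (use assms in auto)
  ultimately have "((\<lambda>m::int. f (nat \<bar>m\<bar>)) has_sum s + s) ({1..} \<union> {..-1})"
    by (intro has_sum_Un_disjoint) auto
  also have "{1..} \<union> {..-1} = - {0::int}"
    by auto
  finally show ?thesis
    by (simp only: mult_2)
qed

lemma has_sum_rows:
  assumes t: "Im t > 0" and r: "odd r"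
  shows "((\<lambda>m::int. (2 * pi * \<i>) ^ Suc r / fact r * eval_fps (power_fps r) (to_q t ^ nat \<bar>m\<bar>)) has_sum
           2 * ((2 * pi * \<i>) ^ Suc r / fact r * eval_fps (sigma_fps r) (to_q t))) (- {0})"
proof -
  have "((\<lambda>m. (2 * pi * \<i>) ^ Suc r / fact r * eval_fps (power_fps r) (to_q t ^ m)) has_sum
           (2 * pi * \<i>) ^ Suc r / fact r * eval_fps (sigma_fps r) (to_q t)) {1..}"
    using r by (intro has_sum_cmult_right has_sum_Lambert' norm_to_q_less_1 t) (auto elim: oddE)
  from has_sum_int_symmetric [OF this] show ?thesis
    by simp
qed

definition Eis6 :: "complex \<Rightarrow> complex" where
  "Eis6 t = 1 - 504 * eval_fps (sigma_fps 5) (to_q t)"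

text \<open>The row m = 0 gives 2 \<zeta>(6) = 2 pi ^ 6 / 945 and the other rows give the divisor
  sums. The factor 504 in \<open>Eis6\<close> is 64 * 945 / 120, the quotient of 2 ^ 6 / 5! and 1 /
  945.\<close>

lemma has_sum_lattice_6:
  assumes t: "Im t > 0"
  shows "((\<lambda>(m, n). 1 / (of_int m * t + of_int n) ^ 6) has_sum (2 * pi ^ 6 / 945 * Eis6 t)) (UNIV - {(0, 0)})"
proof -
  have "((\<lambda>(m, n). 1 / (of_int m * t + of_int n) ^ 6) has_sum
      2 * ((2 * pi * \<i>) ^ 6 / fact 5 * eval_fps (sigma_fps 5) (to_q t))) ((- {0}) \<times> UNIV)"
  proof (rule has_sum_SigmaI)
    show "((\<lambda>m::int. (2 * pi * \<i>) ^ 6 / fact 5 * eval_fps (power_fps 5) (to_q t ^ nat \<bar>m\<bar>)) has_sum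
        2 * ((2 * pi * \<i>) ^ 6 / fact 5 * eval_fps (sigma_fps 5) (to_q t))) (- {0})"
      using has_sum_rows [OF t, of 5] by simp
    show "((\<lambda>n. case (m, n) of (m, n) \<Rightarrow> 1 / (of_int m * t + of_int n) ^ 6) has_sum
        (2 * pi * \<i>) ^ 6 / fact 5 * eval_fps (power_fps 5) (to_q t ^ nat \<bar>m\<bar>)) UNIV"
      if "m \<in> - {0}" for m :: int
      using Lipschitz_row [OF t, of 5 m] that by simp
    show "(\<lambda>(m, n). 1 / (of_int m * t + of_int n) ^ 6) summable_on (- {0}) \<times> UNIV"
      by (rule summable_on_lattice_power [OF t]) simp
  qed
  also have "(2 * pi * \<i>) ^ 6 = complex_of_real (- 64 * pi ^ 6)"
    by (simp add: power_mult_distrib numeral_eq_Suc)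
  finally have 1: "((\<lambda>(m, n). 1 / (of_int m * t + of_int n) ^ 6) has_sum
      2 * (complex_of_real (- 64 * pi ^ 6) / fact 5 * eval_fps (sigma_fps 5) (to_q t))) ((- {0}) \<times> UNIV)" .
  have "((\<lambda>k. 1 / of_nat (Suc k) ^ 6 :: complex) has_sum pi ^ 6 / 945) UNIV"
  proof (rule norm_summable_imp_has_sum [OF _ zeta_6_sums])
    have "summable (\<lambda>n. inverse (real (Suc n) ^ 6))"
      using inverse_power_summable [of 6, where 'a = real] by (subst summable_Suc_iff) simp
    then show "summable (\<lambda>n. norm (1 / of_nat (Suc n) ^ 6 :: complex))"
      by (simp add: norm_divide norm_power inverse_eq_divide del: of_nat_Suc)
  qed
  also have "?this \<longleftrightarrow> ((\<lambda>k. 1 / of_nat k ^ 6 :: complex) has_sum pi ^ 6 / 945) {1..}"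
    by (rule has_sum_reindex_bij_witness [where i = "\<lambda>k. k - 1" and j = Suc]) auto
  finally have "((\<lambda>n. 1 / of_nat (nat \<bar>n\<bar>) ^ 6 :: complex) has_sum 2 * complex_of_real (pi ^ 6 / 945)) (- {0})"
    by (rule has_sum_int_symmetric)
  also have "?this \<longleftrightarrow> ((\<lambda>(m, n). 1 / (of_int m * t + of_int n) ^ 6) has_sum 2 * complex_of_real (pi ^ 6 / 945)) ({0} \<times> - {0})"
    by (rule has_sum_reindex_bij_witness [where i = snd and j = "\<lambda>n. (0, n)"])
      (auto simp: power_even_abs simp flip: of_int_power)
  finally have "((\<lambda>(m, n). 1 / (of_int m * t + of_int n) ^ 6) has_sum
      2 * complex_of_real (pi ^ 6 / 945) + 2 * (complex_of_real (- 64 * pi ^ 6) / fact 5 * eval_fps (sigma_fps 5) (to_q t)))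
      ({0} \<times> - {0} \<union> (- {0}) \<times> UNIV)"
    using 1 by (intro has_sum_Un_disjoint) auto
  also have "{0} \<times> - {0} \<union> (- {0}) \<times> UNIV = UNIV - {(0::int, 0::int)}"
    by auto
  also have "2 * complex_of_real (pi ^ 6 / 945) + 2 * (complex_of_real (- 64 * pi ^ 6) / fact 5 * eval_fps (sigma_fps 5) (to_q t)) =
      2 * pi ^ 6 / 945 * Eis6 t"
    by (simp add: Eis6_def fact_numeral field_simps)
  finally show ?thesis .
qed

lemma Im_minus_inverse_pos: "Im t > 0 \<Longrightarrow> Im (- 1 / t) > 0"
  by (simp add: Im_divide power2_eq_square add_nonneg_pos zero_less_divide_iff)

text \<open>Since t (m (- 1 / t) + n) = n t - m, the inversion merely permutes the nonzero lattice
  points, up to the factor t.\<close>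

lemma Eis6_inversion:
  assumes t: "Im t > 0"
  shows "Eis6 (- 1 / t) = t ^ 6 * Eis6 t"
proof -
  have t0: "t \<noteq> 0"
    using t by auto
  have "((\<lambda>(m, n). t ^ 6 * (1 / (of_int m * t + of_int n) ^ 6)) has_sum t ^ 6 * (2 * pi ^ 6 / 945 * Eis6 t)) (UNIV - {(0, 0)})"
    using has_sum_cmult_right [OF has_sum_lattice_6 [OF t], of "t ^ 6"] by (simp add: case_prod_unfold)
  also have "?this \<longleftrightarrow> ((\<lambda>(m, n). 1 / (of_int m * (- 1 / t) + of_int n) ^ 6) has_sum t ^ 6 * (2 * pi ^ 6 / 945 * Eis6 t)) (UNIV - {(0, 0)})"
  proof (rule has_sum_reindex_bij_witness [where i = "\<lambda>(m, n). (n, - m)" and j = "\<lambda>(m, n). (- n, m)"])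
    fix a :: "int \<times> int" assume "a \<in> UNIV - {(0, 0)}"
    obtain m n where a: "a = (m, n)"
      by force
    have "of_int (- n) * (- 1 / t) + of_int m = (of_int m * t + of_int n) / t"
      using t0 by (simp add: field_simps)
    then show "(case (case a of (m, n) \<Rightarrow> (- n, m)) of (m, n) \<Rightarrow> 1 / (of_int m * (- 1 / t) + of_int n) ^ 6) =
      (case a of (m, n) \<Rightarrow> t ^ 6 * (1 / (of_int m * t + of_int n) ^ 6))"
      unfolding a prod.case by (simp only: power_divide) simp
  qed auto
  finally have "t ^ 6 * (2 * pi ^ 6 / 945 * Eis6 t) = 2 * pi ^ 6 / 945 * Eis6 (- 1 / t)"
    using has_sum_lattice_6 [OF Im_minus_inverse_pos [OF t]] has_sum_unique by blast
  then have "complex_of_real (2 * pi ^ 6 / 945) * (t ^ 6 * Eis6 t) = complex_of_real (2 * pi ^ 6 / 945) * Eis6 (- 1 / t)"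
    by (simp add: mult_ac)
  then show ?thesis
    by (subst (asm) mult_left_cancel) auto
qed

section \<open>Inversion formula for \<open>E\<^sub>2\<close>\<close>

lemma has_sum_diff:
  fixes f g :: "'a \<Rightarrow> 'b :: real_normed_vector"
  assumes "(f has_sum a) A" "(g has_sum b) A"
  shows "((\<lambda>x. f x - g x) has_sum (a - b)) A"
  using has_sum_add [OF assms(1), of "\<lambda>x. - g x" "- b"] assms(2) by (simp add: has_sum_uminus)

definition Eis2 :: "complex \<Rightarrow> complex" where
  "Eis2 t = 1 - 24 * eval_fps (sigma_fps 1) (to_q t)"

lemma has_sum_int_reciprocal_squares:
  "((\<lambda>n::int. 1 / of_int n ^ 2 :: complex) has_sum 2 * complex_of_real (pi ^ 2 / 6)) (- {0})"
proof -
  have "(\<lambda>n. complex_of_real (1 / (of_nat n + 1) ^ 2)) sums complex_of_real (pi ^ 2 / 6)"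
    using sums_of_real [OF inverse_squares_sums, where 'a = complex] by (simp add: add.commute)
  then have "(\<lambda>n. 1 / of_nat (Suc n) ^ 2 :: complex) sums complex_of_real (pi ^ 2 / 6)"
    by (simp add: add.commute)
  moreover have "summable (\<lambda>n. norm (1 / of_nat (Suc n) ^ 2 :: complex))"
    using sums_summable [OF inverse_squares_sums]
    by (simp add: norm_divide norm_power add.commute flip: of_nat_Suc)
  ultimately have "((\<lambda>k. 1 / of_nat (Suc k) ^ 2 :: complex) has_sum pi ^ 2 / 6) UNIV"
    by (intro norm_summable_imp_has_sum)
  also have "?this \<longleftrightarrow> ((\<lambda>k. 1 / of_nat k ^ 2 :: complex) has_sum pi ^ 2 / 6) {1..}"
    by (rule has_sum_reindex_bij_witness [where i = "\<lambda>k. k - 1" and j = Suc]) auto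
  finally have "((\<lambda>n. 1 / of_nat (nat \<bar>n\<bar>) ^ 2 :: complex) has_sum 2 * complex_of_real (pi ^ 2 / 6)) (- {0})"
    by (rule has_sum_int_symmetric)
  also have "?this \<longleftrightarrow> ?thesis"
    by (rule has_sum_cong) (auto simp flip: of_int_power)
  finally show ?thesis .
qed

lemma sums_int_nonzero:
  fixes f :: "int \<Rightarrow> complex"
  assumes "(f has_sum s) (- {0})"
  shows "(\<lambda>k. f (int (Suc k)) + f (- int (Suc k))) sums s"
proof -
  have "f summable_on A" if "A \<subseteq> - {0}" for A
    using assms that summable_on_subset_banach by (metis has_sum_imp_summable)
  then have *: "f summable_on {1..}" "f summable_on {..-1}"
    by auto
  then have "(f has_sum (infsum f {1..} + infsum f {..-1})) ({1..} \<union> {..-1})"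
    by (intro has_sum_Un_disjoint) auto
  also have "{1..} \<union> {..-1} = - {0::int}"
    by auto
  finally have s: "s = infsum f {1..} + infsum f {..-1}"
    using assms has_sum_unique by blast
  have "((\<lambda>k. f (int (Suc k))) has_sum infsum f {1..}) UNIV"
    by (subst has_sum_reindex_bij_witness [where T = "{1..}" and i = "\<lambda>n. nat n - 1" and j = "\<lambda>n. int (Suc n)"
          and h = f and s' = "infsum f {1..}"]) (use * in auto)
  moreover have "((\<lambda>k. f (- int (Suc k))) has_sum infsum f {..-1}) UNIV"
    by (subst has_sum_reindex_bij_witness [where T = "{..-1}" and i = "\<lambda>n. nat (- n) - 1" and j = "\<lambda>n. - int (Suc n)"
          and h = f and s' = "infsum f {..-1}"]) (use * in auto)
  ultimately show ?thesis
    unfolding s by (intro has_sum_imp_sums has_sum_add)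
qed

lemma sums_int_telescope:
  fixes u :: "int \<Rightarrow> complex"
  assumes "((\<lambda>n. u (n - 1) - u n) has_sum s) UNIV"
    and "(\<lambda>N. u (int N)) \<longlonglongrightarrow> a" and "(\<lambda>N. u (- int N)) \<longlonglongrightarrow> b"
  shows "s = b - a"
proof -
  have 1: "(\<lambda>k. u (int k - 1) - u (int k)) sums (u (-1) - a)"
  proof -
    have "(\<lambda>k. u (int (Suc k) - 1)) \<longlonglongrightarrow> a"
      using assms(2) by simp
    then have "(\<lambda>k. u (int k - 1)) \<longlonglongrightarrow> a"
      by (rule LIMSEQ_imp_Suc)
    from telescope_sums' [OF this] show ?thesis
      by simp
  qed
  have 2: "(\<lambda>k. u (- 1 - int k - 1) - u (- 1 - int k)) sums (b - u (-1))"
  proof -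
    have "(\<lambda>k. u (- int (Suc k))) \<longlonglongrightarrow> b"
      using LIMSEQ_Suc [OF assms(3)] .
    then have "(\<lambda>k. u (- 1 - int k)) \<longlonglongrightarrow> b"
      by (simp add: algebra_simps)
    from telescope_sums [OF this] show ?thesis
      by (simp add: algebra_simps)
  qed
  have "((\<lambda>n. u (n - 1) - u n) has_sum ((u (-1) - a) + (b - u (-1)))) UNIV"
    using 1 2 by (intro has_sum_int_iff_nat has_sum_imp_summable [OF assms(1)]) auto
  with assms(1) show ?thesis
    by (metis add_diff_cancel_left' add_diff_eq diff_add_cancel diff_diff_eq2 has_sum_unique add.commute)
qed

lemma tendsto_cot_remainder:
  assumes "Im z > 0"
  shows "(\<lambda>N. cot_remainder (of_nat N * z)) \<longlonglongrightarrow> - (pi * \<i>)"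
proof -
  define q where "q = to_q z"
  have q: "norm q < 1"
    using norm_to_q_less_1 [OF assms] by (simp add: q_def)
  have "(\<lambda>N. pi * (- \<i> * (1 + q ^ N) / (1 - q ^ N)) - inverse (of_nat N) * (1 / z)) \<longlonglongrightarrow>
          pi * (- \<i> * (1 + 0) / (1 - 0)) - 0 * (1 / z)"
    by (intro tendsto_intros LIMSEQ_power_zero q lim_inverse_n) auto
  moreover have "eventually (\<lambda>N. pi * (- \<i> * (1 + q ^ N) / (1 - q ^ N)) - inverse (of_nat N) * (1 / z) =
      cot_remainder (of_nat N * z)) sequentially"
    using eventually_gt_at_top [of 0]
  proof eventually_elim
    case (elim N)
    have "norm (q ^ N) < 1"
      using q elim by (simp add: norm_power power_less_one_iff)
    then have "to_q (of_nat N * z) \<noteq> 1"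
      by (auto simp: q_def to_q_power)
    moreover have "of_nat N * z \<notin> \<int>"
      using assms elim by (intro not_Ints_if_Im) auto
    ultimately show ?case
      by (subst cot_remainder_eq) (simp_all add: cot_pi_eq_to_q q_def to_q_power inverse_eq_divide mult.commute)
  qed
  ultimately show ?thesis
    by (simp add: tendsto_cong)
qed

text \<open>
  The double series of \<open>1 / (m t + n)\<^sup>2\<close> over \<open>m \<noteq> 0\<close> depends on the order of summation. Subtracting
  \<open>1 / (m t + n - 1) - 1 / (m t + n)\<close> makes it absolutely convergent. Summed over \<open>n\<close> first, the
  subtracted terms telescope to 0; summed over \<open>m\<close> first, they leave limits of the cotangent, and
  these are the non-modular term.
\<close>

lemma Eis2_inversion:
  assumes t: "Im t > 0"
  shows "Eis2 (- 1 / t) = t ^ 2 * Eis2 t + 6 * t / (pi * \<i>)"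
proof -
  define t' where "t' = - 1 / t"
  have t': "Im t' > 0"
    unfolding t'_def by (rule Im_minus_inverse_pos [OF t])
  have t0: "t \<noteq> 0" "t' \<noteq> 0" "t * t' = - 1"
    using t by (auto simp: t'_def)
  have t'_times: "t' * (x * t + y) = t' * y - x" for x y
  proof -
    have "t' * (x * t + y) = (t * t') * x + t' * y"
      by (simp add: algebra_simps)
    then show ?thesis
      unfolding t0(3) by simp
  qed
  define S S' where "S = eval_fps (sigma_fps 1) (to_q t)" and "S' = eval_fps (sigma_fps 1) (to_q t')"
  define f where "f = (\<lambda>(m::int, n::int). 1 / (of_int m * t + of_int n) ^ 2)"
  define g where "g = (\<lambda>(m::int, n::int). 1 / (of_int m * t + of_int (n - 1)) - 1 / (of_int m * t + of_int n))"
  have nz: "of_int m * t + of_int n \<noteq> 0" if "m \<noteq> 0" for m n :: int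
    using lattice_nonzero [OF t that] .
  \<comment> \<open>The difference decays cubically, so \<open>summable_on_lattice\<close> applies
    to it, although not to \<open>f\<close> alone.\<close>
  have fg: "f (m, n) - g (m, n) = - 1 / ((of_int m * t + of_int n) ^ 2 * (of_int m * t + of_int (n - 1)))"
    if "m \<noteq> 0" for m n
  proof -
    define v w where "v = of_int m * t + of_int n" and "w = of_int m * t + of_int (n - 1)"
    have vw: "v \<noteq> 0" "w \<noteq> 0" "w = v - 1"
      using nz [OF that, of n] nz [OF that, of "n - 1"] by (auto simp: v_def w_def)
    then have "v - 1 \<noteq> 0"
      by simp
    then have "1 / v ^ 2 - (1 / w - 1 / v) = - 1 / (v ^ 2 * w)"
      unfolding vw(3) using vw(1) by (simp add: divide_simps power2_eq_square)
    then show ?thesis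
      by (simp add: f_def g_def v_def w_def)
  qed
  have "(\<lambda>x. f x - g x) summable_on (- {0}) \<times> UNIV"
  proof -
    obtain K where K: "K > 0" "\<And>m n :: int. K * real_of_int (max \<bar>m\<bar> \<bar>n\<bar>) \<le> norm (of_int m * t + of_int n)"
      using lattice_bound [OF t] by blast
    show ?thesis
    proof (rule summable_on_lattice [where C = "2 / K ^ 3"])
      fix m n :: int
      assume m: "m \<noteq> 0"
      define M where "M = real_of_int (max \<bar>m\<bar> \<bar>n\<bar>)"
      have M: "M \<ge> 1"
        using m by (auto simp: M_def)
      \<comment> \<open>As m is not 0, shifting n by 1 changes the maximum by at most a factor 2.
        This is the 2 in the constant 2 / K ^ 3.\<close>
      have "max \<bar>m\<bar> \<bar>n\<bar> \<le> 2 * max \<bar>m\<bar> \<bar>n - 1\<bar>"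
        using m by (auto simp: max_def abs_if)
      then have "M \<le> real_of_int (2 * max \<bar>m\<bar> \<bar>n - 1\<bar>)"
        unfolding M_def of_int_le_iff .
      then have "K * M \<le> K * (2 * real_of_int (max \<bar>m\<bar> \<bar>n - 1\<bar>))"
        using K(1) by (intro mult_left_mono) auto
      also have "\<dots> \<le> 2 * norm (of_int m * t + of_int (n - 1))"
        using K(2) [of m "n - 1"] by linarith
      finally have 2: "K * M / 2 \<le> norm (of_int m * t + of_int (n - 1))"
        by simp
      have 1: "K * M \<le> norm (of_int m * t + of_int n)"
        using K(2) [of m n] by (simp add: M_def)
      have "(K * M) ^ 2 * (K * M / 2) \<le> norm (of_int m * t + of_int n) ^ 2 * norm (of_int m * t + of_int (n - 1))"
        using 1 2 K M by (intro mult_mono power_mono) auto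
      then have "1 / (norm (of_int m * t + of_int n) ^ 2 * norm (of_int m * t + of_int (n - 1))) \<le> 1 / ((K * M) ^ 2 * (K * M / 2))"
        using K M by (intro divide_left_mono) (auto intro!: mult_pos_pos simp: nz m zero_less_mult_iff simp del: of_int_diff)
      also have "\<dots> = 2 / K ^ 3 / M ^ 3"
        by (simp add: power_mult_distrib power2_eq_square power3_eq_cube)
      finally show "norm (f (m, n) - g (m, n)) \<le> 2 / K ^ 3 / M ^ 3"
        unfolding fg [OF m] by (simp add: norm_divide norm_mult norm_power)
    qed
  qed
  then obtain T where T: "((\<lambda>x. f x - g x) has_sum T) ((- {0}) \<times> UNIV)"
    by (auto simp: summable_on_def)

  \<comment> \<open>For fixed m the terms of \<open>g\<close> telescope to 0, since 1 / (m t + n)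
    tends to 0 at both ends.\<close>
  have rows: "((\<lambda>n. f (m, n) - g (m, n)) has_sum (2 * pi * \<i>) ^ 2 * eval_fps (power_fps 1) (to_q t ^ nat \<bar>m\<bar>)) UNIV"
    if m: "m \<in> - {0}" for m :: int
  proof -
    have 1: "((\<lambda>n. f (m, n)) has_sum (2 * pi * \<i>) ^ 2 * eval_fps (power_fps 1) (to_q t ^ nat \<bar>m\<bar>)) UNIV"
      using Lipschitz_row [OF t, of 1 m] m by (simp add: f_def power2_eq_square)
    have "(\<lambda>n. f (m, n) - g (m, n)) summable_on UNIV"
      using summable_on_SigmaD1 [of "\<lambda>m n. f (m, n) - g (m, n)" "- {0}" "\<lambda>_. UNIV" m] T m
      by (auto simp: case_prod_unfold dest: has_sum_imp_summable)
    then obtain s where s: "((\<lambda>n. f (m, n) - g (m, n)) has_sum s) UNIV"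
      by (auto simp: summable_on_def)
    have "((\<lambda>n. g (m, n)) has_sum ((2 * pi * \<i>) ^ 2 * eval_fps (power_fps 1) (to_q t ^ nat \<bar>m\<bar>) - s)) UNIV"
      using has_sum_diff [OF 1 s] by simp
    moreover have "(\<lambda>n. g (m, n)) = (\<lambda>n. 1 / (of_int m * t + of_int (n - 1)) - 1 / (of_int m * t + of_int n))"
      by (simp add: g_def)
    ultimately have "(2 * pi * \<i>) ^ 2 * eval_fps (power_fps 1) (to_q t ^ nat \<bar>m\<bar>) - s = 0 - 0"
    proof (intro sums_int_telescope [where u = "\<lambda>n. 1 / (of_int m * t + of_int n)"])
      have "filterlim (\<lambda>N. of_int m * t + of_nat N :: complex) at_infinity sequentially"
        by (intro tendsto_add_filterlim_at_infinity [OF tendsto_const] tendsto_of_nat)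
      from filterlim_compose [OF tendsto_inverse_0 this]
      show "(\<lambda>N. 1 / (of_int m * t + of_int (int N))) \<longlonglongrightarrow> 0"
        by (simp add: inverse_eq_divide)
      have "filterlim (\<lambda>N. - (of_int m * t) + of_nat N :: complex) at_infinity sequentially"
        by (intro tendsto_add_filterlim_at_infinity [OF tendsto_const] tendsto_of_nat)
      from tendsto_minus [OF filterlim_compose [OF tendsto_inverse_0 this]]
      show "(\<lambda>N. 1 / (of_int m * t + of_int (- int N))) \<longlonglongrightarrow> 0"
        by (simp add: inverse_eq_divide minus_divide_right add.commute)
    qed simp
    with s show ?thesis
      by simp
  qed
  have T1: "T = 2 * ((2 * pi * \<i>) ^ 2 * S)"
  proof (rule has_sum_unique)
    show "((\<lambda>m. (2 * pi * \<i>) ^ 2 * eval_fps (power_fps 1) (to_q t ^ nat \<bar>m\<bar>)) has_sum T) (- {0})"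
      using has_sum_SigmaD [OF T rows] .
    show "((\<lambda>m::int. (2 * pi * \<i>) ^ 2 * eval_fps (power_fps 1) (to_q t ^ nat \<bar>m\<bar>)) has_sum 2 * ((2 * pi * \<i>) ^ 2 * S)) (- {0})"
      using has_sum_rows [OF t, of 1] by (simp add: S_def power2_eq_square)
  qed

  \<comment> \<open>The sum of \<open>f\<close> over m for fixed n, written in t' = - 1 / t. The
    Lipschitz formula sums over all m, so for n \<noteq> 0 the term m = 0, which is 1 / n ^ 2, has
    to be subtracted. For n = 0 the value is a multiple of \<zeta>(2).\<close>
  define a where "a = (\<lambda>n::int. if n = 0 then t' ^ 2 * (2 * complex_of_real (pi ^ 2 / 6))
    else t' ^ 2 * ((2 * pi * \<i>) ^ 2 * eval_fps (power_fps 1) (to_q t' ^ nat \<bar>n\<bar>)) - 1 / of_int n ^ 2)"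
  have f': "f (m, n) = t' ^ 2 * (1 / (of_int n * t' + of_int (- m)) ^ 2)" for m n
  proof -
    have "of_int n * t' + of_int (- m) = t' * (of_int m * t + of_int n)"
      unfolding t'_times by simp
    then show ?thesis
      using t0 by (simp only: power_mult_distrib) (simp add: f_def)
  qed
  have cols_f: "((\<lambda>m. f (m, n)) has_sum a n) (- {0})" for n
  proof (cases "n = 0")
    case True
    have "((\<lambda>m. t' ^ 2 * (1 / of_int m ^ 2)) has_sum a n) (- {0})"
      using has_sum_cmult_right [OF has_sum_int_reciprocal_squares, of "t' ^ 2"] True by (simp add: a_def)
    then show ?thesis
      using True by (simp add: f')
  next
    case False
    have "((\<lambda>m. 1 / (of_int n * t' + of_int m) ^ 2) has_sum
        (2 * pi * \<i>) ^ 2 * eval_fps (power_fps 1) (to_q t' ^ nat \<bar>n\<bar>)) UNIV"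
      using Lipschitz_row [OF t', of 1 n] False by (simp add: power2_eq_square)
    also have "?this \<longleftrightarrow> ((\<lambda>m. 1 / (of_int n * t' + of_int (- m)) ^ 2) has_sum
        (2 * pi * \<i>) ^ 2 * eval_fps (power_fps 1) (to_q t' ^ nat \<bar>n\<bar>)) UNIV"
      by (rule has_sum_reindex_bij_witness [where i = uminus and j = uminus]) auto
    finally have "((\<lambda>m. f (m, n)) has_sum
        t' ^ 2 * ((2 * pi * \<i>) ^ 2 * eval_fps (power_fps 1) (to_q t' ^ nat \<bar>n\<bar>))) UNIV"
      unfolding f' by (rule has_sum_cmult_right)
    moreover have "((\<lambda>m. f (m, n)) has_sum 1 / of_int n ^ 2) {0}"
      by (rule has_sum_finiteI) (auto simp: f_def)
    ultimately have "((\<lambda>m. f (m, n)) has_sum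
        (t' ^ 2 * ((2 * pi * \<i>) ^ 2 * eval_fps (power_fps 1) (to_q t' ^ nat \<bar>n\<bar>)) - 1 / of_int n ^ 2)) (UNIV - {0})"
      by (rule has_sum_Diff) simp
    then show ?thesis
      using False by (simp add: a_def Compl_eq_Diff_UNIV)
  qed
  define A where "A = t' ^ 2 * (2 * ((2 * pi * \<i>) ^ 2 * S')) - 2 * complex_of_real (pi ^ 2 / 6) + t' ^ 2 * (2 * complex_of_real (pi ^ 2 / 6))"
  have sum_a: "(a has_sum A) UNIV"
  proof -
    have "((\<lambda>n::int. t' ^ 2 * ((2 * pi * \<i>) ^ 2 * eval_fps (power_fps 1) (to_q t' ^ nat \<bar>n\<bar>)) - 1 / of_int n ^ 2) has_sum
        t' ^ 2 * (2 * ((2 * pi * \<i>) ^ 2 * S')) - 2 * complex_of_real (pi ^ 2 / 6)) (- {0})"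
    proof (intro has_sum_diff has_sum_cmult_right has_sum_int_reciprocal_squares)
      show "((\<lambda>n::int. (2 * pi * \<i>) ^ 2 * eval_fps (power_fps 1) (to_q t' ^ nat \<bar>n\<bar>)) has_sum 2 * ((2 * pi * \<i>) ^ 2 * S')) (- {0})"
        using has_sum_rows [OF t', of 1] by (simp add: S'_def power2_eq_square)
    qed
    also have "?this \<longleftrightarrow> (a has_sum t' ^ 2 * (2 * ((2 * pi * \<i>) ^ 2 * S')) - 2 * complex_of_real (pi ^ 2 / 6)) (- {0})"
      by (rule has_sum_cong) (simp add: a_def)
    finally have "(a has_sum t' ^ 2 * (2 * ((2 * pi * \<i>) ^ 2 * S')) - 2 * complex_of_real (pi ^ 2 / 6)) (- {0})" .
    moreover have "(a has_sum t' ^ 2 * (2 * complex_of_real (pi ^ 2 / 6))) {0}"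
      by (rule has_sum_finiteI) (auto simp: a_def)
    ultimately have "(a has_sum A) (- {0} \<union> {0})"
      unfolding A_def by (intro has_sum_Un_disjoint) auto
    also have "- {0} \<union> {0} = (UNIV :: int set)"
      by auto
    finally show ?thesis .
  qed

  \<comment> \<open>The sum of 1 / (m t + n) over m \<noteq> 0, with m and - m paired. The sum of
    \<open>g\<close> over m is therefore a difference of two neighbouring values of
    \<open>u\<close>.\<close>
  define u where "u = (\<lambda>n::int. - t' * cot_remainder (- of_int n * t'))"
  have cols: "((\<lambda>m. f (m, n) - g (m, n)) has_sum (a n - (u (n - 1) - u n))) (- {0})" for n
  proof -
    have "(\<lambda>(n, m). f (m, n) - g (m, n)) summable_on UNIV \<times> (- {0})"
      using has_sum_imp_summable [OF T] by (subst summable_on_swap) (simp add: case_prod_unfold)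
    from summable_on_SigmaD1 [OF this] obtain s where s: "((\<lambda>m. f (m, n) - g (m, n)) has_sum s) (- {0})"
      by (auto simp: summable_on_def)
    have "((\<lambda>m. g (m, n)) has_sum (a n - s)) (- {0})"
      using has_sum_diff [OF cols_f [of n] s] by simp
    then have 1: "(\<lambda>k. g (int (Suc k), n) + g (- int (Suc k), n)) sums (a n - s)"
      by (rule sums_int_nonzero)
    have u: "(\<lambda>k. 1 / (of_int (int (Suc k)) * t + of_int n) + 1 / (of_int (- int (Suc k)) * t + of_int n)) sums u n" for n
    proof -
      define z where "z = - of_int n * t'"
      have "z + of_nat (Suc k) = - t' * (of_int (int (Suc k)) * t + of_int n)"
           "z - of_nat (Suc k) = - t' * (of_int (- int (Suc k)) * t + of_int n)" for k
        unfolding mult_minus_left t'_times by (simp_all add: z_def)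
      note z = this
      have nz': "of_int (int (Suc k)) * t + of_int n \<noteq> 0" "of_int (- int (Suc k)) * t + of_int n \<noteq> 0" for k
        by (rule nz, simp)+
      have "z + of_nat (Suc 0) \<noteq> 0" "z - of_nat (Suc 0) \<noteq> 0"
        unfolding z by (simp_all only: mult_eq_0_iff neg_equal_0_iff_equal t0 nz' simp_thms)
      then have "(\<lambda>k. 1 / (z + of_nat (Suc k)) + 1 / (z - of_nat (Suc k))) sums cot_remainder z"
        by (intro cot_remainder_sums) auto
      from sums_mult [OF this, of "- t'"]
      have "(\<lambda>k. - t' * (1 / (z + of_nat (Suc k)) + 1 / (z - of_nat (Suc k)))) sums u n"
        by (simp add: u_def z_def)
      also have "(\<lambda>k. - t' * (1 / (z + of_nat (Suc k)) + 1 / (z - of_nat (Suc k)))) =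
        (\<lambda>k. 1 / (of_int (int (Suc k)) * t + of_int n) + 1 / (of_int (- int (Suc k)) * t + of_int n))"
      proof
        fix k
        have "- t' * (1 / (- t' * x)) = 1 / x" for x
          using t0 by simp
        then have "- t' * (1 / (- t' * x) + 1 / (- t' * y)) = 1 / x + 1 / y" for x y
          by (simp only: distrib_left)
        then show "- t' * (1 / (z + of_nat (Suc k)) + 1 / (z - of_nat (Suc k))) =
          1 / (of_int (int (Suc k)) * t + of_int n) + 1 / (of_int (- int (Suc k)) * t + of_int n)"
          unfolding z .
      qed
      finally show ?thesis .
    qed
    have "(\<lambda>k. g (int (Suc k), n) + g (- int (Suc k), n)) sums (u (n - 1) - u n)"
      using sums_diff [OF u [of "n - 1"] u [of n]] by (simp add: g_def algebra_simps)
    with 1 have "a n - s = u (n - 1) - u n"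
      using sums_unique2 by blast
    with s show ?thesis
      by (simp add: algebra_simps)
  qed
  have "((\<lambda>(n, m). f (m, n) - g (m, n)) has_sum T) (UNIV \<times> (- {0}))"
    using T by (subst has_sum_swap) (simp add: case_prod_unfold)
  from has_sum_SigmaD [OF this, of "\<lambda>n. a n - (u (n - 1) - u n)"]
  have "((\<lambda>n. a n - (u (n - 1) - u n)) has_sum T) UNIV"
    using cols by simp
  from has_sum_diff [OF sum_a this] have "((\<lambda>n. u (n - 1) - u n) has_sum (A - T)) UNIV"
    by simp
  \<comment> \<open>The limits of \<open>u\<close> at the two ends are opposite and nonzero, so this
    telescoping sum is 2 pi i t' and not 0.\<close>
  then have "A - T = - t' * - (pi * \<i>) - - (- t' * - (pi * \<i>))"
  proof (rule sums_int_telescope)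
    have *: "(\<lambda>N. - t' * cot_remainder (of_nat N * t')) \<longlonglongrightarrow> - t' * - (pi * \<i>)"
      by (intro tendsto_intros tendsto_cot_remainder t')
    then show "(\<lambda>N. u (- int N)) \<longlonglongrightarrow> - t' * - (pi * \<i>)"
      by (simp add: u_def)
    show "(\<lambda>N. u (int N)) \<longlonglongrightarrow> - (- t' * - (pi * \<i>))"
      using tendsto_minus [OF *] by (simp add: u_def cot_remainder_minus)
  qed
  then have AT: "A - T = 2 * pi * \<i> * t'"
    by simp
  have T2: "T = - 8 * pi ^ 2 * S"
    by (simp add: T1 power_mult_distrib)
  have A2: "A = - 8 * pi ^ 2 * S' * t' ^ 2 - pi ^ 2 / 3 + t' ^ 2 * (pi ^ 2 / 3)"
    by (simp add: A_def power_mult_distrib)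
  have "pi ^ 2 / 3 * (t' ^ 2 * (1 - 24 * S')) = pi ^ 2 / 3 * (1 - 24 * S) + (A - T)"
    unfolding T2 A2 by (simp add: field_simps)
  then have "pi ^ 2 / 3 * (t' ^ 2 * (1 - 24 * S')) = pi ^ 2 / 3 * (1 - 24 * S) + 2 * pi * \<i> * t'"
    unfolding AT .
  then have "t ^ 2 * (3 / pi ^ 2) * (pi ^ 2 / 3 * (t' ^ 2 * (1 - 24 * S'))) =
      t ^ 2 * (3 / pi ^ 2) * (pi ^ 2 / 3 * (1 - 24 * S) + 2 * pi * \<i> * t')"
    by simp
  also have "t ^ 2 * (3 / pi ^ 2) * (pi ^ 2 / 3 * (t' ^ 2 * (1 - 24 * S'))) = (t * t') ^ 2 * (1 - 24 * S')"
    by (simp add: power_mult_distrib)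
  also have "\<dots> = Eis2 (- 1 / t)"
    unfolding t0(3) by (simp add: Eis2_def S'_def t'_def)
  also have "t ^ 2 * (3 / pi ^ 2) * (pi ^ 2 / 3 * (1 - 24 * S) + 2 * pi * \<i> * t') =
      t ^ 2 * Eis2 t + 6 * \<i> / pi * t * (t * t')"
    by (simp add: Eis2_def S_def field_simps power2_eq_square)
  also have "6 * \<i> / pi * t * (t * t') = 6 * t / (pi * \<i>)"
    unfolding t0(3) by (simp add: field_simps)
  finally show ?thesis .
qed

section \<open>The logarithm of \<open>\<eta>\<close>\<close>

lemma divisor_sigma_0 [simp]: "divisor_sigma s 0 = 0"
  by (simp add: divisor_sigma_def)

text \<open>Minus the logarithm of the Euler product.\<close>

definition euler_log_fps :: "complex fps" where
  "euler_log_fps = Abs_fps (\<lambda>n. of_nat (divisor_sigma 1 n) / of_nat n)"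

lemma fps_X_deriv_euler_log_fps: "fps_X * fps_deriv euler_log_fps = sigma_fps 1"
proof (rule fps_ext)
  fix n
  show "fps_nth (fps_X * fps_deriv euler_log_fps) n = fps_nth (sigma_fps 1) n"
    by (cases n) (simp_all add: euler_log_fps_def sigma_fps_def del: of_nat_Suc)
qed

lemma conv_radius_euler_log_fps: "fps_conv_radius euler_log_fps \<ge> 1"
proof (rule fps_conv_radius_ge_1I)
  fix q :: complex assume q: "norm q < 1"
  have "summable (\<lambda>n. norm (fps_nth (sigma_fps 1) n * q ^ n))"
    by (intro norm_summable_fps ereal_norm_less_radius q conv_radius_sigma_fps) auto
  moreover have "norm (fps_nth euler_log_fps n * q ^ n) \<le> norm (fps_nth (sigma_fps 1) n * q ^ n)" for n
  proof (cases "n = 0")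
    case False
    then have "real (divisor_sigma 1 n) * norm (q ^ n) * 1 \<le> real (divisor_sigma 1 n) * norm (q ^ n) * real n"
      by (intro mult_left_mono) auto
    with False show ?thesis
      by (simp add: euler_log_fps_def sigma_fps_def norm_mult norm_divide pos_divide_le_eq)
  qed (simp add: euler_log_fps_def)
  ultimately show "summable (\<lambda>n. fps_nth euler_log_fps n * q ^ n)"
    by (rule summable_comparison_test' [where N = 0])
qed

text \<open>Defining the logarithm by its series fixes one branch on the whole half plane. Powers of
  eta occur below as exponentials of multiples of this function.\<close>

definition log_eta :: "complex \<Rightarrow> complex" where
  "log_eta t = pi * \<i> / 12 * t - eval_fps euler_log_fps (to_q t)"

lemma has_field_derivative_log_eta:
  assumes t: "Im t > 0"
  shows "(log_eta has_field_derivative pi * \<i> / 12 * Eis2 t) (at t)"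
proof -
  have q: "norm (to_q t) < 1"
    by (rule norm_to_q_less_1 [OF t])
  have "1 \<le> fps_conv_radius (fps_deriv euler_log_fps)"
    using conv_radius_euler_log_fps fps_conv_radius_deriv order_trans by blast
  then have eq: "to_q t * eval_fps (fps_deriv euler_log_fps) (to_q t) = eval_fps (sigma_fps 1) (to_q t)"
    unfolding fps_X_deriv_euler_log_fps [symmetric]
    by (subst eval_fps_mult) (auto intro: ereal_norm_less_radius q)
  have "(log_eta has_field_derivative pi * \<i> / 12 * 1 -
      eval_fps (fps_deriv euler_log_fps) (to_q t) * (2 * pi * \<i> * 1 * to_q t)) (at t)"
    unfolding log_eta_def [abs_def]
    by (rule derivative_eq_intros refl ereal_norm_less_radius q conv_radius_euler_log_fps)+ simp
  also have "pi * \<i> / 12 * 1 - eval_fps (fps_deriv euler_log_fps) (to_q t) * (2 * pi * \<i> * 1 * to_q t) =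
      pi * \<i> / 12 * (1 - 24 * (to_q t * eval_fps (fps_deriv euler_log_fps) (to_q t)))"
    by (simp add: field_simps)
  finally show ?thesis
    unfolding eq Eis2_def .
qed

text \<open>Both sides have the same derivative: the term 6 t / (pi i) in
  \<open>Eis2_inversion\<close> turns into 1 / (2 t), the derivative of half the logarithm.\<close>

lemma log_eta_inversion:
  assumes t: "Im t > 0"
  shows "log_eta (- 1 / t) = log_eta t + Ln (- \<i> * t) / 2"
proof -
  define h where "h = (\<lambda>t. log_eta (- 1 / t) - log_eta t - Ln (- \<i> * t) / 2)"
  have "\<exists>c. \<forall>t\<in>{t. Im t > 0}. h t = c"
  proof (rule has_field_derivative_zero_constant)
    show "convex {t. Im t > 0}"
      by (rule convex_halfspace_Im_gt)
    fix t assume "t \<in> {t. Im t > 0}"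
    then have t: "Im t > 0" and t0: "t \<noteq> 0"
      by auto
    have Ln: "- \<i> * t \<notin> \<real>\<^sub>\<le>\<^sub>0"
      using t by (auto simp: complex_nonpos_Reals_iff)
    have chain: "((\<lambda>t. log_eta (- 1 / t)) has_field_derivative pi * \<i> / 12 * Eis2 (- 1 / t) * (1 / t ^ 2)) (at t)"
      by (rule DERIV_chain2 [where f = log_eta and g = "\<lambda>t. - 1 / t", OF has_field_derivative_log_eta [OF Im_minus_inverse_pos [OF t]]])
        (use t0 in \<open>auto intro!: derivative_eq_intros simp: power2_eq_square\<close>)
    have deriv_Ln: "((\<lambda>t. Ln (- \<i> * t) / 2) has_field_derivative 1 / t / 2) (at t)"
      using t0 Ln by (auto intro!: derivative_eq_intros simp: field_simps)
    have "(h has_field_derivative pi * \<i> / 12 * Eis2 (- 1 / t) * (1 / t ^ 2) - pi * \<i> / 12 * Eis2 t - 1 / t / 2) (at t)"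
      unfolding h_def by (intro DERIV_diff chain has_field_derivative_log_eta t deriv_Ln)
    moreover have "pi * \<i> / 12 * Eis2 (- 1 / t) * (1 / t ^ 2) - pi * \<i> / 12 * Eis2 t - 1 / t / 2 = 0"
      unfolding Eis2_inversion [OF t] using t0 by (simp add: field_simps power2_eq_square)
    ultimately show "(h has_field_derivative 0) (at t within {t. Im t > 0})"
      by (simp add: has_field_derivative_at_within)
  qed
  then have "h t = h \<i>"
    using t by auto
  \<comment> \<open>The point i is fixed by t -> - 1 / t, and there the logarithm is Ln 1 =
    0.\<close>
  also have "h \<i> = 0"
    by (simp add: h_def field_simps)
  finally show ?thesis
    by (simp add: h_def algebra_simps)
qed

section \<open>The Euler product and its reciprocal as power series\<close>

definition complex_fps :: "int fps \<Rightarrow> complex fps" where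
  "complex_fps f = Abs_fps (\<lambda>n. of_int (fps_nth f n))"

lemma complex_fps_nth [simp]: "fps_nth (complex_fps f) n = of_int (fps_nth f n)"
  by (simp add: complex_fps_def)

lemma complex_fps_1 [simp]: "complex_fps 1 = 1"
  by (simp add: fps_eq_iff)

lemma complex_fps_mult: "complex_fps (f * g) = complex_fps f * complex_fps g"
  by (simp add: fps_eq_iff fps_mult_nth)

lemma complex_fps_power: "complex_fps (f ^ n) = complex_fps f ^ n"
  by (induction n) (simp_all add: complex_fps_mult)

text \<open>A logarithmic derivative cleared of denominators, so that it makes sense over the
  integers. The factor 1 - q ^ i contributes - i (q ^ i + q ^ (2 i) + ...).\<close>

lemma X_deriv_prod:
  "fps_X * fps_deriv (\<Prod>i\<le>n. 1 - fps_X ^ Suc i :: int fps) =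
     - (\<Sum>i\<le>n. Abs_fps (\<lambda>m. if Suc i dvd m \<and> m > 0 then int (Suc i) else 0)) * (\<Prod>i\<le>n. 1 - fps_X ^ Suc i)"
proof -
  define D where "D = (\<lambda>i. Abs_fps (\<lambda>m. if i dvd m \<and> m > 0 then int i else 0))"
  have D: "fps_X * fps_deriv (1 - fps_X ^ i) = - D i * (1 - fps_X ^ i)" if "i > 0" for i
  proof (rule fps_ext)
    fix m
    have "fps_nth (D i * (1 - fps_X ^ i)) m = (if m = i then int i else 0)"
      using that by (auto simp: D_def right_diff_distrib fps_X_power_mult_right_nth
          dvd_minus_self dest: dvd_imp_le)
    then show "fps_nth (fps_X * fps_deriv (1 - fps_X ^ i)) m = fps_nth (- D i * (1 - fps_X ^ i)) m"
      using that by (cases m) (auto simp: fps_X_power_iff)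
  qed
  have "fps_X * fps_deriv (\<Prod>i\<le>n. 1 - fps_X ^ Suc i) = - (\<Sum>i\<le>n. D (Suc i)) * (\<Prod>i\<le>n. 1 - fps_X ^ Suc i)"
  proof (induction n)
    case 0
    show ?case
      using D [of 1] by simp
  next
    case (Suc n)
    define A B where "A = (\<Prod>i\<le>n. 1 - fps_X ^ Suc i :: int fps)" and "B = (1 - fps_X ^ Suc (Suc n) :: int fps)"
    have "fps_X * fps_deriv (A * B) = (fps_X * fps_deriv A) * B + A * (fps_X * fps_deriv B)"
      by (simp add: algebra_simps)
    also have "\<dots> = - ((\<Sum>i\<le>n. D (Suc i)) + D (Suc (Suc n))) * (A * B)"
      using Suc.IH D [of "Suc (Suc n)"] unfolding A_def [symmetric] B_def [symmetric]
      by (simp add: algebra_simps)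
    finally show ?case
      by (simp add: A_def B_def)
  qed
  then show ?thesis
    by (simp add: D_def)
qed

text \<open>The coefficients up to m of the partial products become stationary, and a partial
  product that reaches beyond m already contains every divisor of m.\<close>

lemma X_deriv_q_pochhammer:
  "fps_X * fps_deriv q_pochhammer = - Abs_fps (\<lambda>n. int (divisor_sigma 1 n)) * q_pochhammer"
proof (rule fps_ext)
  fix m
  define P where "P = (\<lambda>n. \<Prod>i\<le>n. 1 - fps_X ^ Suc i :: int fps)"
  define S where "S = (\<lambda>n. \<Sum>i\<le>n. Abs_fps (\<lambda>m. if Suc i dvd m \<and> m > 0 then int (Suc i) else 0))"
  have "P \<longlonglongrightarrow> q_pochhammer"
    unfolding P_def by (rule has_prod_imp_tendsto [OF has_prod_q_pochhammer])
  then have "\<forall>k\<in>{..m}. eventually (\<lambda>n. fps_nth (P n) k = fps_nth q_pochhammer k) sequentially"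
    by (auto simp: tendsto_fps_iff)
  then have "eventually (\<lambda>n. \<forall>k\<in>{..m}. fps_nth (P n) k = fps_nth q_pochhammer k) sequentially"
    by (simp add: eventually_ball_finite)
  with eventually_ge_at_top [of m]
  have "eventually (\<lambda>n. m \<le> n \<and> (\<forall>k\<in>{..m}. fps_nth (P n) k = fps_nth q_pochhammer k)) sequentially"
    by (rule eventually_conj)
  then obtain n where n: "m \<le> n" "\<And>k. k \<le> m \<Longrightarrow> fps_nth (P n) k = fps_nth q_pochhammer k"
    by (auto simp: eventually_sequentially)
  have S: "fps_nth (S n) k = int (divisor_sigma 1 k)" if "k \<le> m" for k
  proof (cases "k = 0")
    case False
    have "fps_nth (S n) k = (\<Sum>i\<le>n. if Suc i dvd k then int (Suc i) else 0)"
      using False by (simp add: S_def fps_sum_nth)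
    also have "\<dots> = (\<Sum>i\<in>{i\<in>{..n}. Suc i dvd k}. int (Suc i))"
      by (intro sum.mono_neutral_cong_right) auto
    also have "\<dots> = (\<Sum>d | d dvd k. int d)"
    proof (rule sum.reindex_bij_witness [where i = "\<lambda>d. d - 1" and j = Suc])
      fix d assume "d \<in> {d. d dvd k}"
      then have "d > 0" "d \<le> k"
        using False by (auto intro: dvd_imp_le dvd_pos_nat)
      with \<open>d \<in> {d. d dvd k}\<close> show "d - 1 \<in> {i\<in>{..n}. Suc i dvd k}" "Suc (d - 1) = d"
        using \<open>k \<le> m\<close> n(1) by auto
    qed auto
    finally show ?thesis
      by (simp add: divisor_sigma_def)
  qed (simp add: S_def divisor_sigma_def fps_sum_nth)
  have "fps_nth (fps_X * fps_deriv q_pochhammer) m = fps_nth (fps_X * fps_deriv (P n)) m"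
    by (cases m) (simp_all add: n(2) [symmetric])
  also have "\<dots> = fps_nth (- S n * P n) m"
    unfolding P_def S_def X_deriv_prod ..
  also have "\<dots> = fps_nth (- Abs_fps (\<lambda>n. int (divisor_sigma 1 n)) * q_pochhammer) m"
    by (simp add: fps_mult_nth S n(2))
  finally show "fps_nth (fps_X * fps_deriv q_pochhammer) m =
      fps_nth (- Abs_fps (\<lambda>n. int (divisor_sigma 1 n)) * q_pochhammer) m" .
qed

text \<open>As h has no constant term, the equation expresses n times coefficient n through earlier
  coefficients. This identifies the formal Euler product with an analytic exponential without
  treating the product as an infinite product of functions.\<close>

lemma X_deriv_ode_unique:
  fixes f g h :: "complex fps"
  assumes "fps_X * fps_deriv f = h * f" "fps_X * fps_deriv g = h * g"
    and "fps_nth h 0 = 0" "fps_nth f 0 = fps_nth g 0"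
  shows "f = g"
proof (rule fps_ext)
  fix n
  show "fps_nth f n = fps_nth g n"
  proof (induction n rule: less_induct)
    case (less n)
    have *: "of_nat n * fps_nth u n = (\<Sum>i=1..n. fps_nth h i * fps_nth u (n - i))"
      if "fps_X * fps_deriv u = h * u" for u
    proof -
      have "of_nat n * fps_nth u n = fps_nth (fps_X * fps_deriv u) n"
        by (cases n) simp_all
      also have "\<dots> = (\<Sum>i=0..n. fps_nth h i * fps_nth u (n - i))"
        unfolding that by (simp add: fps_mult_nth)
      also have "\<dots> = (\<Sum>i=1..n. fps_nth h i * fps_nth u (n - i))"
        using assms(3) by (subst sum.atLeast_Suc_atMost) auto
      finally show ?thesis .
    qed
    have "of_nat n * fps_nth f n = of_nat n * fps_nth g n"
      unfolding * [OF assms(1)] * [OF assms(2)] by (intro sum.cong) (auto simp: less.IH)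
    then show ?case
      using assms(4) by (cases "n = 0") auto
  qed
qed

text \<open>The value c = - 1 yields the Euler product and c = 1 its reciprocal, as series to which
  \<open>X_deriv_ode_unique\<close> applies.\<close>

lemma euler_exp_fps:
  assumes c: "c = 1 \<or> c = (- 1 :: complex)"
  obtains F where "fps_conv_radius F \<ge> 1" "fps_X * fps_deriv F = fps_const c * sigma_fps 1 * F"
    "fps_nth F 0 = 1" "\<And>q. norm q < 1 \<Longrightarrow> eval_fps F q = exp (c * eval_fps euler_log_fps q)"
proof -
  define f where "f = (\<lambda>q. exp (c * eval_fps euler_log_fps q))"
  define F where "F = fps_expansion f 0"
  have sub: "eball 0 1 \<subseteq> eball 0 (fps_conv_radius euler_log_fps)"
    using conv_radius_euler_log_fps by (rule eball_mono)
  have holo: "f holomorphic_on eball 0 1"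
    unfolding f_def using sub by (intro holomorphic_intros)
  have rad: "fps_conv_radius F \<ge> 1"
    unfolding F_def by (rule conv_radius_fps_expansion [OF holo])
  have eval: "eval_fps F q = exp (c * eval_fps euler_log_fps q)" if "norm q < 1" for q
    unfolding F_def using eval_fps_expansion' [OF holo, of q] that by (simp add: f_def one_ereal_def)
  have rad': "fps_conv_radius (fps_deriv F) \<ge> 1" "fps_conv_radius (fps_deriv euler_log_fps) \<ge> 1"
    using rad conv_radius_euler_log_fps fps_conv_radius_deriv order_trans by blast+
  have "fps_deriv F = fps_const c * (fps_deriv euler_log_fps * F)"
  proof (rule eval_fps_eqD)
    show "fps_conv_radius (fps_deriv F) > 0"
      using rad'(1) by (rule order_less_le_trans [rotated]) simp
    have "1 \<le> min (fps_conv_radius (fps_deriv euler_log_fps)) (fps_conv_radius F)"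
      using rad rad' by simp
    also have "\<dots> \<le> fps_conv_radius (fps_deriv euler_log_fps * F)"
      by (rule fps_conv_radius_mult)
    finally have r2: "fps_conv_radius (fps_deriv euler_log_fps * F) \<ge> 1" .
    have "1 \<le> min (fps_conv_radius (fps_const c)) (fps_conv_radius (fps_deriv euler_log_fps * F))"
      using r2 by simp
    also have "\<dots> \<le> fps_conv_radius (fps_const c * (fps_deriv euler_log_fps * F))"
      by (rule fps_conv_radius_mult)
    finally show "fps_conv_radius (fps_const c * (fps_deriv euler_log_fps * F)) > 0"
      by (rule order_less_le_trans [rotated]) simp
    have "eval_fps (fps_deriv F) q = eval_fps (fps_const c * (fps_deriv euler_log_fps * F)) q"
      if q: "norm q < 1" for q
    proof -
      have "(eval_fps F has_field_derivative eval_fps (fps_deriv F) q) (at q)"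
        by (intro has_field_derivative_eval_fps ereal_norm_less_radius q rad)
      moreover have "((\<lambda>q. exp (c * eval_fps euler_log_fps q)) has_field_derivative
          exp (c * eval_fps euler_log_fps q) * (c * eval_fps (fps_deriv euler_log_fps) q)) (at q)"
        by (rule derivative_eq_intros refl has_field_derivative_eval_fps ereal_norm_less_radius q conv_radius_euler_log_fps)+ simp
      then have "(eval_fps F has_field_derivative
          exp (c * eval_fps euler_log_fps q) * (c * eval_fps (fps_deriv euler_log_fps) q)) (at q)"
        by (rule has_field_derivative_transform_within_open [where S = "ball 0 1"]) (use q eval in auto)
      ultimately have "eval_fps (fps_deriv F) q = exp (c * eval_fps euler_log_fps q) * (c * eval_fps (fps_deriv euler_log_fps) q)"
        by (rule DERIV_unique)
      then show ?thesis
        by (subst eval_fps_mult eval_fps_mult, (auto intro!: ereal_norm_less_radius q rad rad' r2)[2])+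
          (simp add: eval [OF q] mult_ac)
    qed
    moreover have "eventually (\<lambda>q::complex. q \<in> ball 0 1) (nhds 0)"
      by (intro eventually_nhds_in_open) auto
    ultimately show "eventually (\<lambda>q. eval_fps (fps_deriv F) q = eval_fps (fps_const c * (fps_deriv euler_log_fps * F)) q) (nhds 0)"
      by (auto elim!: eventually_mono)
  qed
  then have "fps_X * fps_deriv F = fps_const c * (fps_X * fps_deriv euler_log_fps) * F"
    by (simp add: mult_ac)
  moreover have "fps_nth F 0 = 1"
    using eval [of 0] by (simp add: eval_fps_at_0 euler_log_fps_def)
  ultimately show ?thesis
    using that rad eval by (simp add: fps_X_deriv_euler_log_fps)
qed

definition partition_fps :: "int fps" where
  "partition_fps = fps_right_inverse q_pochhammer 1"

lemma q_pochhammer_times_partition_fps: "q_pochhammer * partition_fps = 1"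
  unfolding partition_fps_def by (rule fps_right_inverse) (simp add: q_pochhammer_nth_0)

text \<open>The Euler product and the series \<open>F\<close> satisfy the same equation and so
  agree. The product of \<open>F\<close> and \<open>G\<close> has derivative 0, hence is 1, and
  \<open>G\<close> is the partition series.\<close>

lemma eval_partition_fps:
  assumes "norm q < 1"
  shows "eval_fps (complex_fps partition_fps) q = exp (eval_fps euler_log_fps q)"
    and "fps_conv_radius (complex_fps partition_fps) \<ge> 1"
proof -
  obtain F where F: "fps_conv_radius F \<ge> 1" "fps_X * fps_deriv F = fps_const (- 1) * sigma_fps 1 * F"
    "fps_nth F 0 = 1" "\<And>q. norm q < 1 \<Longrightarrow> eval_fps F q = exp (- 1 * eval_fps euler_log_fps q)"
    using euler_exp_fps [of "- 1"] by blast
  obtain G where G: "fps_conv_radius G \<ge> 1" "fps_X * fps_deriv G = fps_const 1 * sigma_fps 1 * G"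
    "fps_nth G 0 = 1" "\<And>q. norm q < 1 \<Longrightarrow> eval_fps G q = exp (1 * eval_fps euler_log_fps q)"
    using euler_exp_fps [of 1] by blast
  have "complex_fps (fps_X * fps_deriv q_pochhammer) = complex_fps (- Abs_fps (\<lambda>n. int (divisor_sigma 1 n)) * q_pochhammer)"
    by (simp only: X_deriv_q_pochhammer)
  moreover have "complex_fps (fps_X * fps_deriv q_pochhammer) = fps_X * fps_deriv (complex_fps q_pochhammer)"
    by (auto simp: fps_eq_iff)
  moreover have "complex_fps (- Abs_fps (\<lambda>n. int (divisor_sigma 1 n))) = fps_const (- 1) * sigma_fps 1"
    by (simp add: fps_eq_iff sigma_fps_def)
  ultimately have "fps_X * fps_deriv (complex_fps q_pochhammer) = fps_const (- 1) * sigma_fps 1 * complex_fps q_pochhammer"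
    by (simp only: complex_fps_mult)
  from X_deriv_ode_unique [OF this F(2)] have QF: "complex_fps q_pochhammer = F"
    by (simp add: F(3) q_pochhammer_nth_0)
  have "fps_X * fps_deriv (F * G) = (fps_X * fps_deriv F) * G + F * (fps_X * fps_deriv G)"
    by (simp add: algebra_simps)
  also have "\<dots> = 0 * (F * G)"
    unfolding F G by (simp add: fps_const_neg [symmetric] algebra_simps del: fps_const_neg)
  finally have "F * G = 1"
    by (rule X_deriv_ode_unique) (auto simp: F G)
  moreover have "F * complex_fps partition_fps = 1"
    unfolding QF [symmetric] complex_fps_mult [symmetric] q_pochhammer_times_partition_fps by simp
  ultimately have PG: "complex_fps partition_fps = G"
    by (metis mult.commute mult.left_commute mult.right_neutral)
  show "eval_fps (complex_fps partition_fps) q = exp (eval_fps euler_log_fps q)"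
    and "fps_conv_radius (complex_fps partition_fps) \<ge> 1"
    unfolding PG using G assms by auto
qed

lemma complex_fps_E6: "complex_fps E6 = 1 - fps_const 504 * sigma_fps 5"
  by (auto simp: fps_eq_iff E6_def sigma_fps_def divisor_sigma_def)

lemma conv_radius_E6: "fps_conv_radius (complex_fps E6) \<ge> 1"
proof -
  have "1 \<le> min (fps_conv_radius (1 :: complex fps)) (fps_conv_radius (fps_const 504 * sigma_fps 5))"
    using conv_radius_sigma_fps [of 5] by (simp add: fps_conv_radius_cmult_left)
  also have "\<dots> \<le> fps_conv_radius (complex_fps E6)"
    unfolding complex_fps_E6 by (rule fps_conv_radius_diff)
  finally show ?thesis .
qed

lemma eval_E6:
  assumes "Im t > 0"
  shows "eval_fps (complex_fps E6) (to_q t) = Eis6 t"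
  unfolding complex_fps_E6 Eis6_def
  by (subst eval_fps_diff, simp, rule ereal_norm_less_radius)
    (use norm_to_q_less_1 [OF assms] conv_radius_sigma_fps [of 5] in
      \<open>auto simp: fps_conv_radius_cmult_left eval_fps_mult ereal_norm_less_radius\<close>)

section \<open>Transformation under the modular group\<close>

text \<open>
  The matrix with rows \<open>(a, b)\<close>, \<open>(c, d)\<close> is written as a word in \<open>t \<mapsto> t + 1\<close> and \<open>t \<mapsto> - 1 / t\<close> by
  expanding \<open>a / c\<close> into a continued fraction with minus signs. With this choice of signs every
  principal logarithm that occurs has imaginary part less than \<open>\<pi> / 2\<close> in absolute value, so each
  inversion contributes the same phase \<open>- 3\<close> (in units of \<open>2 \<pi> / 24\<close>).
\<close>

function eta_phase :: "int \<Rightarrow> int \<Rightarrow> int \<Rightarrow> int \<Rightarrow> int" where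
  "eta_phase a b c d = (if c \<le> 1 then a + d else
     let r = (- a) mod c; k = (a + r) div c in eta_phase c d r (k * d - b) + k - 3)"
  by auto
termination
  by (relation "Wellfounded.measure (\<lambda>(a, b, c, d). nat c)") (auto simp: nat_less_iff)

declare eta_phase.simps [simp del]

text \<open>All three arguments lie strictly between - pi / 2 and pi / 2, so both sides have
  imaginary part strictly between - pi and pi, and no multiple of 2 pi i can intervene.\<close>

lemma Ln_mult_rotate:
  assumes "Re x > 0" "Re y > 0" "Re w > 0" "x * y = - \<i> * w"
  shows "Ln x + Ln y = Ln w - \<i> * (pi / 2)"
proof -
  have nz: "x \<noteq> 0" "y \<noteq> 0" "w \<noteq> 0"
    using assms by auto
  have Im: "\<bar>Im (Ln x)\<bar> < pi / 2" "\<bar>Im (Ln y)\<bar> < pi / 2" "\<bar>Im (Ln w)\<bar> < pi / 2"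
    using assms(1-3) by (intro Re_Ln_pos_lt_imp; simp)+
  have "Ln x + Ln y = Ln (exp (Ln x + Ln y))"
    using Im by (subst Ln_exp) auto
  also have "exp (Ln x + Ln y) = exp (Ln w - \<i> * (pi / 2))"
  proof -
    have "exp (\<i> * complex_of_real (pi / 2)) = \<i>"
      by (simp only: cis_conv_exp [symmetric] cis_pi_half)
    then show ?thesis
      using nz assms(4) by (simp only: exp_add exp_diff exp_Ln) (simp add: field_simps)
  qed
  also have "Ln (exp (Ln w - \<i> * (pi / 2))) = Ln w - \<i> * (pi / 2)"
    using Im by (subst Ln_exp) auto
  finally show ?thesis .
qed

text \<open>The product of z ^ 6, from the weight of E6, and the principal value of (- i z) ^ (- 1 /
  2), from 1 / eta.\<close>

definition weight_factor :: "complex \<Rightarrow> complex" where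
  "weight_factor z = z ^ 6 * exp (- Ln (- \<i> * z) / 2)"

lemma weight_factor_scale:
  assumes "x > 0" "Im z > 0"
  shows "weight_factor (of_real x * z) = of_real (x ^ 6 / sqrt x) * weight_factor z"
proof -
  have z: "- \<i> * z \<noteq> 0"
    using assms by auto
  have "Ln (- \<i> * (of_real x * z)) = Ln (of_real x * (- \<i> * z))"
    by (simp add: mult_ac)
  also have "\<dots> = of_real (ln x) + Ln (- \<i> * z)"
    using Ln_times_of_real [OF assms(1) z] assms(1) by (simp only: Ln_of_real)
  finally have "exp (- Ln (- \<i> * (of_real x * z)) / 2) = exp (- of_real (ln x / 2) + - Ln (- \<i> * z) / 2)"
    by (simp add: field_simps)
  also have "\<dots> = of_real (exp (- (ln x / 2))) * exp (- Ln (- \<i> * z) / 2)"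
    by (simp only: exp_add of_real_minus exp_of_real [symmetric])
  also have "exp (- (ln x / 2)) = 1 / sqrt x"
    using assms(1) by (simp add: exp_minus inverse_eq_divide flip: ln_sqrt)
  finally show ?thesis
    by (simp add: weight_factor_def power_mult_distrib)
qed

text \<open>The behaviour of E6 / eta under two generators of the modular group. The factor for t +
  1 comes from q ^ (- 1 / 24).\<close>

locale eta_type_form =
  fixes G :: "complex \<Rightarrow> complex"
  assumes plus_1: "Im t > 0 \<Longrightarrow> G (t + 1) = exp (- (pi * \<i> / 12)) * G t"
    and inversion: "Im t > 0 \<Longrightarrow> G (- 1 / t) = weight_factor t * G t"
begin

lemma plus_of_nat:
  assumes "Im t > 0"
  shows "G (t + of_nat n) = exp (- (pi * \<i> / 12) * of_nat n) * G t"
proof (induction n)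
  case (Suc n)
  have "G (t + of_nat (Suc n)) = exp (- (pi * \<i> / 12)) * G (t + of_nat n)"
    using plus_1 [of "t + of_nat n"] assms by (simp add: add_ac)
  then show ?case
    unfolding Suc.IH of_nat_Suc distrib_left exp_add by (simp add: mult_ac)
qed simp

lemma plus_of_int:
  assumes "Im t > 0"
  shows "G (t + of_int n) = exp (- (pi * \<i> / 12) * of_int n) * G t"
proof (cases "n \<ge> 0")
  case True
  then show ?thesis
    using plus_of_nat [OF assms, of "nat n"] by simp
next
  case False
  have "G t = exp (- (pi * \<i> / 12) * of_int (- n)) * G (t + of_int n)"
    using plus_of_nat [of "t + of_int n" "nat (- n)"] assms False by simp
  then show ?thesis
    by (simp add: exp_minus field_simps)
qed

lemma transformation:
  assumes "Im t > 0" "c > 0" "a * d - b * c = 1"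
  shows "G ((of_int a * t + of_int b) / (of_int c * t + of_int d)) =
     weight_factor (of_int c * t + of_int d) * exp (- (pi * \<i> / 12) * of_int (eta_phase a b c d)) * G t"
  using assms(2,3)
proof (induction a b c d rule: eta_phase.induct)
  case (1 a b c d)
  have Im_c: "Im (of_int c * t + of_int d) > 0"
    using 1 assms(1) by simp
  then have nz: "of_int c * t + of_int d \<noteq> 0"
    by (metis less_irrefl zero_complex.sel(2))
  show ?case
  proof (cases "c \<le> 1")
    case True
    then have c: "c = 1"
      using 1 by simp
    then have b: "b = a * d - 1"
      using 1 by simp
    have Im_td: "Im (t + of_int d) > 0"
      using assms by simp
    have "(of_int a * t + of_int b) / (of_int c * t + of_int d) = - 1 / (t + of_int d) + of_int a"
      using nz unfolding c b by (simp add: field_simps)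
    also have "G \<dots> = exp (- (pi * \<i> / 12) * of_int a) * (weight_factor (t + of_int d) * (exp (- (pi * \<i> / 12) * of_int d) * G t))"
      by (simp only: plus_of_int [OF Im_minus_inverse_pos [OF Im_td]] inversion [OF Im_td] plus_of_int [OF assms(1)])
    also have "\<dots> = weight_factor (of_int c * t + of_int d) * exp (- (pi * \<i> / 12) * of_int (a + d)) * G t"
      unfolding c of_int_add distrib_left exp_add by (simp add: mult_ac)
    finally show ?thesis
      using c by (simp add: eta_phase.simps)
  next
    case False
    \<comment> \<open>Here a / c = k - r / c, so the transformed point is k - 1 / s, where s belongs
      to the smaller bottom row (r, e).\<close>
    define r k where "r = (- a) mod c" and "k = (a + r) div c"
    have "c dvd a + r"
      unfolding r_def by (metis add.commute dvd_minus_iff mod_0_imp_dvd mod_add_right_eq neg_eq_iff_add_eq_0 mod_0 right_minus)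
    then have k: "k * c = a + r"
      by (simp add: k_def)
    have "r \<noteq> 0"
    proof
      assume "r = 0"
      then have "c dvd 1"
        using k 1(3) by (metis add.right_neutral dvd_diff dvd_mult2 dvd_triv_right)
      then show False
        using False 1(2) by simp
    qed
    then have r: "r > 0"
      using 1(2) unfolding r_def by (metis Euclidean_Rings.pos_mod_sign order_le_less)
    define e where "e = k * d - b"
    have a: "a = k * c - r"
      using k by simp
    have det: "c * e - d * r = 1"
      using 1(3) unfolding e_def a by (simp add: algebra_simps)
    define s where "s = (of_int c * t + of_int d) / (of_int r * t + of_int e)"
    have Im_r: "Im (of_int r * t + of_int e) > 0"
      using r assms(1) by simp
    then have nz_r: "of_int r * t + of_int e \<noteq> 0"
      by (metis less_irrefl zero_complex.sel(2))
    have s_mult: "s * (of_int r * t + of_int e) = of_int c * t + of_int d"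
      using nz_r by (simp add: s_def)
    have Im_s: "Im s > 0"
    proof -
      have "Im (of_int c * t + of_int d) * Re (of_int r * t + of_int e) - Re (of_int c * t + of_int d) * Im (of_int r * t + of_int e)
          = of_int (c * e - d * r) * Im t"
        by (simp add: algebra_simps)
      then have "Im s = Im t / ((Re (of_int r * t + of_int e))\<^sup>2 + (Im (of_int r * t + of_int e))\<^sup>2)"
        unfolding s_def Im_divide det by simp
      then show ?thesis
        using assms(1) Im_r by (simp only: divide_pos_pos add_nonneg_pos zero_le_power2 zero_less_power)
    qed
    have IH: "G s = weight_factor (of_int r * t + of_int e) * exp (- (pi * \<i> / 12) * of_int (eta_phase c d r e)) * G t"
      unfolding s_def e_def
      by (rule "1.IH" [OF False r_def k_def r]) (use det in \<open>simp add: e_def\<close>)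
    have "(of_int a * t + of_int b) / (of_int c * t + of_int d) = - 1 / s + of_int k"
      unfolding s_def using nz nz_r by (simp add: a e_def field_simps)
    also have "G \<dots> = exp (- (pi * \<i> / 12) * of_int k) * (weight_factor s * G s)"
      by (simp only: plus_of_int [OF Im_minus_inverse_pos [OF Im_s]] inversion [OF Im_s])
    also have "\<dots> = (weight_factor s * weight_factor (of_int r * t + of_int e)) *
        (exp (- (pi * \<i> / 12) * of_int k) * exp (- (pi * \<i> / 12) * of_int (eta_phase c d r e))) * G t"
      unfolding IH by (simp only: mult_ac)
    \<comment> \<open>By \<open>Ln_mult_rotate\<close> the two square roots combine to one, up to
      exp (pi i / 4). This is the phase - 3.\<close>
    also have "weight_factor s * weight_factor (of_int r * t + of_int e) =
        weight_factor (of_int c * t + of_int d) * exp (- (pi * \<i> / 12) * (- 3))"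
    proof -
      have half: "- A / 2 + - B / 2 = - C / 2 + - (pi * \<i> / 12) * (- 3)" if "A + B = C - \<i> * (pi / 2)" for A B C
      proof -
        have "- A / 2 + - B / 2 = - (A + B) / 2"
          by (simp add: field_simps)
        then show ?thesis
          unfolding that by (simp add: field_simps)
      qed
      have "- Ln (- \<i> * s) / 2 + - Ln (- \<i> * (of_int r * t + of_int e)) / 2 =
          - Ln (- \<i> * (of_int c * t + of_int d)) / 2 + - (pi * \<i> / 12) * (- 3)"
        by (rule half, rule Ln_mult_rotate) (use Im_s Im_r Im_c s_mult in \<open>auto simp: algebra_simps\<close>)
      then have 1: "exp (- Ln (- \<i> * s) / 2) * exp (- Ln (- \<i> * (of_int r * t + of_int e)) / 2) =
          exp (- Ln (- \<i> * (of_int c * t + of_int d)) / 2) * exp (- (pi * \<i> / 12) * (- 3))"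
        by (simp only: exp_add [symmetric])
      have 2: "s ^ 6 * (of_int r * t + of_int e) ^ 6 = (of_int c * t + of_int d) ^ 6"
        by (simp only: power_mult_distrib [symmetric] s_mult)
      have swap: "(w * x) * (y * z) = (w * y) * (x * z)" for w x y z :: complex
        by (simp only: mult_ac)
      show ?thesis
        unfolding weight_factor_def by (subst swap, simp only: 1 2, simp only: mult.assoc)
    qed
    also have "weight_factor (of_int c * t + of_int d) * exp (- (pi * \<i> / 12) * (- 3)) *
        (exp (- (pi * \<i> / 12) * of_int k) * exp (- (pi * \<i> / 12) * of_int (eta_phase c d r e))) =
        weight_factor (of_int c * t + of_int d) * exp (- (pi * \<i> / 12) * of_int (eta_phase c d r e + k - 3))"
      by (simp only: of_int_add of_int_diff of_int_numeral distrib_left right_diff_distrib exp_add exp_diff)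
        (simp add: exp_minus field_simps)
    also have "eta_phase c d r e + k - 3 = eta_phase a b c d"
      using False by (subst (2) eta_phase.simps) (simp add: Let_def r_def k_def e_def)
    finally show ?thesis .
  qed
qed

end

section \<open>The Legendre symbol modulo 13 and the multiplier for denominators 13 and 169\<close>

definition chi13 :: "int \<Rightarrow> int" where
  "chi13 n = (if 13 dvd n then 0 else if n mod 13 \<in> {1, 3, 4, 9, 10, 12} then 1 else - 1)"

text \<open>With \<open>if\<close> the simplifier would unfold the recursion under an undecided test.\<close>

lemma eta_phase_code [code]:
  "eta_phase a b c d = (case c \<le> 1 of True \<Rightarrow> a + d | False \<Rightarrow>
     let r = (- a) mod c; k = (a + r) div c in eta_phase c d r (k * d - b) + k - 3)"
  by (subst eta_phase.simps) simp

text \<open>The matrix with rows (24 b, B), (c, - 24 b') has determinant 1 when c B = - (576 b b' +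
  1). Its phase matters only modulo 24.\<close>

definition eta_phase_ok :: "int \<Rightarrow> int \<Rightarrow> int \<Rightarrow> int \<Rightarrow> bool" where
  "eta_phase_ok c b b' v \<longleftrightarrow> (576 * b * b' + 1) mod c = 0 \<and>
     eta_phase (24 * b) (- ((576 * b * b' + 1) div c)) c (- 24 * b') mod 24 = v"

primrec eta_phase_check :: "int \<Rightarrow> (int \<Rightarrow> int) \<Rightarrow> (int \<Rightarrow> int) \<Rightarrow> int list \<Rightarrow> bool" where
  "eta_phase_check c f g [] = True"
| "eta_phase_check c f g (b # bs) = (eta_phase_ok c b (f b) (g b) \<and> eta_phase_check c f g bs)"

text \<open>The factors 3 here and 120 in \<open>dual169\<close> are the inverses of \<open>- 576\<close> modulo 13 and 169.\<close>

definition dual13 :: "int \<Rightarrow> int" where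
  "dual13 b = 3 * b ^ 11 mod 13"

text \<open>The phase is 0 or 12 modulo 24, so the multiplier equals \<open>chi13 b\<close>. The
  finite check takes the place of an evaluation of Dedekind sums.\<close>

lemma eta_phase_13: "eta_phase_check 13 dual13 (\<lambda>b. 6 - 6 * chi13 b) [1..12]"
  by code_simp

text \<open>There are 156 units modulo 169, so the power with exponent 155 is the inverse of b, as
  is the one with exponent 11 modulo 13.\<close>

definition dual169 :: "int \<Rightarrow> int" where
  "dual169 b = 120 * mod_exp b 155 169 mod 169"

lemma eta_phase_169: "eta_phase_check 169 dual169 (\<lambda>_. 0) (filter (\<lambda>b. b mod 13 \<noteq> 0) [0..168])"
  by code_simp

section \<open>The Hecke operator\<close>

lemma eta_phase_checkD: "eta_phase_check c f g bs \<Longrightarrow> b \<in> set bs \<Longrightarrow> eta_phase_ok c b (f b) (g b)"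
  by (induction bs) auto

definition residues13 :: "int \<Rightarrow> int set" where
  "residues13 c = {b \<in> {0..<c}. \<not> 13 dvd b}"

lemma finite_residues13 [simp, intro]: "finite (residues13 c)"
  by (rule finite_subset [of _ "{0..<c}"]) (auto simp: residues13_def)

lemma residues13_13: "residues13 13 \<subseteq> set [1..12]"
proof
  fix b assume b: "b \<in> residues13 13"
  then have "b \<noteq> 0"
    by (auto simp: residues13_def)
  with b show "b \<in> set [1..12]"
    by (auto simp: residues13_def)
qed

lemma eta_phase_ok_13: "b \<in> residues13 13 \<Longrightarrow> eta_phase_ok 13 b (dual13 b) (6 - 6 * chi13 b)"
  by (rule eta_phase_checkD [OF eta_phase_13]) (rule subsetD [OF residues13_13])

lemma eta_phase_ok_169: "b \<in> residues13 169 \<Longrightarrow> eta_phase_ok 169 b (dual169 b) 0"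
  by (rule eta_phase_checkD [OF eta_phase_169]) (auto simp: residues13_def dvd_eq_mod_eq_0)

text \<open>The congruence 576 b f(b) = - 1 modulo c makes f(b) a unit that determines b.\<close>

lemma bij_betw_residues13:
  assumes "13 dvd c" "\<And>b. b \<in> residues13 c \<Longrightarrow> f b \<in> {0..<c}"
    and ok: "\<And>b. b \<in> residues13 c \<Longrightarrow> eta_phase_ok c b (f b) (g b)"
  shows "bij_betw f (residues13 c) (residues13 c)"
proof -
  have c: "c dvd 576 * b * f b + 1" if "b \<in> residues13 c" for b
    using ok [OF that] unfolding eta_phase_ok_def by (intro mod_0_imp_dvd) blast
  have maps: "f b \<in> residues13 c" if b: "b \<in> residues13 c" for b
  proof -
    have "\<not> 13 dvd f b"
    proof
      assume "13 dvd f b"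
      then have "13 dvd (576 * b * f b + 1) - 576 * b * f b"
        by (intro dvd_diff dvd_mult dvd_trans [OF assms(1) c [OF b]])
      then show False
        by simp
    qed
    with assms(2) [OF b] show ?thesis
      by (simp add: residues13_def)
  qed
  have "inj_on f (residues13 c)"
  proof (rule inj_onI)
    fix x y assume x: "x \<in> residues13 c" and y: "y \<in> residues13 c" and eq: "f x = f y"
    have "c dvd (576 * x * f x + 1) - (576 * y * f y + 1)"
      using c x y by (intro dvd_diff) auto
    then have "c dvd x * ((576 * x * f x + 1) - (576 * y * f y + 1))"
      by (rule dvd_mult)
    moreover have "c dvd (x - y) * (576 * x * f x + 1)"
      using c x by (intro dvd_mult) auto
    ultimately have "c dvd (x - y) * (576 * x * f x + 1) - x * ((576 * x * f x + 1) - (576 * y * f y + 1))"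
      by (intro dvd_diff)
    also have "(x - y) * (576 * x * f x + 1) - x * ((576 * x * f x + 1) - (576 * y * f y + 1)) = x - y"
      unfolding eq by (simp add: algebra_simps)
    finally have "x mod c = y mod c"
      by (simp add: mod_eq_dvd_iff)
    then show "x = y"
      using x y by (simp add: residues13_def)
  qed
  moreover from this have "f ` residues13 c = residues13 c"
    using maps by (intro endo_inj_surj) auto
  ultimately show ?thesis
    by (simp add: bij_betw_def)
qed

lemma bij_dual13: "bij_betw dual13 (residues13 13) (residues13 13)"
  by (rule bij_betw_residues13 [OF _ _ eta_phase_ok_13]) (auto simp: dual13_def)

lemma bij_dual169: "bij_betw dual169 (residues13 169) (residues13 169)"
  by (rule bij_betw_residues13 [OF _ _ eta_phase_ok_169]) (auto simp: dual169_def)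

text \<open>The dual of b is - 1 / (24 ^ 2 b) modulo 13, and - 1 is a square modulo 13.\<close>

lemma chi13_dual13: "b \<in> residues13 13 \<Longrightarrow> chi13 (dual13 b) = chi13 b"
proof -
  assume "b \<in> residues13 13"
  then have "b \<in> set [1..12]"
    by (rule subsetD [OF residues13_13])
  moreover have "\<forall>b\<in>set [1..12]. chi13 (dual13 b) = chi13 b"
    by (simp add: upto.simps dual13_def chi13_def)
  ultimately show ?thesis
    by blast
qed

lemma chi13_cases: "b \<in> residues13 13 \<Longrightarrow> chi13 b = 1 \<or> chi13 b = - 1"
  by (auto simp: chi13_def residues13_def)

text \<open>
  Under \<open>t \<mapsto> - 1 / t\<close> the summands of the first sum with \<open>b\<close> prime to 13 are permuted, those with
  \<open>b \<noteq> 0\<close> divisible by 13 are exchanged with the second sum, and the one with \<open>b = 0\<close> with the last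
  term; the normalizing factors are forced by this.
\<close>

definition hecke169 :: "(complex \<Rightarrow> complex) \<Rightarrow> complex \<Rightarrow> complex" where
  "hecke169 G t = 1 / 169 * (\<Sum>b\<in>{0..<169}. G ((t + 24 * of_int b) / 169)) +
     of_real (13 ^ 4 / sqrt 13) * (\<Sum>b\<in>residues13 13. of_int (chi13 b) * G (t + 24 * of_int b / 13)) +
     13 ^ 9 * G (169 * t)"

lemma sum_residues_169:
  fixes f :: "int \<Rightarrow> complex"
  shows "(\<Sum>b\<in>{0..<169}. f b) = f 0 + (\<Sum>b\<in>residues13 13. f (13 * b)) + (\<Sum>b\<in>residues13 169. f b)"
proof -
  have inj: "inj_on ((*) 13) (residues13 13)"
    by (auto simp: inj_on_def)
  have "{0..<169} = insert 0 ((*) 13 ` residues13 13 \<union> residues13 169)" (is "?A = ?B")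
  proof
    show "?A \<subseteq> ?B"
    proof
      fix b :: int assume b: "b \<in> {0..<169}"
      show "b \<in> ?B"
      proof (cases "13 dvd b")
        case True
        then obtain c where c: "b = 13 * c"
          by (elim dvdE)
        with b have "c = 0 \<or> c \<in> residues13 13"
          by (auto simp: residues13_def dest: zdvd_imp_le)
        then show ?thesis
          using c by auto
      qed (use b in \<open>auto simp: residues13_def\<close>)
    qed
  qed (auto simp: residues13_def)
  moreover have "0 \<notin> (*) 13 ` residues13 13 \<union> residues13 169"
      "(*) 13 ` residues13 13 \<inter> residues13 169 = {}"
    by (auto simp: residues13_def)
  note disjoint = this
  ultimately have "(\<Sum>b\<in>{0..<169}. f b) = (\<Sum>b\<in>insert 0 ((*) 13 ` residues13 13 \<union> residues13 169). f b)"
    by simp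
  also have "\<dots> = f 0 + (\<Sum>b\<in>(*) 13 ` residues13 13 \<union> residues13 169. f b)"
    by (subst sum.insert) (use disjoint in auto)
  also have "(\<Sum>b\<in>(*) 13 ` residues13 13 \<union> residues13 169. f b) =
      (\<Sum>b\<in>(*) 13 ` residues13 13. f b) + (\<Sum>b\<in>residues13 169. f b)"
    by (subst sum.union_disjoint) (use disjoint in auto)
  also have "(\<Sum>b\<in>(*) 13 ` residues13 13. f b) = (\<Sum>b\<in>residues13 13. f (13 * b))"
    using inj by (simp add: sum.reindex)
  finally show ?thesis
    by (simp add: add.assoc)
qed

context eta_type_form
begin

lemma exp_phase:
  assumes "n mod 24 = 6 - 6 * e" "e = 1 \<or> e = - 1"
  shows "exp (- (pi * \<i> / 12) * of_int n) = of_int e"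
proof -
  define m where "m = n div 24"
  have n: "n = 24 * m + (6 - 6 * e)"
    using assms(1) by (simp add: m_def minus_mod_eq_mult_div [symmetric])
  have "- (pi * \<i> / 12) * of_int n = of_int (2 * (- m)) * (of_real pi * \<i>) + - (pi * \<i>) * of_int ((1 - e) div 2)"
    unfolding n using assms(2) by (auto simp: field_simps)
  also have "exp \<dots> = exp (- (pi * \<i>) * of_int ((1 - e) div 2))"
    unfolding exp_add using exp_integer_2pi [of "of_int (- m)"] by (simp add: mult_ac)
  also have "\<dots> = of_int e"
    using assms(2) by (auto simp: exp_minus)
  finally show ?thesis .
qed

text \<open>Put v = c u - 24 b'. For v = t (with c = 169) and for v = 13 t or t / 13 (with c = 13),
  the argument on the left is that of a summand of the Hecke sum at - 1 / t, and u is that of its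
  partner at t.\<close>

lemma transformation_dual:
  assumes u: "Im u > 0" and c: "c > 0" and ok: "eta_phase_ok c b b' (6 - 6 * e)" and e: "e = 1 \<or> e = - 1"
  shows "G (24 * of_int b / of_int c - 1 / (of_int c * (of_int c * u - 24 * of_int b'))) =
     weight_factor (of_int c * u - 24 * of_int b') * of_int e * G u"
proof -
  define B where "B = - ((576 * b * b' + 1) div c)"
  have "c dvd 576 * b * b' + 1"
    using ok unfolding eta_phase_ok_def by (intro mod_0_imp_dvd) blast
  then have B: "c * B = - (576 * b * b' + 1)"
    by (simp add: B_def)
  have phase: "eta_phase (24 * b) B c (- 24 * b') mod 24 = 6 - 6 * e"
    using ok by (simp add: eta_phase_ok_def B_def)
  define v where "v = of_int c * u - 24 * of_int b'"
  have "Im v > 0"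
    using u c by (simp add: v_def)
  then have v: "v \<noteq> 0"
    by auto
  have "of_int c * (of_int (24 * b) * u + of_int B) = 24 * of_int b * (of_int c * u) + of_int (c * B)"
    by (simp add: algebra_simps)
  also have "\<dots> = 24 * of_int b * v - 1"
    unfolding B v_def by (simp add: algebra_simps)
  finally have eq: "of_int c * (of_int (24 * b) * u + of_int B) = 24 * of_int b * v - 1" .
  have "(of_int (24 * b) * u + of_int B) / v = (of_int c * (of_int (24 * b) * u + of_int B)) / (of_int c * v)"
    using c by simp
  also have "\<dots> = 24 * of_int b / of_int c - 1 / (of_int c * v)"
    unfolding eq using v c by (simp add: diff_divide_distrib)
  finally have "(of_int (24 * b) * u + of_int B) / v = 24 * of_int b / of_int c - 1 / (of_int c * v)" .
  moreover have "G ((of_int (24 * b) * u + of_int B) / (of_int c * u + of_int (- 24 * b'))) =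
     weight_factor (of_int c * u + of_int (- 24 * b')) *
     exp (- (pi * \<i> / 12) * of_int (eta_phase (24 * b) B c (- 24 * b'))) * G u"
    by (rule transformation [OF u c]) (use B in \<open>simp add: algebra_simps\<close>)
  moreover have "of_int c * u + of_int (- 24 * b') = v"
    by (simp add: v_def)
  ultimately show ?thesis
    by (simp only: exp_phase [OF phase e] v_def)
qed

lemma hecke169_inversion:
  assumes t: "Im t > 0"
  shows "hecke169 G (- 1 / t) = weight_factor t * hecke169 G t"
proof -
  have t0: "t \<noteq> 0"
    using t by auto
  define W where "W = weight_factor t"
  define A where "A = (\<lambda>b::int. G ((t + 24 * of_int b) / 169))"
  define M where "M = (\<lambda>b::int. G (t + 24 * of_int b / 13))"
  have sqrt13: "sqrt 13 * sqrt 13 = (13::real)" "sqrt 169 = (13::real)"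
    by (simp, rule real_sqrt_unique) auto
  have A0: "G ((- 1 / t + 24 * of_int 0) / 169) = 13 ^ 11 * W * G (169 * t)"
  proof -
    have "(- 1 / t + 24 * of_int 0) / 169 = - 1 / (169 * t)"
      using t0 by (simp add: field_simps)
    also have "G \<dots> = weight_factor (169 * t) * G (169 * t)"
      by (rule inversion) (use t in simp)
    also have "weight_factor (169 * t) = 13 ^ 11 * W"
      using weight_factor_scale [of 169 t] t by (simp add: sqrt13 W_def)
    finally show ?thesis .
  qed
  have L: "G (169 * (- 1 / t)) = 1 / 13 ^ 11 * W * A 0"
  proof -
    have "169 * (- 1 / t) = - 1 / (of_real (1 / 169) * t)"
      using t0 by (simp add: field_simps)
    also have "G \<dots> = weight_factor (of_real (1 / 169) * t) * G (of_real (1 / 169) * t)"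
      by (rule inversion) (use t in simp)
    also have "weight_factor (of_real (1 / 169) * t) = 1 / 13 ^ 11 * W"
      by (subst weight_factor_scale) (use t in \<open>simp_all add: sqrt13 W_def real_sqrt_divide power_one_over\<close>)
    finally show ?thesis
      by (simp add: A_def)
  qed
  have AU: "G ((- 1 / t + 24 * of_int b) / 169) = W * A (dual169 b)" if b: "b \<in> residues13 169" for b
  proof -
    define u where "u = (t + 24 * of_int (dual169 b)) / 169"
    have u: "of_int 169 * u - 24 * of_int (dual169 b) = t"
      by (simp add: u_def field_simps)
    have "eta_phase_ok 169 b (dual169 b) (6 - 6 * 1)"
      using eta_phase_ok_169 [OF b] by simp
    moreover have "Im u > 0"
      using t by (simp add: u_def)
    ultimately have "G (24 * of_int b / of_int 169 - 1 / (of_int 169 * t)) = W * of_int 1 * G u"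
      using transformation_dual [of u 169 b "dual169 b" 1] unfolding u W_def by simp
    moreover have "24 * of_int b / of_int 169 - 1 / (of_int 169 * t) = (- 1 / t + 24 * of_int b) / 169"
      using t0 by (simp add: field_simps)
    ultimately show ?thesis
      by (simp only: A_def u_def of_int_1 mult_1_right)
  qed
  have A13: "G ((- 1 / t + 24 * of_int (13 * b)) / 169) = of_real (13 ^ 6 / sqrt 13) * W * (of_int (chi13 (dual13 b)) * M (dual13 b))"
    if b: "b \<in> residues13 13" for b
  proof -
    define u where "u = t + 24 * of_int (dual13 b) / 13"
    have u: "of_int 13 * u - 24 * of_int (dual13 b) = of_real 13 * t"
      by (simp add: u_def field_simps)
    have "Im u > 0"
      using t by (simp add: u_def)
    then have "G (24 * of_int b / of_int 13 - 1 / (of_int 13 * (of_real 13 * t))) = weight_factor (of_real 13 * t) * of_int (chi13 b) * G u"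
      using transformation_dual [OF _ _ eta_phase_ok_13 [OF b] chi13_cases [OF b], of u] unfolding u by simp
    moreover have "weight_factor (of_real 13 * t) = of_real (13 ^ 6 / sqrt 13) * W"
      unfolding W_def by (rule weight_factor_scale) (use t in auto)
    moreover have "24 * of_int b / of_int 13 - 1 / (of_int 13 * (of_real 13 * t)) = (- 1 / t + 24 * of_int (13 * b)) / 169"
      using t0 by (simp add: field_simps)
    ultimately show ?thesis
      by (simp only: chi13_dual13 [OF b] M_def u_def mult.assoc)
  qed
  have MM: "of_int (chi13 b) * G (- 1 / t + 24 * of_int b / 13) = of_real (sqrt 13 / 13 ^ 6) * W * A (13 * dual13 b)"
    if b: "b \<in> residues13 13" for b
  proof -
    define u where "u = (t + 24 * of_int (13 * dual13 b)) / 169"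
    have u: "of_int 13 * u - 24 * of_int (dual13 b) = of_real (1 / 13) * t"
      by (simp add: u_def field_simps)
    have "Im u > 0"
      using t by (simp add: u_def)
    then have "G (24 * of_int b / of_int 13 - 1 / (of_int 13 * (of_real (1 / 13) * t))) = weight_factor (of_real (1 / 13) * t) * of_int (chi13 b) * G u"
      using transformation_dual [OF _ _ eta_phase_ok_13 [OF b] chi13_cases [OF b], of u] unfolding u by simp
    moreover have "weight_factor (of_real (1 / 13) * t) = of_real (sqrt 13 / 13 ^ 6) * W"
      unfolding W_def by (subst weight_factor_scale) (use t in \<open>simp_all add: real_sqrt_divide power_divide\<close>)
    moreover have "24 * of_int b / of_int 13 - 1 / (of_int 13 * (of_real (1 / 13) * t)) = - 1 / t + 24 * of_int b / 13"
      using t0 by (simp add: field_simps)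
    ultimately have "G (- 1 / t + 24 * of_int b / 13) = of_real (sqrt 13 / 13 ^ 6) * W * of_int (chi13 b) * A (13 * dual13 b)"
      by (simp only: A_def u_def)
    then show ?thesis
      using chi13_cases [OF b] by auto
  qed
  have sum1: "(\<Sum>b\<in>{0..<169}. G ((- 1 / t + 24 * of_int b) / 169)) =
      13 ^ 11 * W * G (169 * t) +
      of_real (13 ^ 6 / sqrt 13) * W * (\<Sum>b\<in>residues13 13. of_int (chi13 b) * M b) +
      W * (\<Sum>b\<in>residues13 169. A b)"
  proof -
    have "(\<Sum>b\<in>residues13 13. of_int (chi13 (dual13 b)) * M (dual13 b)) = (\<Sum>b\<in>residues13 13. of_int (chi13 b) * M b)"
      by (rule sum.reindex_bij_betw [OF bij_dual13])
    moreover have "(\<Sum>b\<in>residues13 169. A (dual169 b)) = (\<Sum>b\<in>residues13 169. A b)"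
      by (rule sum.reindex_bij_betw [OF bij_dual169])
    ultimately show ?thesis
      unfolding sum_residues_169 A0 by (simp only: A13 AU sum_distrib_left [symmetric] cong: sum.cong)
  qed
  have sum2: "(\<Sum>b\<in>residues13 13. of_int (chi13 b) * G (- 1 / t + 24 * of_int b / 13)) =
      of_real (sqrt 13 / 13 ^ 6) * W * (\<Sum>b\<in>residues13 13. A (13 * b))"
  proof -
    have "(\<Sum>b\<in>residues13 13. A (13 * dual13 b)) = (\<Sum>b\<in>residues13 13. A (13 * b))"
      by (rule sum.reindex_bij_betw [OF bij_dual13])
    then show ?thesis
      by (simp only: MM sum_distrib_left [symmetric] cong: sum.cong)
  qed
  define s where "s = complex_of_real (sqrt 13)"
  have s: "s \<noteq> 0" "s * s = 13"
    by (simp_all add: s_def sqrt13 flip: of_real_mult)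
  have "hecke169 G (- 1 / t) = 1 / 169 * (13 ^ 11 * W * G (169 * t) +
      13 ^ 6 / s * W * (\<Sum>b\<in>residues13 13. of_int (chi13 b) * M b) + W * (\<Sum>b\<in>residues13 169. A b)) +
      13 ^ 4 / s * (s / 13 ^ 6 * W * (\<Sum>b\<in>residues13 13. A (13 * b))) + 13 ^ 9 * (1 / 13 ^ 11 * W * A 0)"
    unfolding hecke169_def sum1 sum2 L by (simp add: s_def)
  \<comment> \<open>The constants match: 13 ^ 11 / 169 = 13 ^ 9, 13 ^ 6 / 169 = 13 ^ 4, and the
    factors s cancel in the exchanged sum, leaving 13 ^ 4 / 13 ^ 6 = 1 / 169.\<close>
  also have "\<dots> = W * (1 / 169 * (A 0 + (\<Sum>b\<in>residues13 13. A (13 * b)) + (\<Sum>b\<in>residues13 169. A b)) +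
      13 ^ 4 / s * (\<Sum>b\<in>residues13 13. of_int (chi13 b) * M b) + 13 ^ 9 * G (169 * t))"
    using s(1) by (simp add: field_simps)
  also have "\<dots> = W * hecke169 G t"
    unfolding hecke169_def by (simp only: sum_residues_169 [of A, symmetric]) (simp add: A_def M_def s_def)
  finally show ?thesis
    by (simp add: W_def)
qed

end

section \<open>Sums of roots of unity and the Gauss sum modulo 13\<close>

lemma has_sum_sum:
  fixes f :: "'b \<Rightarrow> 'a \<Rightarrow> 'c :: topological_comm_monoid_add"
  assumes "\<And>b. b \<in> B \<Longrightarrow> (f b has_sum s b) A"
  shows "((\<lambda>x. \<Sum>b\<in>B. f b x) has_sum (\<Sum>b\<in>B. s b)) A"
  using assms by (induction B rule: infinite_finite_induct) (auto intro!: has_sum_add)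

lemma to_q_add: "to_q (x + y) = to_q x * to_q y"
  by (simp add: to_q_def distrib_left exp_add)

lemma to_q_of_int [simp]: "to_q (of_int n) = 1"
  using exp_integer_2pi [of "of_int n"] by (simp add: to_q_def mult_ac)

lemma to_q_of_real_eq_1_iff: "to_q (of_real x) = 1 \<longleftrightarrow> x \<in> \<int>"
  by (auto simp: to_q_def exp_eq_1 Ints_def field_simps)

lemma to_q_rational_eq_1_iff:
  assumes "c > 0"
  shows "to_q (of_int N / of_int c) = 1 \<longleftrightarrow> c dvd N"
proof -
  have "of_int N / of_int c = (of_real (of_int N / of_int c) :: complex)"
    by simp
  then have "to_q (of_int N / of_int c) = 1 \<longleftrightarrow> of_int N / of_int c \<in> (\<int> :: real set)"
    by (simp only: to_q_of_real_eq_1_iff)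
  also have "\<dots> \<longleftrightarrow> c dvd N"
  proof
    assume "of_int N / of_int c \<in> (\<int> :: real set)"
    then obtain k where "real_of_int N / of_int c = of_int k"
      by (elim Ints_cases)
    then have "real_of_int N = of_int (k * c)"
      using assms by (simp add: field_simps)
    then have "N = k * c"
      by (simp only: of_int_eq_iff)
    then show "c dvd N"
      by simp
  qed (use assms in \<open>auto elim!: dvdE\<close>)
  finally show ?thesis .
qed

lemma sum_to_q_residues:
  assumes "c > 0"
  shows "(\<Sum>b\<in>{0..<c}. to_q (of_int N * of_int b / of_int c)) = (if c dvd N then of_int c else 0)"
proof -
  define w where "w = to_q (of_int N / of_int c)"
  have "(\<Sum>b\<in>{0..<c}. to_q (of_int N * of_int b / of_int c)) = (\<Sum>k<nat c. w ^ k)"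
    by (rule sum.reindex_bij_witness [where i = int and j = nat])
      (auto simp: w_def to_q_power mult_ac)
  also have "\<dots> = (if c dvd N then of_int c else 0)"
  proof (cases "c dvd N")
    case True
    then have "w = 1"
      unfolding w_def to_q_rational_eq_1_iff [OF assms] .
    then show ?thesis
      using True assms by simp
  next
    case False
    then have "w \<noteq> 1"
      unfolding w_def to_q_rational_eq_1_iff [OF assms] .
    moreover have "w ^ nat c = 1"
      using assms by (simp add: w_def to_q_power)
    ultimately show ?thesis
      using False by (simp add: geometric_sum)
  qed
  finally show ?thesis .
qed

text \<open>Only the square of the sum is computed, which leaves the sign \<open>e\<close> open. The
  sign does not depend on N.\<close>

lemma gauss_sum_13:
  obtains e :: int where "e = 1 \<or> e = - 1"
    "\<And>N. (\<Sum>b\<in>residues13 13. of_int (chi13 b) * to_q (of_int N * of_int b / 13)) = of_int (e * chi13 N) * of_real (sqrt 13)"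
proof -
  define P where "P = (\<lambda>k::int. to_q (of_int k / 13))"
  have P_mod: "P k = P (k mod 13)" for k
  proof -
    have "k = 13 * (k div 13) + k mod 13"
      by simp
    then have eq: "of_int k / 13 = of_int (k div 13) + (of_int (k mod 13) / 13 :: complex)"
      by (metis (no_types, lifting) add_divide_distrib nonzero_mult_div_cancel_left of_int_add of_int_mult of_int_numeral zero_neq_numeral)
    show ?thesis
      unfolding P_def by (subst eq) (simp only: to_q_add to_q_of_int mult_1_left)
  qed
  have P_mult: "P j * P k = P ((j + k) mod 13)" for j k
    unfolding P_mod [of "j + k", symmetric] by (simp add: P_def add_divide_distrib flip: to_q_add)
  have P_0: "P 0 = 1"
    by (simp add: P_def to_q_def)
  have units: "residues13 13 = {1, 2, 3, 4, 5, 6, 7, 8, 9, 10, 11, 12}"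
  proof
    show "residues13 13 \<subseteq> {1, 2, 3, 4, 5, 6, 7, 8, 9, 10, 11, 12}"
      using residues13_13 by (simp add: upto.simps)
  qed (auto simp: residues13_def)
  define A where "A = P 1 + P 3 + P 4 + P 9 + P 10 + P 12"
  define B where "B = P 2 + P 5 + P 6 + P 7 + P 8 + P 11"
  have "(\<Sum>b\<in>{0..<13}. to_q (of_int 1 * of_int b / of_int 13)) = 0"
    by (subst sum_to_q_residues) auto
  moreover have interval: "{0..<13} = {0, 1, 2, 3, 4, 5, 6, 7, 8, 9, 10, 11, 12::int}"
  proof -
    have "{0..<13::int} = set [0..12]"
      by auto
    then show ?thesis
      by (simp add: upto.simps)
  qed
  ultimately have AB: "1 + A + B = 0"
    using P_0 by (simp add: A_def B_def P_def add_ac)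
  \<comment> \<open>Among the 36 sums of two nonzero squares modulo 13, 0 occurs 6 times, each
    nonzero square twice and each nonsquare three times.\<close>
  have AA: "A * A = 6 + 2 * A + 3 * B"
    by (simp add: A_def B_def distrib_left distrib_right P_mult P_0)
  have B: "B = - 1 - A"
    using AB by (simp add: algebra_simps eq_neg_iff_add_eq_0)
  have "(A - B) ^ 2 = 1 + 4 * A + 4 * (A * A)"
    unfolding B by (simp add: power2_eq_square algebra_simps)
  also have "\<dots> = 13"
    unfolding AA B by (simp add: algebra_simps)
  finally have "(A - B) ^ 2 = 13" .
  also have "\<dots> = complex_of_real (sqrt 13) ^ 2"
    by (simp flip: of_real_power)
  finally have "A - B = of_real (sqrt 13) \<or> A - B = - of_real (sqrt 13)"
    by (simp only: power2_eq_iff)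
  then obtain e :: int where e: "e = 1 \<or> e = - 1" "A - B = of_int e * of_real (sqrt 13)"
    by (metis mult_1 mult_minus1 of_int_1 of_int_minus)
  have "(\<Sum>b\<in>residues13 13. of_int (chi13 b) * to_q (of_int N * of_int b / 13)) = of_int (chi13 N) * (A - B)" for N
  proof -
    define r where "r = N mod 13"
    have r: "r \<in> {0, 1, 2, 3, 4, 5, 6, 7, 8, 9, 10, 11, 12}"
      unfolding interval [symmetric] r_def by simp
    have "to_q (of_int N * of_int b / 13) = P ((r * b) mod 13)" for b
      using P_mod [of "N * b"] by (simp add: P_def r_def mod_mult_left_eq)
    then have "(\<Sum>b\<in>residues13 13. of_int (chi13 b) * to_q (of_int N * of_int b / 13)) =
        (\<Sum>b\<in>residues13 13. of_int (chi13 b) * P ((r * b) mod 13))"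
      by simp
    also have "\<dots> = of_int (chi13 r) * (A - B)"
      using r unfolding units A_def B_def by (elim insertE emptyE) (simp_all add: chi13_def)
    also have "chi13 r = chi13 N"
      by (simp add: chi13_def r_def dvd_mod_iff)
    finally show ?thesis .
  qed
  with e that show ?thesis
    by (simp add: mult_ac)
qed

section \<open>Forms as integral coefficient sequences, and the Hecke action on them\<close>

definition q_term :: "int \<Rightarrow> complex \<Rightarrow> complex" where
  "q_term n t = to_q ((of_int n - 1 / 24) * t)"

definition fourier :: "(int \<Rightarrow> int) \<Rightarrow> complex \<Rightarrow> complex" where
  "fourier a t = (\<Sum>\<^sub>\<infinity>n. of_int (a n) * q_term n t)"

text \<open>Weakly holomorphic forms: the index runs over all integers with a finite principal part.
  Only the inversion is required, because the exponents n - 1 / 24 imply the law for t + 1.\<close>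

definition eta_forms :: "(int \<Rightarrow> int) set" where
  "eta_forms = {a. (\<exists>m::nat. \<forall>n < - int m. a n = 0) \<and>
     (\<forall>t. Im t > 0 \<longrightarrow> (\<lambda>n. of_int (a n) * q_term n t) summable_on UNIV) \<and>
     (\<forall>t. Im t > 0 \<longrightarrow> fourier a (- 1 / t) = weight_factor t * fourier a t)}"

lemma eta_forms_has_sum:
  "a \<in> eta_forms \<Longrightarrow> Im t > 0 \<Longrightarrow> ((\<lambda>n. of_int (a n) * q_term n t) has_sum fourier a t) UNIV"
  by (auto simp: eta_forms_def fourier_def)

lemma eta_formsI:
  assumes "\<And>n. n < - int m \<Longrightarrow> a n = 0"
    and "\<And>t. Im t > 0 \<Longrightarrow> ((\<lambda>n. of_int (a n) * q_term n t) has_sum G t) UNIV"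
    and "\<And>t. Im t > 0 \<Longrightarrow> G (- 1 / t) = weight_factor t * G t"
  shows "a \<in> eta_forms"
proof -
  have "fourier a t = G t" if "Im t > 0" for t
    unfolding fourier_def using assms(2) [OF that] by (rule infsumI)
  then show ?thesis
    using assms Im_minus_inverse_pos unfolding eta_forms_def by (auto intro: has_sum_imp_summable)
qed

lemma q_term_plus: "q_term n (t + s) = q_term n t * to_q ((of_int n - 1 / 24) * s)"
  by (simp add: q_term_def to_q_add distrib_left)

lemma eta_type_form_fourier:
  assumes "a \<in> eta_forms"
  shows "eta_type_form (fourier a)"
proof
  fix t assume t: "Im t > 0"
  show "fourier a (- 1 / t) = weight_factor t * fourier a t"
    using assms t by (auto simp: eta_forms_def)
  have "to_q ((of_int n - 1 / 24) * 1) = exp (- (pi * \<i> / 12))" for n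
  proof -
    have "(of_int n - 1 / 24) * 1 = of_int n + (- 1 / 24 :: complex)"
      by simp
    then have "to_q ((of_int n - 1 / 24) * 1) = to_q (- 1 / 24)"
      by (simp only: to_q_add to_q_of_int mult_1_left)
    then show ?thesis
      by (simp add: to_q_def field_simps)
  qed
  then have q: "q_term n (t + 1) = exp (- (pi * \<i> / 12)) * q_term n t" for n
    unfolding q_term_plus by (simp only: mult.commute)
  show "fourier a (t + 1) = exp (- (pi * \<i> / 12)) * fourier a t"
  proof (rule has_sum_unique)
    show "((\<lambda>n. of_int (a n) * q_term n (t + 1)) has_sum fourier a (t + 1)) UNIV"
      using t by (intro eta_forms_has_sum assms) simp
    show "((\<lambda>n. of_int (a n) * q_term n (t + 1)) has_sum exp (- (pi * \<i> / 12)) * fourier a t) UNIV"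
      using has_sum_cmult_right [OF eta_forms_has_sum [OF assms t], of "exp (- (pi * \<i> / 12))"]
      unfolding q by (simp only: mult.left_commute)
  qed
qed

definition hecke_coeff :: "int \<Rightarrow> (int \<Rightarrow> int) \<Rightarrow> int \<Rightarrow> int" where
  "hecke_coeff e a n = a (169 * n - 7) + 13 ^ 4 * e * chi13 (24 * n - 1) * a n +
     (if 169 dvd n + 7 then 13 ^ 9 * a ((n + 7) div 169) else 0)"

text \<open>Since 24 * 7 = 169 - 1, the inverse of 24 modulo 169 is - 7.\<close>

lemma dvd_24n_minus_1_iff: "169 dvd 24 * n - 1 \<longleftrightarrow> (\<exists>m. n = 169 * m - 7)" for n :: int
proof
  assume "169 dvd 24 * n - 1"
  then have "169 dvd 169 * n - 7 * (24 * n - 1)"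
    by (rule dvd_diff [OF dvd_triv_left dvd_mult])
  also have "169 * n - 7 * (24 * n - 1) = n + 7"
    by simp
  finally show "\<exists>m. n = 169 * m - 7"
    by (intro exI [of _ "(n + 7) div 169"]) simp
next
  assume "\<exists>m. n = 169 * m - 7"
  then obtain m where "n = 169 * m - 7"
    by blast
  then have "24 * n - 1 = 169 * (24 * m - 1)"
    by simp
  then show "169 dvd 24 * n - 1"
    by (simp only: dvd_triv_left)
qed

lemma q_term_scale:
  assumes "n = 169 * m - 7"
  shows "q_term n t = q_term m (169 * t)"
  unfolding q_term_def assms by (rule arg_cong [where f = to_q]) (simp add: field_simps)

lemma hecke_coeff_eta_forms:
  assumes a: "a \<in> eta_forms"
  obtains e where "e = 1 \<or> e = - 1" "hecke_coeff e a \<in> eta_forms"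
proof -
  obtain e :: int where e: "e = 1 \<or> e = - 1"
    "\<And>N. (\<Sum>b\<in>residues13 13. of_int (chi13 b) * to_q (of_int N * of_int b / 13)) = of_int (e * chi13 N) * of_real (sqrt 13)"
    using gauss_sum_13 by blast
  interpret eta_type_form "fourier a"
    by (rule eta_type_form_fourier [OF a])
  obtain m where m: "\<And>n. n < - int m \<Longrightarrow> a n = 0"
    using a by (auto simp: eta_forms_def)
  have "hecke_coeff e a \<in> eta_forms"
  proof (rule eta_formsI [OF _ _ hecke169_inversion])
    \<comment> \<open>The last term of the operator moves the exponent - m to - 169 m - 7.\<close>
    fix n assume "n < - int (169 * m + 7)"
    moreover from this have "(n + 7) div 169 < - int m"
      by linarith
    ultimately show "hecke_coeff e a n = 0"
      by (simp add: hecke_coeff_def m)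
  next
    fix t assume t: "Im t > 0"
    \<comment> \<open>Averaging over b selects, by orthogonality of roots of unity, the n with 169
      dividing 24 n - 1, that is n = 169 m - 7.\<close>
    have 1: "((\<lambda>n. of_int (a (169 * n - 7)) * q_term n t) has_sum 1 / 169 * (\<Sum>b\<in>{0..<169}. fourier a ((t + 24 * of_int b) / 169))) UNIV"
    proof -
      have "((\<lambda>n. \<Sum>b\<in>{0..<169::int}. of_int (a n) * q_term n ((t + 24 * of_int b) / 169)) has_sum
          (\<Sum>b\<in>{0..<169::int}. fourier a ((t + 24 * of_int b) / 169))) UNIV"
        using t by (intro has_sum_sum eta_forms_has_sum a) simp
      then have "((\<lambda>n. 1 / 169 * (\<Sum>b\<in>{0..<169::int}. of_int (a n) * q_term n ((t + 24 * of_int b) / 169))) has_sum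
          1 / 169 * (\<Sum>b\<in>{0..<169::int}. fourier a ((t + 24 * of_int b) / 169))) UNIV"
        by (rule has_sum_cmult_right)
      moreover have "1 / 169 * (\<Sum>b\<in>{0..<169::int}. of_int (a n) * q_term n ((t + 24 * of_int b) / 169)) =
          (if 169 dvd 24 * n - 1 then of_int (a n) * q_term n (t / 169) else 0)" for n
      proof -
        have "q_term n ((t + 24 * of_int b) / 169) = q_term n (t / 169) * to_q (of_int (24 * n - 1) * of_int b / of_int 169)" for b
          unfolding add_divide_distrib q_term_plus
          by (rule arg_cong2 [where f = "(*)"], rule refl, rule arg_cong [where f = to_q]) (simp add: field_simps)
        then have "(\<Sum>b\<in>{0..<169::int}. of_int (a n) * q_term n ((t + 24 * of_int b) / 169)) =
            of_int (a n) * q_term n (t / 169) * (\<Sum>b\<in>{0..<169::int}. to_q (of_int (24 * n - 1) * of_int b / of_int 169))"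
          by (simp only: sum_distrib_left mult.assoc)
        then show ?thesis
          by (subst (asm) sum_to_q_residues) simp_all
      qed
      ultimately have "((\<lambda>n. if 169 dvd 24 * n - 1 then of_int (a n) * q_term n (t / 169) else 0) has_sum
          1 / 169 * (\<Sum>b\<in>{0..<169::int}. fourier a ((t + 24 * of_int b) / 169))) UNIV"
        by simp
      also have "?this \<longleftrightarrow> ((\<lambda>n. of_int (a n) * q_term n (t / 169)) has_sum
          1 / 169 * (\<Sum>b\<in>{0..<169::int}. fourier a ((t + 24 * of_int b) / 169))) (range (\<lambda>m. 169 * m - 7))"
        by (rule has_sum_cong_neutral) (auto simp: dvd_24n_minus_1_iff)
      also have "\<dots> \<longleftrightarrow> ((\<lambda>m. of_int (a (169 * m - 7)) * q_term (169 * m - 7) (t / 169)) has_sum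
          1 / 169 * (\<Sum>b\<in>{0..<169::int}. fourier a ((t + 24 * of_int b) / 169))) UNIV"
        by (subst has_sum_reindex) (auto simp: inj_on_def o_def)
      also have "(\<lambda>m. of_int (a (169 * m - 7)) * q_term (169 * m - 7) (t / 169)) = (\<lambda>m. of_int (a (169 * m - 7)) * q_term m t)"
        using q_term_scale [OF refl, of _ "t / 169"] by simp
      finally show ?thesis .
    qed
    \<comment> \<open>On each term the sum over b is a Gauss sum, whose factor sqrt 13 cancels the
      one in the operator.\<close>
    have 2: "((\<lambda>n. of_int (13 ^ 4 * e * chi13 (24 * n - 1) * a n) * q_term n t) has_sum
        of_real (13 ^ 4 / sqrt 13) * (\<Sum>b\<in>residues13 13. of_int (chi13 b) * fourier a (t + 24 * of_int b / 13))) UNIV"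
    proof -
      have "((\<lambda>n. of_real (13 ^ 4 / sqrt 13) * (\<Sum>b\<in>residues13 13. of_int (chi13 b) * (of_int (a n) * q_term n (t + 24 * of_int b / 13)))) has_sum
          of_real (13 ^ 4 / sqrt 13) * (\<Sum>b\<in>residues13 13. of_int (chi13 b) * fourier a (t + 24 * of_int b / 13))) UNIV"
        using t by (intro has_sum_cmult_right has_sum_sum eta_forms_has_sum a) simp
      moreover have "of_real (13 ^ 4 / sqrt 13) * (\<Sum>b\<in>residues13 13. of_int (chi13 b) * (of_int (a n) * q_term n (t + 24 * of_int b / 13))) =
          of_int (13 ^ 4 * e * chi13 (24 * n - 1) * a n) * q_term n t" for n
      proof -
        have "q_term n (t + 24 * of_int b / 13) = q_term n t * to_q (of_int (24 * n - 1) * of_int b / 13)" for b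
          unfolding q_term_plus
          by (rule arg_cong2 [where f = "(*)"], rule refl, rule arg_cong [where f = to_q]) (simp add: field_simps)
        then have "(\<Sum>b\<in>residues13 13. of_int (chi13 b) * (of_int (a n) * q_term n (t + 24 * of_int b / 13))) =
            of_int (a n) * q_term n t * (\<Sum>b\<in>residues13 13. of_int (chi13 b) * to_q (of_int (24 * n - 1) * of_int b / 13))"
          by (simp only: sum_distrib_left mult_ac)
        then show ?thesis
          unfolding e(2) by simp
      qed
      ultimately show ?thesis
        by simp
    qed
    have 3: "((\<lambda>n. of_int (if 169 dvd n + 7 then 13 ^ 9 * a ((n + 7) div 169) else 0) * q_term n t) has_sum
        13 ^ 9 * fourier a (169 * t)) UNIV"
    proof -
      have "((\<lambda>n. 13 ^ 9 * (of_int (a n) * q_term n (169 * t))) has_sum 13 ^ 9 * fourier a (169 * t)) UNIV"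
        using t by (intro has_sum_cmult_right eta_forms_has_sum a) simp
      also have "(\<lambda>n. 13 ^ 9 * (of_int (a n) * q_term n (169 * t))) =
          (\<lambda>n. of_int (if 169 dvd n + 7 then 13 ^ 9 * a ((n + 7) div 169) else 0) * q_term n t) \<circ> (\<lambda>n. 169 * n - 7)"
        using q_term_scale [OF refl, of _ t] by (auto simp: o_def)
      also have "(\<dots> has_sum 13 ^ 9 * fourier a (169 * t)) UNIV \<longleftrightarrow>
          ((\<lambda>n. of_int (if 169 dvd n + 7 then 13 ^ 9 * a ((n + 7) div 169) else 0) * q_term n t) has_sum
          13 ^ 9 * fourier a (169 * t)) (range (\<lambda>n. 169 * n - 7))"
        by (subst has_sum_reindex) (auto simp: inj_on_def)
      also have "\<dots> \<longleftrightarrow> ((\<lambda>n. of_int (if 169 dvd n + 7 then 13 ^ 9 * a ((n + 7) div 169) else 0) * q_term n t) has_sum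
          13 ^ 9 * fourier a (169 * t)) UNIV"
      proof (rule has_sum_cong_neutral)
        fix n :: int assume "n \<in> UNIV - range (\<lambda>n. 169 * n - 7)"
        then have n: "n \<noteq> 169 * k - 7" for k
          by auto
        have "\<not> 169 dvd n + 7"
        proof
          assume "169 dvd n + 7"
          then obtain k where "n + 7 = 169 * k"
            by (elim dvdE)
          with n [of k] show False
            by simp
        qed
        then show "of_int (if 169 dvd n + 7 then 13 ^ 9 * a ((n + 7) div 169) else 0) * q_term n t = 0"
          by simp
      qed auto
      finally show ?thesis .
    qed
    show "((\<lambda>n. of_int (hecke_coeff e a n) * q_term n t) has_sum hecke169 (fourier a) t) UNIV"
      using has_sum_add [OF has_sum_add [OF 1 2] 3]
      unfolding hecke169_def hecke_coeff_def of_int_add distrib_right .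
  qed
  with e(1) that show ?thesis
    by blast
qed

section \<open>Liouville principle\<close>

text \<open>The bound 4 / 5 is below sqrt 3 / 2, which leaves room for growth at a fixed rate: after
  a translation to real part at most 1 / 2 in absolute value, |s| ^ 2 is at most 1 / 4 + 16 / 25 <
  10 / 11, so an inversion multiplies the imaginary part by at least 11 / 10. Plain induction on the
  number of steps then suffices.\<close>

lemma fundamental_domain_reduction:
  fixes g :: "complex \<Rightarrow> 'a"
  assumes plus: "\<And>t n. Im t > 0 \<Longrightarrow> g (t + of_int n) = g t"
    and inv: "\<And>t. Im t > 0 \<Longrightarrow> g (- 1 / t) = g t"
    and t: "Im t > 0"
  obtains t' where "Im t' \<ge> 4 / 5" "g t' = g t"
proof -
  have "\<exists>t'. Im t' \<ge> 4 / 5 \<and> g t' = g t" if "Im t > 0" "Im t * (11 / 10) ^ n \<ge> 4 / 5" for n t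
    using that
  proof (induction n arbitrary: t)
    case (Suc n)
    define s where "s = t + of_int (- round (Re t))"
    have s: "Im s = Im t" "\<bar>Re s\<bar> \<le> 1 / 2"
      using of_int_round_abs_le [of "Re t"] by (auto simp: s_def abs_minus_commute)
    have gs: "g s = g t"
      unfolding s_def by (rule plus [OF Suc.prems(1)])
    show ?case
    proof (cases "Im t \<ge> 4 / 5")
      case False
      define D where "D = (Re s)\<^sup>2 + (Im s)\<^sup>2"
      have "(Re s)\<^sup>2 \<le> (1 / 2)\<^sup>2"
        using s(2) by (simp add: abs_le_square_iff [symmetric])
      moreover have "(Im s)\<^sup>2 \<le> (4 / 5)\<^sup>2"
        using False Suc.prems(1) s(1) by (intro power_mono) auto
      ultimately have "D \<le> 10 / 11"
        by (simp add: D_def power2_eq_square)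
      have "(Im s)\<^sup>2 > 0"
        using s(1) Suc.prems(1) by simp
      then have D: "D > 0"
        by (simp add: D_def add_nonneg_pos)
      have "Im (- 1 / s) = Im t / D"
        by (simp add: Im_divide D_def s(1))
      moreover have "Im t * (11 / 10) \<le> Im t / D"
        using D \<open>D \<le> 10 / 11\<close> Suc.prems(1) mult_left_mono [of D "10 / 11" "Im t * (11 / 10)"] by (simp add: field_simps)
      ultimately have "Im (- 1 / s) \<ge> Im t * (11 / 10)"
        by simp
      then have "Im (- 1 / s) * (11 / 10) ^ n \<ge> Im t * (11 / 10) * (11 / 10) ^ n"
        by (intro mult_right_mono) auto
      then have "Im (- 1 / s) * (11 / 10) ^ n \<ge> 4 / 5"
        using Suc.prems(2) by (simp add: mult.assoc)
      moreover have "Im (- 1 / s) > 0"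
        using Suc.prems(1) s(1) by (intro Im_minus_inverse_pos) simp
      ultimately obtain t' where "Im t' \<ge> 4 / 5" "g t' = g (- 1 / s)"
        using Suc.IH by blast
      moreover have "g (- 1 / s) = g t"
        using inv [of s] gs s(1) Suc.prems(1) by simp
      ultimately show ?thesis
        by auto
    qed blast
  qed (auto intro!: exI)
  moreover obtain n where "(11 / 10) ^ n > 4 / 5 / Im t"
    using real_arch_pow [of "11 / 10"] by auto
  then have "Im t * (11 / 10) ^ n \<ge> 4 / 5"
    using t by (simp add: field_simps)
  ultimately show ?thesis
    using t that by blast
qed

lemma to_q_surj:
  assumes "z \<noteq> 0" "norm z < 1"
  obtains t where "Im t > 0" "to_q t = z"
proof
  define t where "t = Ln z / (2 * pi * \<i>)"
  show "to_q t = z"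
    using assms by (simp add: to_q_def t_def)
  have "exp (- 2 * pi * Im t) < 1"
    using assms \<open>to_q t = z\<close> norm_to_q [of t] by simp
  then show "Im t > 0"
    by (simp add: zero_less_mult_iff)
qed

lemma to_q_plus_of_int [simp]: "to_q (t + of_int n) = to_q t"
  by (simp add: to_q_add)

text \<open>By invariance every value on the unit disc is taken on a smaller closed disc or is the
  value at 0. So the modulus has an interior maximum and the function is constant.\<close>

lemma weight_zero_cusp_form_zero:
  assumes A: "fps_conv_radius A \<ge> 1" "fps_nth A 0 = 0"
    and inv: "\<And>t. Im t > 0 \<Longrightarrow> eval_fps A (to_q (- 1 / t)) = eval_fps A (to_q t)"
    and z: "norm z < 1"
  shows "eval_fps A z = 0"
proof -
  \<comment> \<open>The largest modulus of q on the half plane Im t >= 4 / 5.\<close>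
  define r where "r = exp (- 2 * pi * (4 / 5))"
  have r: "0 < r" "r < 1"
    by (auto simp: r_def)
  have sub: "ball 0 1 \<subseteq> eball 0 (fps_conv_radius A)"
    using A(1) by (intro ball_eball_mono) (simp add: one_ereal_def)
  have holo: "eval_fps A holomorphic_on ball 0 1"
    using sub by (intro holomorphic_intros)
  have sub': "cball 0 r \<subseteq> ball (0::complex) 1"
    using r by auto
  have "continuous_on (cball 0 r) (\<lambda>z. norm (eval_fps A z))"
    by (intro continuous_intros continuous_on_subset [OF holomorphic_on_imp_continuous_on [OF holo] sub'])
  moreover have "compact (cball (0::complex) r)" "cball (0::complex) r \<noteq> {}"
    using r by auto
  ultimately obtain z0 where z0: "z0 \<in> cball 0 r" "\<And>z. z \<in> cball 0 r \<Longrightarrow> norm (eval_fps A z) \<le> norm (eval_fps A z0)"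
    using continuous_attains_sup by metis
  have bound: "norm (eval_fps A z) \<le> norm (eval_fps A z0)" if z1: "norm z < 1" for z
  proof (cases "z = 0")
    case True
    then show ?thesis
      using A(2) by (simp add: eval_fps_at_0)
  next
    case False
    then obtain t where t: "Im t > 0" "to_q t = z"
      using z1 by (rule to_q_surj)
    obtain t' where t': "Im t' \<ge> 4 / 5" "eval_fps A (to_q t') = eval_fps A (to_q t)"
      by (rule fundamental_domain_reduction [of "\<lambda>t. eval_fps A (to_q t)", OF _ inv t(1)]) auto
    have "norm (to_q t') \<le> r"
      unfolding norm_to_q r_def using t'(1) by simp
    then show ?thesis
      using z0(2) [of "to_q t'"] t'(2) t(2) by simp
  qed
  have "eval_fps A constant_on ball 0 1"
  proof (rule maximum_modulus_principle [OF holo])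
    show "z0 \<in> ball 0 1"
      using z0(1) sub' by blast
  qed (use bound in auto)
  then have "eval_fps A z = eval_fps A 0"
    using z by (auto simp: constant_on_def)
  then show ?thesis
    using A(2) by (simp add: eval_fps_at_0)
qed

section \<open>Negative powers of eta and vanishing of forms without principal part\<close>

lemma fps_conv_radius_mult_ge_1:
  fixes f g :: "complex fps"
  assumes "fps_conv_radius f \<ge> 1" "fps_conv_radius g \<ge> 1"
  shows "fps_conv_radius (f * g) \<ge> 1"
  using assms order_trans [OF _ fps_conv_radius_mult, of 1 f g] by simp

lemma fps_conv_radius_power_ge_1:
  fixes f :: "complex fps"
  assumes "fps_conv_radius f \<ge> 1"
  shows "fps_conv_radius (f ^ n) \<ge> 1"
  using assms fps_conv_radius_power order_trans by blast

lemma conv_radius_partition_fps: "fps_conv_radius (complex_fps partition_fps) \<ge> 1"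
  using eval_partition_fps(2) [of 0] by simp

lemma exp_log_eta:
  assumes "Im t > 0"
  shows "exp (- (of_nat n * log_eta t)) = to_q (- (of_nat n / 24) * t) * eval_fps (complex_fps partition_fps) (to_q t) ^ n"
proof -
  have "eval_fps (complex_fps partition_fps) (to_q t) ^ n = exp (of_nat n * eval_fps euler_log_fps (to_q t))"
    by (simp only: eval_partition_fps(1) [OF norm_to_q_less_1 [OF assms]] exp_of_nat_mult)
  moreover have "to_q (- (of_nat n / 24) * t) = exp (- (of_nat n * (pi * \<i> / 12 * t)))"
    unfolding to_q_def by (rule arg_cong [where f = exp]) (simp add: field_simps)
  moreover have "- (of_nat n * log_eta t) = - (of_nat n * (pi * \<i> / 12 * t)) + of_nat n * eval_fps euler_log_fps (to_q t)"
    by (simp add: log_eta_def algebra_simps)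
  ultimately show ?thesis
    by (simp only: exp_add)
qed

lemma exp_log_eta_inversion:
  assumes "Im t > 0"
  shows "exp (- (of_nat n * log_eta (- 1 / t))) = exp (- Ln (- \<i> * t) / 2) ^ n * exp (- (of_nat n * log_eta t))"
  unfolding log_eta_inversion [OF assms] exp_of_nat_mult [symmetric] exp_add [symmetric]
  by (simp add: algebra_simps)

text \<open>The square of the exponential is 1 / (- i t), so the product is i ^ 12. In other words,
  the multiplier of eta ^ 24 is trivial.\<close>

lemma weight_12: "Im t > 0 \<Longrightarrow> t ^ 12 * exp (- Ln (- \<i> * t) / 2) ^ 24 = 1"
proof -
  assume t: "Im t > 0"
  then have t0: "t \<noteq> 0"
    by auto
  have "exp (- Ln (- \<i> * t) / 2) ^ 24 = (exp (- Ln (- \<i> * t) / 2) ^ 2) ^ 12"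
    by (simp only: power_mult [symmetric]) simp
  also have "exp (- Ln (- \<i> * t) / 2) ^ 2 = inverse (- \<i> * t)"
  proof -
    have "exp (- Ln (- \<i> * t) / 2) ^ 2 = exp (2 * (- Ln (- \<i> * t) / 2))"
      by (simp only: exp_double)
    also have "\<dots> = inverse (exp (Ln (- \<i> * t)))"
      by (simp add: exp_minus)
    finally show ?thesis
      using t0 by simp
  qed
  also have "t ^ 12 * inverse (- \<i> * t) ^ 12 = (t * inverse (- \<i> * t)) ^ 12"
    by (simp only: power_mult_distrib)
  also have "t * inverse (- \<i> * t) = \<i>"
    using t0 by (simp add: field_simps)
  also have "\<i> ^ 12 = 1"
    using power_mult [of \<i> 2 6] by simp
  finally show ?thesis .
qed

lemma q_term_add_nat: "q_term (n + int k) t = q_term n t * to_q t ^ k"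
  by (simp add: q_term_def to_q_power to_q_add [symmetric] algebra_simps)

lemma has_sum_shift_fps:
  fixes a :: "int \<Rightarrow> int"
  assumes "\<And>n. n < m \<Longrightarrow> a n = 0"
  shows "((\<lambda>n. of_int (a n) * q_term n t) has_sum q_term m t * s) UNIV \<longleftrightarrow>
    ((\<lambda>k. of_int (a (m + int k)) * to_q t ^ k) has_sum s) UNIV"
proof -
  have "((\<lambda>n. of_int (a n) * q_term n t) has_sum q_term m t * s) UNIV \<longleftrightarrow>
      ((\<lambda>n. of_int (a n) * q_term n t) has_sum q_term m t * s) {m..}"
    using assms by (intro has_sum_cong_neutral) auto
  also have "\<dots> \<longleftrightarrow> ((\<lambda>k. of_int (a (m + int k)) * q_term (m + int k) t) has_sum q_term m t * s) UNIV"
    by (rule has_sum_reindex_bij_witness [where i = "\<lambda>k. m + int k" and j = "\<lambda>n. nat (n - m)"]) auto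
  also have "(\<lambda>k. of_int (a (m + int k)) * q_term (m + int k) t) = (\<lambda>k. q_term m t * (of_int (a (m + int k)) * to_q t ^ k))"
    by (simp only: q_term_add_nat mult.left_commute)
  also have "(\<dots> has_sum q_term m t * s) UNIV \<longleftrightarrow> ((\<lambda>k. of_int (a (m + int k)) * to_q t ^ k) has_sum s) UNIV"
    by (subst has_sum_cmult_right_iff) (simp_all add: q_term_def)
  finally show ?thesis .
qed

text \<open>The square of such a form times \<open>\<eta>\<close> to the power \<open>- 22\<close> has weight 0 and vanishes at the cusp.\<close>

lemma eta_form_zero:
  assumes a: "a \<in> eta_forms" and zero: "\<And>n. n \<le> 0 \<Longrightarrow> a n = 0"
  shows "a n = 0"
proof -
  define F where "F = Abs_fps (\<lambda>k. complex_of_int (a (1 + int k)))"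
  define P where "P = complex_fps partition_fps"
  have sum: "((\<lambda>k. fps_nth F k * to_q t ^ k) has_sum (fourier a t / q_term 1 t)) UNIV" if "Im t > 0" for t
    using has_sum_shift_fps [of 1 a t "fourier a t / q_term 1 t"] zero eta_forms_has_sum [OF a that]
    by (simp add: F_def q_term_def)
  have rF: "fps_conv_radius F \<ge> 1"
  proof (rule fps_conv_radius_ge_1I)
    fix z :: complex assume z: "norm z < 1"
    show "summable (\<lambda>k. fps_nth F k * z ^ k)"
    proof (cases "z = 0")
      case False
      then obtain t where "Im t > 0" "to_q t = z"
        using z by (rule to_q_surj)
      then show ?thesis
        using sum [of t] by (auto dest!: has_sum_imp_sums sums_summable)
    qed simp
  qed
  have F: "fourier a t = q_term 1 t * eval_fps F (to_q t)" if "Im t > 0" for t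
  proof -
    have "((\<lambda>k. fps_nth F k * to_q t ^ k) has_sum eval_fps F (to_q t)) UNIV"
      by (intro has_sum_eval_fps ereal_norm_less_radius norm_to_q_less_1 that rF)
    with sum [OF that] have "fourier a t / q_term 1 t = eval_fps F (to_q t)"
      by (rule has_sum_unique)
    then show ?thesis
      by (simp add: field_simps q_term_def)
  qed
  \<comment> \<open>The square has leading exponent 2 * 23 / 24 and eta ^ (- 22) has - 22 / 24. The
    total is 1, hence the factor \<open>fps_X\<close> and the zero at the cusp.\<close>
  define A where "A = fps_X * (F ^ 2 * P ^ 22)"
  have rP: "fps_conv_radius P \<ge> 1"
    unfolding P_def by (rule conv_radius_partition_fps)
  have r2: "fps_conv_radius (F ^ 2 * P ^ 22) \<ge> 1"
    by (intro fps_conv_radius_mult_ge_1 fps_conv_radius_power_ge_1 rF rP)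
  have rA: "fps_conv_radius A \<ge> 1"
    unfolding A_def by (intro fps_conv_radius_mult_ge_1 r2) simp
  have eval_A: "eval_fps A z = z * (eval_fps F z ^ 2 * eval_fps P z ^ 22)" if z: "norm z < 1" for z
  proof -
    have less: "ereal (norm z) < fps_conv_radius f" if "fps_conv_radius f \<ge> 1" for f :: "complex fps"
      by (rule ereal_norm_less_radius [OF z that])
    have "eval_fps A z = z * eval_fps (F ^ 2 * P ^ 22) z"
      unfolding A_def by (subst eval_fps_mult) (auto intro: less r2)
    also have "eval_fps (F ^ 2 * P ^ 22) z = eval_fps (F ^ 2) z * eval_fps (P ^ 22) z"
      by (intro eval_fps_mult less fps_conv_radius_power_ge_1 rF rP)
    also have "\<dots> = eval_fps F z ^ 2 * eval_fps P z ^ 22"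
      by (simp add: eval_fps_power less rF rP)
    finally show ?thesis .
  qed
  have g: "eval_fps A (to_q t) = fourier a t ^ 2 * exp (- (of_nat 22 * log_eta t))" if t: "Im t > 0" for t
  proof -
    have "q_term 1 t ^ 2 * to_q (- (of_nat 22 / 24) * t) = to_q t"
      unfolding q_term_def to_q_power to_q_add [symmetric]
      by (rule arg_cong [where f = to_q]) (simp add: field_simps)
    then show ?thesis
      unfolding eval_A [OF norm_to_q_less_1 [OF t]] exp_log_eta [OF t] F [OF t] P_def [symmetric]
      by (simp add: power_mult_distrib mult_ac)
  qed
  have "eval_fps A z = 0" if z: "norm z < 1" for z
  proof (rule weight_zero_cusp_form_zero [OF rA _ _ z])
    fix t assume t: "Im t > 0"
    define x where "x = exp (- Ln (- \<i> * t) / 2)"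
    have "fourier a (- 1 / t) = t ^ 6 * x * fourier a t"
      using a t by (simp add: eta_forms_def weight_factor_def x_def)
    then have "eval_fps A (to_q (- 1 / t)) = (t ^ 6 * x * fourier a t) ^ 2 * (x ^ 22 * exp (- (of_nat 22 * log_eta t)))"
      unfolding g [OF Im_minus_inverse_pos [OF t]] exp_log_eta_inversion [OF t] x_def [symmetric] by simp
    also have "\<dots> = (t ^ 12 * x ^ 24) * (fourier a t ^ 2 * exp (- (of_nat 22 * log_eta t)))"
      by (simp add: power_mult_distrib eval_nat_numeral)
    also have "t ^ 12 * x ^ 24 = 1"
      unfolding x_def by (rule weight_12 [OF t])
    finally show "eval_fps A (to_q (- 1 / t)) = eval_fps A (to_q t)"
      unfolding g [OF t] by simp
  qed (simp add: A_def)
  then have "A = 0"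
  proof (intro eval_fps_eqD)
    have "eventually (\<lambda>z::complex. z \<in> ball 0 1) (nhds 0)"
      by (intro eventually_nhds_in_open) auto
    then show "eventually (\<lambda>z. eval_fps A z = eval_fps 0 z) (nhds 0)"
      by eventually_elim (use \<open>\<And>z. norm z < 1 \<Longrightarrow> eval_fps A z = 0\<close> in auto)
    show "fps_conv_radius A > 0"
      by (rule order_less_le_trans [OF _ rA]) simp
  qed simp
  moreover have "fps_nth P 0 = 1"
    using q_pochhammer_times_partition_fps q_pochhammer_nth_0
    by (metis P_def complex_fps_nth fps_mult_nth_0 fps_one_nth mult_1 of_int_1)
  then have "P \<noteq> 0"
    by auto
  ultimately have "F = 0"
    by (simp add: A_def)
  show ?thesis
  proof (cases "n \<le> 0")
    case False
    then have "complex_of_int (a n) = fps_nth F (nat (n - 1))"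
      by (simp add: F_def)
    with \<open>F = 0\<close> show ?thesis
      by simp
  qed (rule zero)
qed

section \<open>Integrality and divisibility\<close>

text \<open>The weight is 6 (2 m + 1) - (24 m + 1) / 2 = 11 / 2 for every m, and the leading
  exponent is - m - 1 / 24.\<close>

definition eta_basis :: "nat \<Rightarrow> int \<Rightarrow> int" where
  "eta_basis m n = (if n < - int m then 0 else
     fps_nth (E6 ^ (2 * m + 1) * partition_fps ^ (24 * m + 1)) (nat (n + int m)))"

lemma partition_fps_nth_0: "fps_nth partition_fps 0 = 1"
  using q_pochhammer_times_partition_fps q_pochhammer_nth_0
  by (metis fps_mult_nth_0 fps_one_nth mult_1)

lemma eta_basis_leading: "eta_basis m (- int m) = 1"
  by (simp add: eta_basis_def fps_mult_nth fps_power_zeroth E6_def partition_fps_nth_0)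

lemma eta_basis_eta_forms: "eta_basis m \<in> eta_forms"
proof (rule eta_formsI)
  define F where "F = complex_fps (E6 ^ (2 * m + 1) * partition_fps ^ (24 * m + 1))"
  define G where "G = (\<lambda>t. Eis6 t ^ (2 * m + 1) * exp (- (of_nat (24 * m + 1) * log_eta t)))"
  show "eta_basis m n = 0" if "n < - int m" for n
    using that by (simp add: eta_basis_def)
  show "((\<lambda>n. of_int (eta_basis m n) * q_term n t) has_sum G t) UNIV" if t: "Im t > 0" for t
  proof -
    have q: "norm (to_q t) < 1"
      by (rule norm_to_q_less_1 [OF t])
    have r: "fps_conv_radius (complex_fps E6 ^ (2 * m + 1)) \<ge> 1" "fps_conv_radius (complex_fps partition_fps ^ (24 * m + 1)) \<ge> 1"
      by (intro fps_conv_radius_power_ge_1 conv_radius_E6 conv_radius_partition_fps)+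
    have F: "F = complex_fps E6 ^ (2 * m + 1) * complex_fps partition_fps ^ (24 * m + 1)"
      by (simp only: F_def complex_fps_mult complex_fps_power)
    have "eval_fps F (to_q t) = eval_fps (complex_fps E6 ^ (2 * m + 1)) (to_q t) * eval_fps (complex_fps partition_fps ^ (24 * m + 1)) (to_q t)"
      unfolding F by (intro eval_fps_mult ereal_norm_less_radius q r)
    also have "\<dots> = Eis6 t ^ (2 * m + 1) * eval_fps (complex_fps partition_fps) (to_q t) ^ (24 * m + 1)"
      by (simp only: eval_fps_power ereal_norm_less_radius q conv_radius_E6 conv_radius_partition_fps eval_E6 [OF t])
    finally have eval_F: "eval_fps F (to_q t) = Eis6 t ^ (2 * m + 1) * eval_fps (complex_fps partition_fps) (to_q t) ^ (24 * m + 1)" .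
    have "q_term (- int m) t = to_q (- (of_nat (24 * m + 1) / 24) * t)"
      unfolding q_term_def by (rule arg_cong [where f = to_q]) (simp add: field_simps)
    then have "q_term (- int m) t * eval_fps F (to_q t) = G t"
      unfolding G_def exp_log_eta [OF t] eval_F by (simp only: mult_ac)
    moreover have "((\<lambda>n. of_int (eta_basis m n) * q_term n t) has_sum q_term (- int m) t * eval_fps F (to_q t)) UNIV"
    proof (subst has_sum_shift_fps)
      have "fps_conv_radius F \<ge> 1"
        unfolding F by (intro fps_conv_radius_mult_ge_1 r)
      then have "((\<lambda>k. fps_nth F k * to_q t ^ k) has_sum eval_fps F (to_q t)) UNIV"
        by (intro has_sum_eval_fps ereal_norm_less_radius q)
      then show "((\<lambda>k. of_int (eta_basis m (- int m + int k)) * to_q t ^ k) has_sum eval_fps F (to_q t)) UNIV"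
        by (simp add: F_def eta_basis_def)
    qed (simp add: eta_basis_def)
    ultimately show ?thesis
      by simp
  qed
  show "G (- 1 / t) = weight_factor t * G t" if t: "Im t > 0" for t
  proof -
    define x where "x = exp (- Ln (- \<i> * t) / 2)"
    have "G (- 1 / t) = (t ^ 6 * Eis6 t) ^ (2 * m + 1) * (x ^ (24 * m + 1) * exp (- (of_nat (24 * m + 1) * log_eta t)))"
      unfolding G_def Eis6_inversion [OF t] exp_log_eta_inversion [OF t] x_def ..
    also have "\<dots> = ((t ^ 6) ^ (2 * m + 1) * x ^ (24 * m + 1)) * G t"
      unfolding G_def power_mult_distrib by (simp only: mult_ac)
    also have "(t ^ 6) ^ (2 * m + 1) * x ^ (24 * m + 1) = (t ^ 12 * x ^ 24) ^ m * (t ^ 6 * x)"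
    proof -
      have "(t ^ 6) ^ (2 * m + 1) = (t ^ 12) ^ m * t ^ 6"
        by (simp add: power_add power_mult flip: power_mult)
      moreover have "x ^ (24 * m + 1) = (x ^ 24) ^ m * x"
        by (simp add: power_add power_mult)
      ultimately show ?thesis
        by (simp only: power_mult_distrib mult_ac)
    qed
    also have "t ^ 12 * x ^ 24 = 1"
      unfolding x_def by (rule weight_12 [OF t])
    finally show ?thesis
      by (simp add: weight_factor_def x_def)
  qed
qed

lemma eta_forms_diff:
  assumes "a \<in> eta_forms" "b \<in> eta_forms"
  shows "(\<lambda>n. a n - c * b n) \<in> eta_forms"
proof -
  obtain m1 m2 where m: "\<And>n. n < - int m1 \<Longrightarrow> a n = 0" "\<And>n. n < - int m2 \<Longrightarrow> b n = 0"
    using assms by (auto simp: eta_forms_def)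
  show ?thesis
  proof (rule eta_formsI)
    show "a n - c * b n = 0" if "n < - int (max m1 m2)" for n
      using that m by simp
    show "((\<lambda>n. of_int (a n - c * b n) * q_term n t) has_sum (fourier a t - of_int c * fourier b t)) UNIV" if "Im t > 0" for t
      using has_sum_diff [OF eta_forms_has_sum [OF assms(1) that]
          has_sum_cmult_right [OF eta_forms_has_sum [OF assms(2) that], of "of_int c"]]
      by (simp add: algebra_simps)
    show "fourier a (- 1 / t) - of_int c * fourier b (- 1 / t) = weight_factor t * (fourier a t - of_int c * fourier b t)"
      if "Im t > 0" for t
      using assms that by (simp add: eta_forms_def algebra_simps)
  qed
qed

lemma eta_forms_divide:
  assumes "(\<lambda>n. d * a n) \<in> eta_forms" "d \<noteq> 0"
  shows "a \<in> eta_forms"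
proof -
  define b where "b = (\<lambda>n. d * a n)"
  have b: "b \<in> eta_forms"
    using assms by (simp add: b_def)
  then obtain m where m: "\<And>n. n < - int m \<Longrightarrow> b n = 0"
    by (auto simp: eta_forms_def)
  show ?thesis
  proof (rule eta_formsI)
    show "a n = 0" if "n < - int m" for n
      using m [OF that] assms(2) by (simp add: b_def)
    show "((\<lambda>n. of_int (a n) * q_term n t) has_sum (fourier b t / of_int d)) UNIV" if "Im t > 0" for t
      using has_sum_cmult_right [OF eta_forms_has_sum [OF b that], of "1 / of_int d"] assms(2)
      by (simp add: b_def)
    show "fourier b (- 1 / t) / of_int d = weight_factor t * (fourier b t / of_int d)" if "Im t > 0" for t
      using b that by (simp add: eta_forms_def)
  qed
qed

lemma eta_forms_dvd:
  assumes "a \<in> eta_forms" "\<And>n. n \<le> 0 \<Longrightarrow> d dvd a n"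
  shows "d dvd a n"
proof -
  \<comment> \<open>\<open>M\<close> counts the indices n <= 0 that may carry a coefficient. With M
    = 0 none is left and \<open>eta_form_zero\<close> applies. Otherwise the lowest one is removed
    by subtracting a multiple of \<open>eta_basis\<close>.\<close>
  have "d dvd a n" if "a \<in> eta_forms" "\<And>n. n \<le> 0 \<Longrightarrow> d dvd a n" "\<And>n. n < 1 - int M \<Longrightarrow> a n = 0" for M a n
    using that
  proof (induction M arbitrary: a)
    case 0
    have "a n = 0"
      by (rule eta_form_zero [OF 0(1)], rule 0(3)) simp
    then show ?case
      by simp
  next
    case (Suc M)
    define c where "c = a (- int M)"
    define a' where "a' = (\<lambda>n. a n - c * eta_basis M n)"
    have c: "d dvd c"
      unfolding c_def by (rule Suc.prems(2)) simp
    have "d dvd a' n"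
    proof (rule Suc.IH)
      show "a' \<in> eta_forms"
        unfolding a'_def by (intro eta_forms_diff Suc.prems(1) eta_basis_eta_forms)
      show "d dvd a' n" if "n \<le> 0" for n
        unfolding a'_def using Suc.prems(2) [OF that] c by simp
      show "a' n = 0" if "n < 1 - int M" for n
      proof (cases "n = - int M")
        case True
        then show ?thesis
          by (simp add: a'_def c_def eta_basis_leading)
      next
        case False
        with that have "n < - int M"
          by simp
        then show ?thesis
          using Suc.prems(3) [of n] by (simp add: a'_def eta_basis_def)
      qed
    qed
    then have "d dvd a' n + c * eta_basis M n"
      using c by (intro dvd_add) auto
    then show ?case
      by (simp add: a'_def)
  qed
  moreover obtain m where "\<And>n. n < - int m \<Longrightarrow> a n = 0"
    using assms(1) by (auto simp: eta_forms_def)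
  then have "\<And>n. n < 1 - int (m + 1) \<Longrightarrow> a n = 0"
    by simp
  ultimately show ?thesis
    using assms by blast
qed

section \<open>The lattice of forms with prescribed divisibility\<close>

definition divisible_forms :: "(int \<Rightarrow> int) set" where
  "divisible_forms = {a \<in> eta_forms. \<forall>n e. n \<le> 0 \<longrightarrow> 13 ^ e dvd 24 * n - 1 \<longrightarrow> 13 ^ (2 * e) dvd a n}"

lemma divisible_formsD:
  "a \<in> divisible_forms \<Longrightarrow> n \<le> 0 \<Longrightarrow> 13 ^ e dvd 24 * n - 1 \<Longrightarrow> 13 ^ (2 * e) dvd a n"
  by (simp add: divisible_forms_def)

text \<open>The map n -> 169 n - 7 raises e by 2 and so gains 13 ^ 4. The middle term has the factor
  13 ^ 4 and vanishes unless e = 0. The last term loses 13 ^ 4 against 13 ^ 9, and 9 + 2 (e - 2) = 2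
  e + 5 is still enough.\<close>

lemma hecke_coeff_divisible:
  assumes a: "a \<in> divisible_forms" and n: "n \<le> 0" and e: "13 ^ e dvd 24 * n - 1"
  shows "13 ^ (2 * e + 4) dvd hecke_coeff s a n"
proof -
  have "13 ^ (2 * e + 4) dvd a (169 * n - 7)"
  proof -
    have "13 ^ (e + 2) dvd 24 * (169 * n - 7) - 1"
    proof -
      have "24 * (169 * n - 7) - 1 = (24 * n - 1) * 13 ^ 2"
        by simp
      then show ?thesis
        unfolding power_add using e by (simp only: mult_dvd_mono dvd_refl)
    qed
    then have "13 ^ (2 * (e + 2)) dvd a (169 * n - 7)"
      using n by (intro divisible_formsD [OF a]) auto
    also have "2 * (e + 2) = 2 * e + 4"
      by simp
    finally show ?thesis .
  qed
  moreover have "13 ^ (2 * e + 4) dvd 13 ^ 4 * s * chi13 (24 * n - 1) * a n"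
  proof (cases "e = 0")
    case False
    then have "13 dvd 24 * n - 1"
      using e by (meson dvd_power dvd_trans neq0_conv)
    then show ?thesis
      by (simp add: chi13_def)
  qed (simp add: mult.assoc)
  moreover have "13 ^ (2 * e + 4) dvd 13 ^ 9 * a m" if m: "n + 7 = 169 * m" for m
  proof (cases "e \<le> 2")
    case True
    then have "(13::int) ^ (2 * e + 4) dvd 13 ^ 9"
      by (intro le_imp_power_dvd) simp
    then show ?thesis
      by simp
  next
    case False
    have "n = 169 * m - 7"
      using m by simp
    then have "24 * n - 1 = 13 ^ 2 * (24 * m - 1)"
      by simp
    moreover have "(13::int) ^ e = 13 ^ 2 * 13 ^ (e - 2)"
    proof -
      have "(13::int) ^ e = 13 ^ (2 + (e - 2))"
        using False by (intro arg_cong [where f = "power 13"]) simp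
      then show ?thesis
        by (simp only: power_add)
    qed
    ultimately have "13 ^ (e - 2) dvd 24 * m - 1"
      using e by (simp only: dvd_mult_cancel_left) simp
    then have "13 ^ (2 * (e - 2)) dvd a m"
      using m n by (intro divisible_formsD [OF a]) auto
    then have "13 ^ 9 * 13 ^ (2 * (e - 2)) dvd 13 ^ 9 * a m"
      by simp
    moreover have "(13::int) ^ (2 * e + 4) dvd 13 ^ 9 * 13 ^ (2 * (e - 2))"
      unfolding power_add [symmetric] using False by (intro le_imp_power_dvd) simp
    ultimately show ?thesis
      by (rule dvd_trans [rotated])
  qed
  ultimately show ?thesis
    unfolding hecke_coeff_def by (intro dvd_add) (auto elim!: dvdE)
qed

lemma hecke_divisible_forms:
  assumes a: "a \<in> divisible_forms"
  obtains s b where "b \<in> divisible_forms" "\<And>n. hecke_coeff s a n = 13 ^ 4 * b n"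
proof -
  have "a \<in> eta_forms"
    using a by (simp add: divisible_forms_def)
  then obtain s where h: "hecke_coeff s a \<in> eta_forms"
    by (rule hecke_coeff_eta_forms)
  define b where "b = (\<lambda>n. hecke_coeff s a n div 13 ^ 4)"
  have "13 ^ 4 dvd hecke_coeff s a n" for n
  proof (rule eta_forms_dvd [OF h])
    show "13 ^ 4 dvd hecke_coeff s a n" if "n \<le> 0" for n
      using hecke_coeff_divisible [OF a that, of 0 s] by simp
  qed
  then have b: "hecke_coeff s a n = 13 ^ 4 * b n" for n
    by (simp add: b_def)
  have "(\<lambda>n. 13 ^ 4 * b n) \<in> eta_forms"
    using h by (simp only: b [symmetric])
  then have "b \<in> eta_forms"
    by (rule eta_forms_divide) simp
  moreover have "13 ^ (2 * e) dvd b n" if "n \<le> 0" "13 ^ e dvd 24 * n - 1" for n e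
    using hecke_coeff_divisible [OF a that, of s] unfolding b power_add by (simp add: mult.commute)
  ultimately have "b \<in> divisible_forms"
    by (simp add: divisible_forms_def)
  with b that show ?thesis
    by blast
qed

fun index169 :: "nat \<Rightarrow> int \<Rightarrow> int" where
  "index169 0 n = n"
| "index169 (Suc k) n = 169 * index169 k n - 7"

lemma index169_eq: "24 * index169 k n - 1 = 169 ^ k * (24 * n - 1)"
  by (induction k) (simp_all add: algebra_simps)

text \<open>The recursion for a at step j + 1 uses another form b at step j and the form a at step j
  - 1. Hence the induction is strong and quantifies over all forms of the lattice.\<close>

lemma divisible_forms_index169:
  assumes "a \<in> divisible_forms"
  shows "13 ^ (4 * k) dvd a (index169 k n)"
  using assms
proof (induction k arbitrary: a rule: less_induct)
  case (less k)
  show ?case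
  proof (cases k)
    case (Suc j)
    obtain s b where b: "b \<in> divisible_forms" "\<And>n. hecke_coeff s a n = 13 ^ 4 * b n"
      using hecke_divisible_forms [OF less.prems] by blast
    define N where "N = index169 j n"
    have "13 ^ (4 * j) dvd b N"
      unfolding N_def using Suc b(1) by (intro less.IH) auto
    then have "13 ^ 4 * 13 ^ (4 * j) dvd 13 ^ 4 * b N"
      by simp
    then have 1: "13 ^ (4 * k) dvd hecke_coeff s a N"
      unfolding b(2) by (simp add: Suc power_add)
    \<comment> \<open>For j > 0 the character vanishes. For j = 0 one has k = 1, and the factor 13 ^
      4 suffices.\<close>
    have 2: "13 ^ (4 * k) dvd 13 ^ 4 * s * chi13 (24 * N - 1) * a N"
    proof (cases j)
      case (Suc i)
      have "24 * N - 1 = 169 ^ j * (24 * n - 1)"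
        unfolding N_def by (rule index169_eq)
      then have "13 dvd 24 * N - 1"
        unfolding Suc by simp
      then show ?thesis
        by (simp add: chi13_def)
    qed (simp add: \<open>k = Suc j\<close> mult.assoc)
    \<comment> \<open>For j = 0 the factor 13 ^ 9 suffices. For j = i + 1 the exponent 9 + 4 i
      exceeds 4 k = 4 i + 8.\<close>
    have 3: "13 ^ (4 * k) dvd (if 169 dvd N + 7 then 13 ^ 9 * a ((N + 7) div 169) else 0)"
    proof (cases j)
      case 0
      have "(13::int) ^ (4 * k) dvd 13 ^ 9"
        using 0 Suc by (intro le_imp_power_dvd) simp
      then show ?thesis
        by simp
    next
      case (Suc i)
      have "13 ^ (4 * i) dvd a (index169 i n)"
        using Suc \<open>k = Suc j\<close> less.prems by (intro less.IH) auto
      then have "13 ^ 9 * 13 ^ (4 * i) dvd 13 ^ 9 * a (index169 i n)"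
        by simp
      moreover have "(13::int) ^ (4 * k) dvd 13 ^ 9 * 13 ^ (4 * i)"
        unfolding power_add [symmetric] using Suc \<open>k = Suc j\<close> by (intro le_imp_power_dvd) simp
      ultimately have "13 ^ (4 * k) dvd 13 ^ 9 * a (index169 i n)"
        by (rule dvd_trans [rotated])
      moreover have "(N + 7) div 169 = index169 i n"
        by (simp add: N_def Suc)
      ultimately show ?thesis
        by simp
    qed
    have "a (index169 k n) = hecke_coeff s a N - (13 ^ 4 * s * chi13 (24 * N - 1) * a N +
        (if 169 dvd N + 7 then 13 ^ 9 * a ((N + 7) div 169) else 0))"
      by (simp add: hecke_coeff_def N_def Suc)
    then show ?thesis
      using 1 2 3 by (simp only: dvd_diff dvd_add)
  qed simp
qed

section \<open>Application to the coefficients of E6 / eta\<close>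

lemma eta_basis_0: "eta_basis 0 (int n) = e6 n"
  by (simp add: eta_basis_def e6_def e6_fps_def partition_fps_def)

text \<open>The only nonzero coefficient at n <= 0 sits at n = 0, where 24 n - 1 = - 1 is prime to
  13.\<close>

lemma eta_basis_0_divisible: "eta_basis 0 \<in> divisible_forms"
proof -
  have "13 ^ (2 * e) dvd eta_basis 0 n" if n: "n \<le> 0" and e: "13 ^ e dvd 24 * n - 1" for n :: int and e
  proof (cases "n = 0")
    case True
    then have "(13::int) ^ e dvd 1"
      using e by simp
    have "e = 0"
    proof (rule ccontr)
      assume "e \<noteq> 0"
      then have "(13::int) dvd 13 ^ e"
        by simp
      then have "(13::int) dvd 1"
        using \<open>13 ^ e dvd 1\<close> by (rule dvd_trans)
      then show False
        by simp
    qed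
    then show ?thesis
      by simp
  next
    case False
    with n show ?thesis
      by (simp add: eta_basis_def)
  qed
  with eta_basis_eta_forms show ?thesis
    by (simp add: divisible_forms_def)
qed

text \<open>As 169 = 1 modulo 24, the number 23 * 169 ^ k + 1 is divisible by 24. By
  \<open>index169_eq\<close> the quotient is \<open>index169 k 1\<close>.\<close>

lemma delta_13: "24 * int (delta 13 (2 * k)) = 23 * 169 ^ k + 1" if "k \<ge> 1"
proof -
  have "169 ^ k mod 24 = (1::nat)"
    using power_mod [of 169 "24::nat" k] by simp
  moreover have "(23 * 169 ^ k + 1) mod 24 = (23 * (169 ^ k mod 24) + 1) mod (24::nat)"
    by (metis mod_add_left_eq mod_mult_right_eq)
  ultimately have "24 dvd 23 * 169 ^ k + (1::nat)"
    by (simp add: dvd_eq_mod_eq_0)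
  then obtain d :: nat where d: "23 * 169 ^ k + 1 = 24 * d"
    by (elim dvdE)
  have ge: "(169::nat) ^ k \<ge> 169"
    using that power_increasing [of 1 k "169::nat"] by simp
  have pow: "13 ^ (2 * k) = (169::nat) ^ k"
    by (simp add: power_mult)
  have "delta 13 (2 * k) = d"
    unfolding delta_def
  proof (rule the1_equality)
    show "\<exists>!d. 0 < d \<and> d < (13::nat) ^ (2 * k) \<and> [24 * d = 1] (mod 13 ^ (2 * k))"
      by (rule delta_ex1) (use that in auto)
    have "[23 * 169 ^ k + 1 = (1::nat)] (mod 169 ^ k)"
      by (simp only: cong_add_rcancel_0_nat cong_0_iff) simp
    moreover have "d < 169 ^ k"
      using d ge by linarith
    moreover have "0 < d"
      using d by (intro gr0I) simp
    ultimately show "0 < d \<and> d < 13 ^ (2 * k) \<and> [24 * d = 1] (mod 13 ^ (2 * k))"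
      unfolding pow d by blast
  qed
  then show ?thesis
    using arg_cong [OF d, of int] by simp
qed

theorem theorem6p10:
  fixes k n :: nat
  assumes "k \<ge> 1"
  shows "[e6 (13 ^ (2 * k) * n + delta 13 (2 * k)) = 0] (mod 13 ^ (2 * k))"
proof -
  define N where "N = 13 ^ (2 * k) * n + delta 13 (2 * k)"
  have "13 ^ (2 * k) = (169::nat) ^ k"
    by (simp add: power_mult)
  \<comment> \<open>Both sides are 169 ^ k (24 n + 23), and 24 n + 23 = 24 (n + 1) - 1 accounts for
    the shift to n + 1.\<close>
  then have "24 * int N - 1 = 24 * index169 k (int n + 1) - 1"
    unfolding index169_eq N_def using delta_13 [OF assms] by (simp add: algebra_simps)
  then have "int N = index169 k (int n + 1)"
    by simp
  then have "13 ^ (4 * k) dvd e6 N"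
    using divisible_forms_index169 [OF eta_basis_0_divisible, of k "int n + 1"]
    by (simp flip: eta_basis_0)
  moreover have "(13::int) ^ (2 * k) dvd 13 ^ (4 * k)"
    by (rule le_imp_power_dvd) simp
  ultimately have "13 ^ (2 * k) dvd e6 N"
    by (rule dvd_trans [rotated])
  then show ?thesis
    by (simp add: cong_0_iff N_def)
qed

end
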